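(* Let $d\ge 1$ and let $f:\mathbb T^d\to\mathbb T^d$ be a $C^\infty$ diffeomorphism preserving Lebesgue measure. Assume that $f$ exhibits $\kappa$-uniform $H^{-1}$ decay at rate $\gamma>0$. Let $b\in C^\infty(\mathbb T^d)$ be mean-zero with $\|b\|=1$, let $(\omega_n)_{n\ge1}$ be an IID sequence of square-integrable real random variables with $\mathbb E[\omega_n]=0$ and $\operatorname{Var}(\omega_n)=1$, and consider the Markov chain $g_{n+1}=\mathcal L_{f,\kappa}g_n+\omega_{n+1}b$ on the space of mean-zero functions in $L^2(\mathbb T^d)$. Let $\Lambda=\log\sup_{x\in\mathbb T^d}|(Df_x)^{-1}|$. Then: (i) For every $\kappa>0$ the Markov chain $(g_n)$ admits a unique stationary measure $\mu_{f,\kappa}$ on the mean-zero functions in $L^2$, and $\mu_{f,\kappa}$ is the law of $$g_{f,\kappa}=\sum_{n=0}^\infty \eta_n\,\mathcal L_{f,\kappa}^n b,$$ where $(\eta_n)_{n\ge0}$ is an IID sequence with the same law as the $\omega_n$. (ii) There exists a constant $C>0$, independent of $\kappa$, such that for all sufficiently small $\kappa>0$ and all $N$ with $2\le N\le\kappa^{-1/2}$, $$\frac{1}{2\Lambda}\log N-C\;\le\;\mathbb E\|\Pi_{\le N}g_{f,\kappa}\|^2\;\le\;\frac{2}{\gamma}\log N+C,$$ and $$\mathbb E\big\|\Pi_{\ge \kappa^{-1/2}}\,g_{f,\kappa}\big\|^2\le C.$$ ($C$ is also independent of $N$.)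
   Context: $\mathbb T^d=\mathbb R^d/\mathbb Z^d$; $e_k(x)=e^{2\pi i k\cdot x}$ and $\hat h(k)$, $k\in\mathbb Z^d$, are Fourier coefficients. $\|\cdot\|$ is the $L^2$ norm. $\mathcal L_f[\varphi]=\varphi\circ f^{-1}$; $e^{t\Delta}$ is the heat semigroup on $\mathbb T^d$ (so $e^{t\Delta}e_k=e^{-4\pi^2t|k|^2}e_k$), and $\mathcal L_{f,\kappa}=e^{\kappa\Delta}\circ\mathcal L_f$ for $\kappa\ge0$. $\Pi_{\le N}$ (resp. $\Pi_{\ge N}$) is the $L^2$-orthogonal projection onto Fourier modes with $|k|\le N$ (resp. $|k|\ge N$). For $s\in\mathbb R$, $\|h\|_{H^s}^2=\sum_{k\ne0}|k|^{2s}|\hat h(k)|^2$. Definition: $f$ exhibits $\kappa$-uniform $H^{-1}$ decay at rate $\gamma>0$ if for every smooth mean-zero $h:\mathbb T^d\to\mathbb R$ there is $C_h>0$ such that $\|\mathcal L_{f,\kappa}^nh\|_{H^{-1}}\le C_he^{-\gamma n}$ for all $\kappa\ge0$ and $n\ge1$ (with $\gamma$ and $C_h$ independent of $\kappa$). *)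

theory Defs
  imports "HOL-Probability.Probability"
begin

section \<open>The torus and its Lebesgue measure\<close>

definition int_congruent :: "real^'n \<Rightarrow> real^'n \<Rightarrow> bool" where
  "int_congruent x y \<longleftrightarrow> (\<forall>i. x $ i - y $ i \<in> \<int>)"

lemma int_congruent_equivp: "equivp int_congruent"
proof (rule equivpI)
  show "reflp int_congruent"
    by (auto simp: reflp_def int_congruent_def)
  show "symp int_congruent"
    unfolding symp_def int_congruent_def by (metis Ints_minus minus_diff_eq)
  show "transp int_congruent"
    unfolding transp_def int_congruent_def
  proof (intro allI impI)
    fix x y z :: "real^'n" and i
    assume "\<forall>i. x $ i - y $ i \<in> \<int>" "\<forall>i. y $ i - z $ i \<in> \<int>"
    then have "(x $ i - y $ i) + (y $ i - z $ i) \<in> \<int>"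
      by (intro Ints_add) auto
    then show "x $ i - z $ i \<in> \<int>" by simp
  qed
qed

quotient_type (overloaded) 'n torus = "real^('n::finite)" / int_congruent
  by (rule int_congruent_equivp)

instantiation torus :: (finite) topological_space
begin

definition open_torus :: "'a torus set \<Rightarrow> bool" where
  "open_torus U \<longleftrightarrow> open (abs_torus -` U)"

instance
proof
  show "open (UNIV :: 'a torus set)"
    by (simp add: open_torus_def)
  show "open (S \<inter> T)" if "open S" "open T" for S T :: "'a torus set"
    using that by (simp add: open_torus_def vimage_Int open_Int)
  show "open (\<Union>K)" if "\<forall>S\<in>K. open S" for K :: "'a torus set set"
    using that by (auto simp: open_torus_def vimage_Union)
qed

end

definition torus_lebesgue :: "('n::finite) torus measure" where
  "torus_lebesgue =
     distr (restrict_space lborel {x :: real^'n. \<forall>i. 0 \<le> x $ i \<and> x $ i < 1}) borel abs_torus"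

section \<open>Smoothness\<close>

text \<open>In finite dimension, being \<open>n\<close> times continuously differentiable amounts to differentiability
  together with all directional derivatives being \<open>n - 1\<close> times continuously differentiable.\<close>

primrec Ck :: "nat \<Rightarrow> ('a::euclidean_space \<Rightarrow> 'b::euclidean_space) \<Rightarrow> bool" where
  "Ck 0 F \<longleftrightarrow> continuous_on UNIV F"
| "Ck (Suc n) F \<longleftrightarrow>
     (\<forall>x. F differentiable (at x)) \<and> (\<forall>v. Ck n (\<lambda>x. frechet_derivative F (at x) v))"

definition C_inf :: "('a::euclidean_space \<Rightarrow> 'b::euclidean_space) \<Rightarrow> bool" where
  "C_inf F \<longleftrightarrow> (\<forall>n. Ck n F)"

definition smooth_function :: "(('n::finite) torus \<Rightarrow> real) \<Rightarrow> bool" where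
  "smooth_function h \<longleftrightarrow> C_inf (\<lambda>x. h (abs_torus x))"

text \<open>As \<open>\<real>\<^sup>n\<close> is the universal cover of the torus, a self-map of the torus is smooth iff it
  has a smooth lift. Two lifts differ by a constant in \<open>\<int>\<^sup>n\<close>, so the derivative below depends
  neither on the choice of the lift nor on the representative of the point; it is the differential
  under the canonical identification of all tangent spaces with \<open>\<real>\<^sup>n\<close>.\<close>

definition smooth_lift :: "(('n::finite) torus \<Rightarrow> 'n torus) \<Rightarrow> (real^'n \<Rightarrow> real^'n) \<Rightarrow> bool" where
  "smooth_lift f F \<longleftrightarrow> C_inf F \<and> (\<forall>x. f (abs_torus x) = abs_torus (F x))"

definition smooth_map :: "(('n::finite) torus \<Rightarrow> 'n torus) \<Rightarrow> bool" where
  "smooth_map f \<longleftrightarrow> (\<exists>F. smooth_lift f F)"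

definition smooth_diffeo :: "(('n::finite) torus \<Rightarrow> 'n torus) \<Rightarrow> bool" where
  "smooth_diffeo f \<longleftrightarrow> bij f \<and> smooth_map f \<and> smooth_map (inv f)"

definition torus_deriv :: "(('n::finite) torus \<Rightarrow> 'n torus) \<Rightarrow> 'n torus \<Rightarrow> real^'n \<Rightarrow> real^'n" where
  "torus_deriv f p = frechet_derivative (SOME F. smooth_lift f F) (at (rep_torus p))"

definition Lambda_of :: "(('n::finite) torus \<Rightarrow> 'n torus) \<Rightarrow> real" where
  "Lambda_of f = ln (SUP p. onorm (inv (torus_deriv f p)))"

definition preserves_lebesgue :: "(('n::finite) torus \<Rightarrow> 'n torus) \<Rightarrow> bool" where
  "preserves_lebesgue f \<longleftrightarrow>
     f \<in> measurable torus_lebesgue torus_lebesgue \<and>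
     distr torus_lebesgue torus_lebesgue f = torus_lebesgue"

section \<open>Fourier analysis\<close>

definition real_vec :: "int^'n \<Rightarrow> real^('n::finite)" where
  "real_vec k = (\<chi> i. real_of_int (k $ i))"

lift_definition fourier_mode :: "int^'n \<Rightarrow> ('n::finite) torus \<Rightarrow> complex"
  is "\<lambda>k x. exp (2 * of_real pi * \<i> * of_real (real_vec k \<bullet> x))"
proof -
  fix k :: "int^'n" and x y :: "real^'n"
  assume "int_congruent x y"
  then have *: "real_of_int (k $ i) * (x $ i - y $ i) \<in> \<int>" for i
    by (intro Ints_mult) (auto simp: int_congruent_def)
  have "real_vec k \<bullet> x - real_vec k \<bullet> y = (\<Sum>i\<in>UNIV. real_of_int (k $ i) * (x $ i - y $ i))"
    by (simp add: inner_vec_def real_vec_def sum_subtractf right_diff_distrib)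
  also have "\<dots> \<in> \<int>" by (intro Ints_sum *)
  finally obtain m :: int where m: "real_vec k \<bullet> x - real_vec k \<bullet> y = of_int m"
    by (auto elim: Ints_cases)
  then have "real_vec k \<bullet> x = real_vec k \<bullet> y + of_int m" by simp
  then have "2 * of_real pi * \<i> * complex_of_real (real_vec k \<bullet> x) =
      2 * of_real pi * \<i> * of_real (real_vec k \<bullet> y) + (2 * of_int m * of_real pi) * \<i>"
    by (simp add: algebra_simps)
  then show "exp (2 * of_real pi * \<i> * complex_of_real (real_vec k \<bullet> x)) =
      exp (2 * of_real pi * \<i> * of_real (real_vec k \<bullet> y))"
    unfolding exp_eq by (intro exI[of _ m]) simp
qed

definition fourier_coeff :: "(('n::finite) torus \<Rightarrow> real) \<Rightarrow> int^'n \<Rightarrow> complex" where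
  "fourier_coeff h k = (LINT x|torus_lebesgue. of_real (h x) * cnj (fourier_mode k x))"

definition L2_norm :: "(('n::finite) torus \<Rightarrow> real) \<Rightarrow> real" where
  "L2_norm h = sqrt (LINT x|torus_lebesgue. (h x)\<^sup>2)"

text \<open>For \<open>s \<le> 0\<close>, the only case needed, the sum converges for every square-integrable \<open>h\<close>.\<close>

definition sobolev_norm :: "real \<Rightarrow> (('n::finite) torus \<Rightarrow> real) \<Rightarrow> real" where
  "sobolev_norm s h =
     sqrt (\<Sum>\<^sub>\<infinity>k\<in>UNIV - {0}. norm (real_vec k) powr (2 * s) * (norm (fourier_coeff h k))\<^sup>2)"

text \<open>All functions are real-valued, so \<open>fourier_coeff h (- k)\<close> is the conjugate of
  \<open>fourier_coeff h k\<close> and the sums below are real; \<open>Re\<close> only changes the type. In particular,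
  \<open>proj_ge N\<close> is the projection complementary to that onto the modes with \<open>\<bar>k\<bar> < N\<close>.\<close>

definition proj_le :: "real \<Rightarrow> (('n::finite) torus \<Rightarrow> real) \<Rightarrow> 'n torus \<Rightarrow> real" where
  "proj_le N h x = Re (\<Sum>k | norm (real_vec k) \<le> N. fourier_coeff h k * fourier_mode k x)"

definition proj_ge :: "real \<Rightarrow> (('n::finite) torus \<Rightarrow> real) \<Rightarrow> 'n torus \<Rightarrow> real" where
  "proj_ge N h x = h x - Re (\<Sum>k | norm (real_vec k) < N. fourier_coeff h k * fourier_mode k x)"

text \<open>For \<open>t > 0\<close> the Fourier series of the heat semigroup converges absolutely at every point.
  For \<open>t = 0\<close> it need not converge pointwise, hence the case distinction.\<close>

definition heat :: "real \<Rightarrow> (('n::finite) torus \<Rightarrow> real) \<Rightarrow> 'n torus \<Rightarrow> real" where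
  "heat t h = (if t = 0 then h else
     (\<lambda>x. Re (\<Sum>\<^sub>\<infinity>k. of_real (exp (- 4 * pi\<^sup>2 * t * (norm (real_vec k))\<^sup>2))
                     * fourier_coeff h k * fourier_mode k x)))"

definition transfer :: "(('n::finite) torus \<Rightarrow> 'n torus) \<Rightarrow> real \<Rightarrow> ('n torus \<Rightarrow> real) \<Rightarrow> 'n torus \<Rightarrow> real" where
  "transfer f \<kappa> h = heat \<kappa> (h \<circ> inv f)"

definition mean_zero :: "(('n::finite) torus \<Rightarrow> real) \<Rightarrow> bool" where
  "mean_zero h \<longleftrightarrow> (LINT x|torus_lebesgue. h x) = 0"

definition uniform_Hminus1_decay :: "(('n::finite) torus \<Rightarrow> 'n torus) \<Rightarrow> real \<Rightarrow> bool" where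
  "uniform_Hminus1_decay f \<gamma> \<longleftrightarrow> \<gamma> > 0 \<and>
     (\<forall>h. smooth_function h \<and> mean_zero h \<longrightarrow>
        (\<exists>C>0. \<forall>\<kappa>\<ge>0. \<forall>n\<ge>1. sobolev_norm (-1) ((transfer f \<kappa> ^^ n) h) \<le> C * exp (- \<gamma> * real n)))"

section \<open>The Markov chain on mean-zero square-integrable functions\<close>

text \<open>Points of \<open>L2_zero\<close> are functions, not almost-everywhere classes. The \<open>\<sigma>\<close>-algebra is generated
  by the sets open in the \<open>L\<^sup>2\<close> seminorm. Such sets are saturated under almost-everywhere equality,
  so this is the pullback of the Borel \<open>\<sigma>\<close>-algebra of the Hilbert space of classes under the
  quotient map, and measures on the two \<open>\<sigma>\<close>-algebras correspond bijectively.\<close>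

definition L2_zero :: "(('n::finite) torus \<Rightarrow> real) set" where
  "L2_zero = {h \<in> borel_measurable torus_lebesgue.
     integrable torus_lebesgue (\<lambda>x. (h x)\<^sup>2) \<and> mean_zero h}"

definition L2_zero_borel :: "(('n::finite) torus \<Rightarrow> real) measure" where
  "L2_zero_borel = sigma L2_zero
     {U. U \<subseteq> L2_zero \<and> (\<forall>g\<in>U. \<exists>e>0. \<forall>h\<in>L2_zero. L2_norm (\<lambda>x. h x - g x) < e \<longrightarrow> h \<in> U)}"

text \<open>The law of \<open>g\<^sub>n\<^sub>+\<^sub>1\<close> given \<open>g\<^sub>n = g\<close>, where \<open>\<nu>\<close> is the common law of the innovations
  \<open>\<omega>\<^sub>n\<close>. A stationary measure is an invariant probability measure of this kernel.\<close>

definition transition_kernel ::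
  "(('n::finite) torus \<Rightarrow> 'n torus) \<Rightarrow> real \<Rightarrow> ('n torus \<Rightarrow> real) \<Rightarrow> real measure
     \<Rightarrow> ('n torus \<Rightarrow> real) \<Rightarrow> ('n torus \<Rightarrow> real) measure" where
  "transition_kernel f \<kappa> b \<nu> g = distr \<nu> L2_zero_borel (\<lambda>w x. transfer f \<kappa> g x + w * b x)"

definition stationary_measure ::
  "(('n::finite) torus \<Rightarrow> 'n torus) \<Rightarrow> real \<Rightarrow> ('n torus \<Rightarrow> real) \<Rightarrow> real measure
     \<Rightarrow> ('n torus \<Rightarrow> real) measure \<Rightarrow> bool" where
  "stationary_measure f \<kappa> b \<nu> \<mu> \<longleftrightarrow>
     prob_space \<mu> \<and> sets \<mu> = sets L2_zero_borel \<and>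
     (\<forall>A\<in>sets L2_zero_borel. emeasure \<mu> A = (\<integral>\<^sup>+g. emeasure (transition_kernel f \<kappa> b \<nu> g) A \<partial>\<mu>))"

text \<open>\<open>g\<close> is a version of the random series \<open>\<Sum>n. \<eta>\<^sub>n \<L>\<^sup>n b\<close>, convergent in \<open>L\<^sup>2\<close> almost surely.\<close>

definition is_random_series ::
  "'w measure \<Rightarrow> (nat \<Rightarrow> 'w \<Rightarrow> real) \<Rightarrow> (('n::finite) torus \<Rightarrow> 'n torus) \<Rightarrow> real \<Rightarrow> ('n torus \<Rightarrow> real)
     \<Rightarrow> ('w \<Rightarrow> 'n torus \<Rightarrow> real) \<Rightarrow> bool" where
  "is_random_series M \<eta> f \<kappa> b g \<longleftrightarrow>
     g \<in> measurable M L2_zero_borel \<and>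
     (AE w in M. (\<lambda>n. L2_norm (\<lambda>x. g w x - (\<Sum>j<n. \<eta> j w * (transfer f \<kappa> ^^ j) b x)))
                   \<longlonglongrightarrow> 0)"

definition iid_on :: "'w measure \<Rightarrow> (nat \<Rightarrow> 'w \<Rightarrow> real) \<Rightarrow> nat set \<Rightarrow> real measure \<Rightarrow> bool" where
  "iid_on M X I \<nu> \<longleftrightarrow>
     prob_space.indep_vars M (\<lambda>_. borel) X I \<and> (\<forall>n\<in>I. distr M borel (X n) = \<nu>)"

end

theory Submission
  imports Defs
begin

text \<open>
  Write \<open>a\<^sub>n\<close> for the \<open>n\<close>-th iterate of \<open>b\<close> under the transfer operator. Since \<open>f\<close> preserves volume and the
  heat semigroup contracts mean-zero functions, \<open>\<Sum>\<^sub>n \<eta>\<^sub>n a\<^sub>n\<close> converges almost surely. Prepending a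
  fresh innovation to the noise sequence shows that its law is stationary; any other stationary law is
  the law of the iterate of an initial datum, which is forgotten in the limit, plus a partial sum of
  this series. Independence turns the second moment of a projected solution into \<open>\<Sum>\<^sub>n \<parallel>\<Pi> a\<^sub>n\<parallel>\<^sup>2\<close>.

  For \<open>\<Pi>\<close> the projection onto modes of size at most \<open>N\<close>, the \<open>n\<close>-th term is at most the minimum of \<open>1\<close>
  and \<open>N\<^sup>2\<close> times the squared negative Sobolev norm, so the sum is cut off exponentially after
  \<open>(log N) / \<gamma>\<close> terms. Conversely one step multiplies the Dirichlet energy by at most
  \<open>exp (2 \<Lambda>)\<close>, so that both the heat loss up to time \<open>n\<close> and the mass above frequency \<open>N\<close> are
  \<open>O(exp (2 \<Lambda> n) / N\<^sup>2)\<close> when \<open>\<kappa> N\<^sup>2 \<le> 1\<close>, and the first \<open>(log N) / \<Lambda>\<close> terms are close to \<open>1\<close>. Modes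
  above the dissipation scale are controlled by the telescoping energy losses.
\<close>

section \<open>The torus as a probability space\<close>

text \<open>Points of the state space are functions, so two versions of a random series agree almost
  surely only in their Fourier coefficients. Events and laws are therefore handled through the
  coefficient map: by completeness of the modes and separability, the \<sigma>-algebra of
  \<open>L2_zero_borel\<close> is the pullback of the product Borel structure. Hence measurability
  is checked mode by mode, events cannot separate functions with equal coefficients, and a law is
  determined by that of the coefficients. Uniqueness uses this together with a reversal of time: the
  newest innovation gets index 0, so that the solution converges almost surely and not just in law.
  L2 limits are mostly obtained from pointwise ones under an L2 majorant, which for the random
  series comes from the smoothing of the heat flow. The factors 1/2 and 2 in the logarithmic bounds
  leave room: the argument yields (log N) / \<Lambda> from below and (log N) / \<gamma> from above,
  up to constants.\<close>

definition unit_cube :: "(real^'n::finite) set" where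
  "unit_cube = {x. \<forall>i. 0 \<le> x $ i \<and> x $ i < 1}"

lemma abs_torus_eq_iff: "abs_torus x = abs_torus y \<longleftrightarrow> (\<forall>i. x $ i - y $ i \<in> \<int>)"
  by (simp add: torus.abs_eq_iff int_congruent_def)

lemma abs_rep_torus [simp]: "abs_torus (rep_torus p) = p"
  by (rule Quotient3_abs_rep[OF Quotient3_torus])

lemma continuous_torus_iff:
  "continuous_on UNIV h \<longleftrightarrow> continuous_on UNIV (\<lambda>x. h (abs_torus x))"
  by (simp add: continuous_on_open_vimage open_torus_def vimage_def)

lemma continuous_abs_torus: "continuous_on UNIV (abs_torus :: real^'n \<Rightarrow> 'n::finite torus)"
  by (simp add: continuous_on_open_vimage open_torus_def)

lemma measurable_abs_torus [measurable]:
  "(abs_torus :: real^'n \<Rightarrow> 'n::finite torus) \<in> borel_measurable borel"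
  by (rule borel_measurable_continuous_onI[OF continuous_abs_torus])

lemma unit_cube_borel [measurable]: "(unit_cube :: (real^'n::finite) set) \<in> sets borel"
proof -
  have "(unit_cube :: (real^'n) set) = (\<Inter>i\<in>UNIV. {x. 0 \<le> x $ i} \<inter> {x. x $ i < 1})"
    by (auto simp: unit_cube_def)
  also have "\<dots> \<in> sets borel"
    by (intro sets.finite_INT sets.Int) (auto simp: closed_halfspace_component_ge open_halfspace_component_lt
        closed_halfspace_component_ge_cart open_halfspace_component_lt_cart)
  finally show ?thesis .
qed

lemma torus_lebesgue_altdef:
  "torus_lebesgue = distr (restrict_space lborel unit_cube) borel abs_torus"
  by (simp add: torus_lebesgue_def unit_cube_def)

lemma sets_torus_lebesgue [simp, measurable_cong]: "sets torus_lebesgue = sets borel"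
  by (simp add: torus_lebesgue_altdef)

lemma space_torus_lebesgue [simp]: "space torus_lebesgue = UNIV"
  by (simp add: torus_lebesgue_altdef)

lemma abs_torus_measurable_restrict [measurable]:
  "abs_torus \<in> measurable (restrict_space lborel unit_cube) borel"
  by (rule measurable_restrict_space1) simp

lemma torus_integral:
  fixes h :: "'n::finite torus \<Rightarrow> 'b::{banach,second_countable_topology}"
  assumes [measurable]: "h \<in> borel_measurable borel"
  shows "(LINT p|torus_lebesgue. h p) = (LINT x|lborel. indicator unit_cube x *\<^sub>R h (abs_torus x))"
  unfolding torus_lebesgue_altdef by (simp add: integral_distr integral_restrict_space)

lemma torus_integrable_iff:
  fixes h :: "'n::finite torus \<Rightarrow> 'b::{banach,second_countable_topology}"
  assumes [measurable]: "h \<in> borel_measurable borel"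
  shows "integrable torus_lebesgue h \<longleftrightarrow>
    integrable lborel (\<lambda>x. indicator unit_cube x *\<^sub>R h (abs_torus x))"
  unfolding torus_lebesgue_altdef by (simp add: integrable_distr_eq integrable_restrict_space)

text \<open>The half-open cube lies between the open and the closed unit box, both of volume
  1.\<close>

lemma emeasure_unit_cube: "emeasure lborel (unit_cube :: (real^'n::finite) set) = 1"
proof (rule antisym)
  have inner1: "(1::real^'n) \<bullet> b = 1" if "b \<in> Basis" for b
    using that by (auto simp: Basis_vec_def inner_axis)
  have "emeasure lborel (unit_cube :: (real^'n) set) \<le> emeasure lborel (cbox 0 1 :: (real^'n) set)"
    by (rule emeasure_mono) (auto simp: unit_cube_def mem_box_cart less_imp_le)
  also have "\<dots> = 1"
    by (subst emeasure_lborel_cbox) (auto simp: inner1)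
  finally show "emeasure lborel (unit_cube :: (real^'n) set) \<le> 1" .
  have "1 = emeasure lborel (box 0 1 :: (real^'n) set)"
    by (subst emeasure_lborel_box) (auto simp: inner1)
  also have "\<dots> \<le> emeasure lborel (unit_cube :: (real^'n) set)"
    by (rule emeasure_mono) (auto simp: unit_cube_def mem_box_cart less_imp_le)
  finally show "1 \<le> emeasure lborel (unit_cube :: (real^'n) set)" .
qed

interpretation torus: prob_space "torus_lebesgue :: ('n::finite) torus measure"
proof
  show "emeasure (torus_lebesgue :: 'n torus measure) (space torus_lebesgue) = 1"
    unfolding torus_lebesgue_altdef
    by (simp add: emeasure_distr emeasure_restrict_space space_restrict_space emeasure_unit_cube)
qed

lemma torus_representative:
  obtains x where "x \<in> unit_cube" "p = abs_torus x"
proof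
  let ?x = "\<chi> i. frac (rep_torus p $ i)"
  show "?x \<in> unit_cube" by (simp add: unit_cube_def frac_lt_1)
  have "rep_torus p $ i - ?x $ i \<in> \<int>" for i
    by (simp add: frac_def)
  then show "p = abs_torus ?x"
    using abs_torus_eq_iff[of "rep_torus p" ?x] by simp
qed

text \<open>The quotient map is continuous and already the closed cube covers the torus.\<close>

lemma compact_torus: "compact (UNIV :: 'n::finite torus set)"
proof -
  have "(UNIV :: 'n torus set) = abs_torus ` cbox 0 1"
  proof (intro equalityI subsetI)
    fix p :: "'n torus"
    obtain x where "x \<in> unit_cube" "p = abs_torus x" by (rule torus_representative)
    then show "p \<in> abs_torus ` cbox 0 1"
      by (force simp: unit_cube_def mem_box_cart less_imp_le)
  qed simp
  also have "compact \<dots>"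
    by (rule compact_continuous_image[OF continuous_on_subset[OF continuous_abs_torus]]) auto
  finally show ?thesis .
qed

lemma continuous_torus_bounded:
  fixes h :: "'n::finite torus \<Rightarrow> 'b::real_normed_vector"
  assumes "continuous_on UNIV h"
  obtains B where "B > 0" "\<And>p. norm (h p) \<le> B"
proof -
  have "bounded (h ` UNIV)"
    by (intro compact_imp_bounded compact_continuous_image assms compact_torus)
  then show ?thesis using that by (auto simp: bounded_pos)
qed

lemma continuous_torus_measurable:
  "continuous_on UNIV h \<Longrightarrow> h \<in> borel_measurable torus_lebesgue"
  using borel_measurable_continuous_onI measurable_cong_sets[OF sets_torus_lebesgue refl] by blast

lemma continuous_torus_integrable:
  fixes h :: "'n::finite torus \<Rightarrow> 'b::{banach,second_countable_topology}"
  assumes "continuous_on UNIV h"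
  shows "integrable torus_lebesgue h"
proof -
  obtain B where "\<And>p. norm (h p) \<le> B" using continuous_torus_bounded[OF assms] by metis
  then show ?thesis
    by (intro torus.integrable_const_bound[where B=B] continuous_torus_measurable assms) auto
qed

section \<open>Translation invariance of the integral\<close>

lemma lborel_integral_shift:
  fixes g :: "'a::euclidean_space \<Rightarrow> 'b::{banach,second_countable_topology}"
  assumes [measurable]: "g \<in> borel_measurable borel"
  shows "(LINT x|lborel. g (x + a)) = (LINT x|lborel. g x)"
proof -
  have "(LINT x|lborel. g x) = (LINT x|distr lborel borel ((+) a). g x)"
    by (simp add: lborel_distr_plus)
  also have "\<dots> = (LINT x|lborel. g (a + x))"
    by (rule integral_distr) auto
  finally show ?thesis by (simp add: add.commute)
qed

text \<open>The shifted cube is cut along the hyperplane where it leaves the unit cube, and the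
  overhanging piece is moved back by one period. Orthogonality of the modes and integration by parts
  both rest on this invariance.\<close>

lemma torus_integral_shift:
  fixes h :: "'n::finite torus \<Rightarrow> 'b::{banach,second_countable_topology}"
  assumes h: "continuous_on UNIV h" and t: "0 \<le> t" "t \<le> 1"
  shows "(LINT x|lborel. indicator unit_cube x *\<^sub>R h (abs_torus (x + t *\<^sub>R axis i 1))) =
    (LINT p|torus_lebesgue. h p)"
proof -
  have hm [measurable]: "h \<in> borel_measurable borel" by (rule borel_measurable_continuous_onI[OF h])
  \<comment> \<open>\<open>D1\<close> receives the shifted points that stay inside the cube,
    \<open>D2\<close> those that overshoot and are brought back by \<open>axis i 1\<close>.\<close>
  define D1 D2 where "D1 = unit_cube \<inter> {x::real^'n. t \<le> x $ i}" and "D2 = unit_cube \<inter> {x::real^'n. x $ i < t}"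
  let ?a = "t *\<^sub>R axis i 1 :: real^'n"
  have [measurable]: "D1 \<in> sets borel" "D2 \<in> sets borel"
    unfolding D1_def D2_def
    by (auto intro!: sets.Int simp: closed_halfspace_component_ge_cart open_halfspace_component_lt_cart)
  define g1 g2 where "g1 = (\<lambda>x. indicator D1 x *\<^sub>R h (abs_torus x))" and "g2 = (\<lambda>x. indicator D2 x *\<^sub>R h (abs_torus x))"
  have [measurable]: "g1 \<in> borel_measurable borel" "g2 \<in> borel_measurable borel"
    by (simp_all add: g1_def g2_def)
  have int: "integrable lborel (\<lambda>x. indicator unit_cube x *\<^sub>R h (abs_torus x))"
    using continuous_torus_integrable[OF h] by (simp add: torus_integrable_iff)
  have i1: "integrable lborel g1" unfolding g1_def
    by (rule Bochner_Integration.integrable_bound[OF int]) (auto simp: D1_def indicator_def)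
  have i2: "integrable lborel g2" unfolding g2_def
    by (rule Bochner_Integration.integrable_bound[OF int]) (auto simp: D2_def indicator_def)
  have shift: "indicator unit_cube x *\<^sub>R h (abs_torus (x + ?a)) = g1 (x + ?a) + g2 (x + (?a - axis i 1))" for x
  proof -
    have comp: "(x + ?a) $ j = x $ j + (if j = i then t else 0)"
      "(x + (?a - axis i 1)) $ j = x $ j + (if j = i then t - 1 else 0)" for j
      by (auto simp: axis_def)
    have cube: "y \<in> unit_cube \<longleftrightarrow> (0 \<le> y $ i \<and> y $ i < 1) \<and> (\<forall>j. j \<noteq> i \<longrightarrow> 0 \<le> y $ j \<and> y $ j < 1)" for y :: "real^'n"
      unfolding unit_cube_def by auto
    have 1: "x + ?a \<in> D1 \<longleftrightarrow> x \<in> unit_cube \<and> x $ i < 1 - t"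
      unfolding D1_def Int_iff cube using t by (auto simp: comp axis_def)
    have 2: "x + (?a - axis i 1) \<in> D2 \<longleftrightarrow> x \<in> unit_cube \<and> x $ i \<ge> 1 - t"
      unfolding D2_def Int_iff cube using t by (auto simp: comp axis_def)
    have 3: "abs_torus (x + (?a - axis i 1)) = abs_torus (x + ?a)"
      unfolding abs_torus_eq_iff by (simp add: axis_def)
    show ?thesis
      unfolding g1_def g2_def 3 using 1 2 by (auto simp: indicator_def)
  qed
  have shint: "integrable lborel (\<lambda>x. g (x + a))" if "integrable lborel g"
    "g \<in> borel_measurable borel" for g :: "real^'n \<Rightarrow> 'b" and a
  proof -
    have "integrable (distr lborel borel ((+) a)) g" by (simp add: lborel_distr_plus that)
    then show ?thesis
      by (subst (asm) integrable_distr_eq) (auto simp: that add.commute)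
  qed
  have "(LINT x|lborel. indicator unit_cube x *\<^sub>R h (abs_torus (x + ?a))) =
     (LINT x|lborel. g1 (x + ?a)) + (LINT x|lborel. g2 (x + (?a - axis i 1)))"
    unfolding shift by (intro Bochner_Integration.integral_add shint i1 i2) auto
  also have "\<dots> = (LINT x|lborel. g1 x) + (LINT x|lborel. g2 x)"
    by (simp add: lborel_integral_shift)
  also have "\<dots> = (LINT x|lborel. g1 x + g2 x)" using i1 i2 by simp
  also have "\<dots> = (LINT x|lborel. indicator unit_cube x *\<^sub>R h (abs_torus x))"
    by (intro Bochner_Integration.integral_cong) (auto simp: g1_def g2_def D1_def D2_def indicator_def)
  finally show ?thesis by (simp add: torus_integral)
qed

section \<open>Fourier modes\<close>

lemma real_vec_simps [simp]:
  "real_vec (0 :: int^'n::finite) = 0" "real_vec (- k) = - real_vec k"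
  "real_vec (k + l) = real_vec k + real_vec l" "real_vec (k - l) = real_vec k - real_vec l"
  by (simp_all add: real_vec_def vec_eq_iff)

lemma real_vec_nth [simp]: "real_vec k $ i = real_of_int (k $ i)"
  by (simp add: real_vec_def)

lemma real_vec_eq_0_iff [simp]: "real_vec k = 0 \<longleftrightarrow> k = 0"
  by (simp add: vec_eq_iff)

lemma fourier_mode_abs: "fourier_mode k (abs_torus x) = cis (2 * pi * (real_vec k \<bullet> x))"
  by (simp add: fourier_mode.abs_eq cis_conv_exp mult_ac)

lemma fourier_mode_0 [simp]: "fourier_mode 0 p = 1"
  by (cases p rule: torus_representative) (simp add: fourier_mode_abs)

lemma fourier_mode_add: "fourier_mode (k + l) p = fourier_mode k p * fourier_mode l p"
  by (cases p rule: torus_representative)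
     (simp add: fourier_mode_abs cis_mult inner_add_left algebra_simps)

lemma fourier_mode_minus: "fourier_mode (- k) p = cnj (fourier_mode k p)"
  by (cases p rule: torus_representative) (simp add: fourier_mode_abs cis_cnj)

lemma norm_fourier_mode [simp]: "norm (fourier_mode k p) = 1"
  by (cases p rule: torus_representative) (simp add: fourier_mode_abs)

lemma continuous_fourier_mode: "continuous_on UNIV (fourier_mode k)"
  unfolding continuous_torus_iff fourier_mode_abs
  by (auto simp: cis_conv_exp intro!: continuous_intros)

lemma fourier_mode_measurable [measurable]: "fourier_mode k \<in> borel_measurable borel"
  by (rule borel_measurable_continuous_onI[OF continuous_fourier_mode])

text \<open>A shift by half a wavelength along a coordinate with \<open>k $ i\<close> nonzero
  changes the sign of the mode, so its integral equals its own negative.\<close>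

lemma integral_fourier_mode:
  "(LINT p|torus_lebesgue. fourier_mode k p) = (if k = 0 then 1 else 0)"
proof (cases "k = 0")
  case True
  then show ?thesis by (simp add: torus.prob_space[unfolded space_torus_lebesgue])
next
  case False
  then obtain i where i: "k $ i \<noteq> 0" by (auto simp: vec_eq_iff)
  define t :: real where "t = 1 / (2 * \<bar>k $ i\<bar>)"
  have t: "0 \<le> t" "t \<le> 1" using i by (auto simp: t_def divide_simps)
  have s: "real_of_int (k $ i) * t = sgn (real_of_int (k $ i)) / 2"
    using i by (auto simp: t_def divide_simps sgn_if)
  have "cis (2 * pi * (real_vec k \<bullet> (t *\<^sub>R axis i 1))) = cis (pi * sgn (real_of_int (k $ i)))"
    using s by (simp add: inner_axis mult_ac)
  also have "\<dots> = -1" using i by (auto simp: sgn_if cis_conv_exp exp_minus)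
  finally have c: "cis (2 * pi * (real_vec k \<bullet> (t *\<^sub>R axis i 1))) = -1" .
  have neg: "fourier_mode k (abs_torus (x + t *\<^sub>R axis i 1)) = - fourier_mode k (abs_torus x)" for x
    unfolding fourier_mode_abs inner_add_right distrib_left using c by (simp flip: cis_mult)
  have "(LINT p|torus_lebesgue. fourier_mode k p) =
     (LINT x|lborel. indicator unit_cube x *\<^sub>R fourier_mode k (abs_torus (x + t *\<^sub>R axis i 1)))"
    by (rule torus_integral_shift[symmetric]) (use t in \<open>auto simp: continuous_fourier_mode\<close>)
  also have "\<dots> = (LINT x|lborel. - (indicator unit_cube x *\<^sub>R fourier_mode k (abs_torus x)))"
    by (simp add: neg)
  also have "\<dots> = - (LINT p|torus_lebesgue. fourier_mode k p)"
    by (simp add: torus_integral)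
  finally show ?thesis using False by simp
qed

section \<open>Square-integrable functions\<close>

definition L2_fun :: "('n::finite torus \<Rightarrow> real) set" where
  "L2_fun = {h \<in> borel_measurable torus_lebesgue. integrable torus_lebesgue (\<lambda>x. (h x)\<^sup>2)}"

definition L2_inner :: "('n::finite torus \<Rightarrow> real) \<Rightarrow> ('n torus \<Rightarrow> real) \<Rightarrow> real" where
  "L2_inner g h = (LINT x|torus_lebesgue. g x * h x)"

lemma L2_fun_measurable: "h \<in> L2_fun \<Longrightarrow> h \<in> borel_measurable torus_lebesgue"
  by (simp add: L2_fun_def)

lemma L2_fun_integrable_mult:
  assumes "g \<in> L2_fun" "h \<in> L2_fun"
  shows "integrable torus_lebesgue (\<lambda>x. g x * h x)"
proof (rule Bochner_Integration.integrable_bound)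
  show "integrable torus_lebesgue (\<lambda>x. (g x)\<^sup>2 + (h x)\<^sup>2)"
    using assms by (simp add: L2_fun_def)
  show "(\<lambda>x. g x * h x) \<in> borel_measurable torus_lebesgue"
    using assms L2_fun_measurable by (intro borel_measurable_times) blast+
  show "AE x in torus_lebesgue. norm (g x * h x) \<le> norm ((g x)\<^sup>2 + (h x)\<^sup>2)"
  proof (rule AE_I2)
    fix x
    have "2 * (\<bar>g x\<bar> * \<bar>h x\<bar>) \<le> (g x)\<^sup>2 + (h x)\<^sup>2"
      using sum_squares_bound[of "\<bar>g x\<bar>" "\<bar>h x\<bar>"] by simp
    then show "norm (g x * h x) \<le> norm ((g x)\<^sup>2 + (h x)\<^sup>2)"
      by (auto simp: abs_mult intro: order_trans[rotated])
  qed
qed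

lemma L2_fun_bounded:
  assumes "h \<in> borel_measurable torus_lebesgue" "\<And>x. \<bar>h x\<bar> \<le> B"
  shows "h \<in> L2_fun"
proof -
  have "(h x)\<^sup>2 \<le> B\<^sup>2" for x
    using assms(2)[of x] by (rule power2_le_iff_abs_le[THEN iffD2, rotated]) (use assms(2)[of x] in linarith)
  then have "integrable torus_lebesgue (\<lambda>x. (h x)\<^sup>2)"
    using assms(1) by (intro torus.integrable_const_bound[where B="B\<^sup>2"]) auto
  then show ?thesis using assms by (simp add: L2_fun_def)
qed

lemma L2_fun_const [simp]: "(\<lambda>_. c) \<in> L2_fun"
  by (rule L2_fun_bounded[where B="\<bar>c\<bar>"]) auto

lemma L2_fun_integrable: "h \<in> L2_fun \<Longrightarrow> integrable torus_lebesgue h"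
  using L2_fun_integrable_mult[OF _ L2_fun_const[of 1]] by simp

lemma L2_fun_continuous:
  assumes "continuous_on UNIV h" shows "h \<in> L2_fun"
proof -
  obtain B where "\<And>p. norm (h p) \<le> B" using continuous_torus_bounded[OF assms] by metis
  then show ?thesis by (intro L2_fun_bounded[where B=B] continuous_torus_measurable assms) auto
qed

lemma L2_fun_scale: "h \<in> L2_fun \<Longrightarrow> (\<lambda>x. c * h x) \<in> L2_fun"
  by (auto simp: L2_fun_def power_mult_distrib)

lemma L2_fun_add: "g \<in> L2_fun \<Longrightarrow> h \<in> L2_fun \<Longrightarrow> (\<lambda>x. g x + h x) \<in> L2_fun"
  using L2_fun_integrable_mult[of g h]
  by (auto simp: L2_fun_def power2_sum mult.assoc)

lemma L2_fun_diff: "g \<in> L2_fun \<Longrightarrow> h \<in> L2_fun \<Longrightarrow> (\<lambda>x. g x - h x) \<in> L2_fun"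
  using L2_fun_add[OF _ L2_fun_scale[of h "-1"], of g] by simp

lemma L2_fun_sum: "(\<And>i. i \<in> I \<Longrightarrow> h i \<in> L2_fun) \<Longrightarrow> (\<lambda>x. \<Sum>i\<in>I. h i x) \<in> L2_fun"
  by (induction I rule: infinite_finite_induct) (simp_all add: L2_fun_add)

lemma L2_inner_commute: "L2_inner g h = L2_inner h g"
  by (simp add: L2_inner_def mult.commute)

lemma L2_inner_scale: "L2_inner (\<lambda>x. c * g x) h = c * L2_inner g h"
  by (simp add: L2_inner_def mult.assoc)

lemma L2_norm_nonneg [simp]: "0 \<le> L2_norm h"
  by (simp add: L2_norm_def)

lemma L2_norm_power2: "(L2_norm h)\<^sup>2 = L2_inner h h"
  by (simp add: L2_norm_def L2_inner_def power2_eq_square)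

lemma L2_norm_power2_diff:
  assumes "g \<in> L2_fun" "h \<in> L2_fun"
  shows "(L2_norm (\<lambda>x. g x - h x))\<^sup>2 = (L2_norm g)\<^sup>2 - 2 * L2_inner g h + (L2_norm h)\<^sup>2"
proof -
  have "(g x - h x)\<^sup>2 = (g x)\<^sup>2 - 2 * (g x * h x) + (h x)\<^sup>2" for x
    by (simp add: power2_diff)
  then show ?thesis
    using assms L2_fun_integrable_mult[OF assms]
    by (simp add: L2_norm_power2 L2_fun_def) (simp add: L2_inner_def power2_eq_square)
qed

lemma L2_norm_scale: "L2_norm (\<lambda>x. c * h x) = \<bar>c\<bar> * L2_norm h"
  by (simp add: L2_norm_def power_mult_distrib real_sqrt_mult)

lemma L2_norm_minus: "L2_norm (\<lambda>x. g x - h x) = L2_norm (\<lambda>x. h x - g x)"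
  by (simp add: L2_norm_def power2_commute)

text \<open>Discriminant argument for the nonnegative quadratic t -> ||g - t h||^2. When
  \<open>h\<close> has norm 0 the quadratic degenerates to an affine function, a separate
  case.\<close>

lemma L2_inner_le_norm:
  assumes "g \<in> L2_fun" "h \<in> L2_fun"
  shows "\<bar>L2_inner g h\<bar> \<le> L2_norm g * L2_norm h"
proof -
  define A B C where "A = (L2_norm g)\<^sup>2" and "B = L2_inner g h" and "C = (L2_norm h)\<^sup>2"
  have q: "0 \<le> A - 2 * t * B + t\<^sup>2 * C" for t
  proof -
    have "0 \<le> (L2_norm (\<lambda>x. g x - t * h x))\<^sup>2" by simp
    also have "\<dots> = A - 2 * t * B + t\<^sup>2 * C"
      using assms L2_inner_scale[of t h g]
      by (simp add: L2_norm_power2_diff L2_fun_scale L2_norm_scale power_mult_distrib A_def B_def C_def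
          L2_inner_commute[of g])
    finally show ?thesis .
  qed
  have "B\<^sup>2 \<le> A * C"
  proof (cases "C = 0")
    case True
    have "B = 0"
    proof (rule ccontr)
      assume "B \<noteq> 0"
      \<comment> \<open>At this t the affine function A - 2 t B equals -1.\<close>
      with q[of "(A + 1) / (2 * B)"] True show False by simp
    qed
    then show ?thesis using True by simp
  next
    case False
    then have "C > 0" by (simp add: C_def less_le)
    with q[of "B / C"] show ?thesis
      by (simp add: field_simps power2_eq_square)
  qed
  then have "\<bar>B\<bar>\<^sup>2 \<le> (L2_norm g * L2_norm h)\<^sup>2"
    by (simp add: A_def C_def power_mult_distrib)
  then show ?thesis unfolding B_def by (rule power2_le_imp_le) simp
qed

lemma L2_norm_triangle:
  assumes "g \<in> L2_fun" "h \<in> L2_fun"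
  shows "L2_norm (\<lambda>x. g x + h x) \<le> L2_norm g + L2_norm h"
proof (rule power2_le_imp_le)
  have "(L2_norm (\<lambda>x. g x + h x))\<^sup>2 = (L2_norm (\<lambda>x. g x - (-1) * h x))\<^sup>2" by simp
  also have "\<dots> = (L2_norm g)\<^sup>2 + 2 * L2_inner g h + (L2_norm h)\<^sup>2"
    using L2_inner_scale[of "-1" h g] assms L2_norm_scale[of "-1" h]
    by (subst L2_norm_power2_diff) (auto simp: L2_fun_scale[of _ "-1", simplified] L2_inner_commute[of g])
  also have "\<dots> \<le> (L2_norm g + L2_norm h)\<^sup>2"
    using L2_inner_le_norm[OF assms] by (simp add: power2_sum)
  finally show "(L2_norm (\<lambda>x. g x + h x))\<^sup>2 \<le> (L2_norm g + L2_norm h)\<^sup>2" .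
qed simp

lemma L2_norm_triangle_diff:
  assumes "g \<in> L2_fun" "h \<in> L2_fun" "k \<in> L2_fun"
  shows "L2_norm (\<lambda>x. g x - k x) \<le> L2_norm (\<lambda>x. g x - h x) + L2_norm (\<lambda>x. h x - k x)"
  using L2_norm_triangle[OF L2_fun_diff[OF assms(1,2)] L2_fun_diff[OF assms(2,3)]] by simp

lemma L2_norm_le_bound:
  assumes "h \<in> borel_measurable torus_lebesgue" "\<And>x. \<bar>h x\<bar> \<le> B"
  shows "L2_norm h \<le> B"
proof -
  have B: "0 \<le> B" using assms(2)[of undefined] by linarith
  have "(LINT x|torus_lebesgue. (h x)\<^sup>2) \<le> (LINT (x::'a torus)|torus_lebesgue. B\<^sup>2)"
    using L2_fun_bounded[OF assms] assms(2) B
    by (intro integral_mono) (auto simp: L2_fun_def power2_le_iff_abs_le)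
  also have "\<dots> = B\<^sup>2" by (simp add: torus.prob_space[unfolded space_torus_lebesgue])
  finally show ?thesis unfolding L2_norm_def using B real_le_lsqrt by force
qed

text \<open>Takes the place of completeness of L2: limits are formed pointwise, and a
  square-integrable majorant turns them into L2 limits. The factor 4 in the proof is the square of
  the 2 in |u - p| \<le> 2 w.\<close>

lemma L2_limit_dominated:
  assumes meas: "\<And>n. p n \<in> borel_measurable torus_lebesgue" and w: "w \<in> L2_fun"
    and bound: "\<And>n x. \<bar>p n x\<bar> \<le> w x" and lim: "\<And>x. (\<lambda>n. p n x) \<longlonglongrightarrow> u x"
  shows "u \<in> L2_fun" "(\<lambda>n. L2_norm (\<lambda>x. u x - p n x)) \<longlonglongrightarrow> 0"
proof -
  have [measurable]: "u \<in> borel_measurable torus_lebesgue"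
    by (rule borel_measurable_LIMSEQ_real[OF lim meas])
  note [measurable] = meas
  have ub: "\<bar>u x\<bar> \<le> w x" for x
    by (rule LIMSEQ_le_const2[OF tendsto_rabs[OF lim]]) (auto simp: bound)
  have iw: "integrable torus_lebesgue (\<lambda>x. 4 * (w x)\<^sup>2)" using w by (simp add: L2_fun_def)
  have "(u x)\<^sup>2 \<le> (w x)\<^sup>2" for x
    using ub[of x] by (metis abs_ge_zero order_trans power2_abs power_mono)
  then have "(u x)\<^sup>2 \<le> 4 * (w x)\<^sup>2" for x
    by (smt (verit) zero_le_power2)
  then show "u \<in> L2_fun"
    unfolding L2_fun_def
    by (auto intro!: Bochner_Integration.integrable_bound[OF iw])
  have "(\<lambda>n. LINT x|torus_lebesgue. (u x - p n x)\<^sup>2) \<longlonglongrightarrow> (LINT (x :: 'a torus)|torus_lebesgue. (0::real))"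
  proof (rule integral_dominated_convergence[where w="\<lambda>x. 4 * (w x)\<^sup>2"])
    show "AE x in torus_lebesgue. (\<lambda>n. (u x - p n x)\<^sup>2) \<longlonglongrightarrow> 0"
    proof (rule AE_I2)
      fix x
      have "(\<lambda>n. (u x - p n x)\<^sup>2) \<longlonglongrightarrow> (u x - u x)\<^sup>2" by (intro tendsto_intros lim)
      then show "(\<lambda>n. (u x - p n x)\<^sup>2) \<longlonglongrightarrow> 0" by simp
    qed
    show "AE x in torus_lebesgue. norm ((u x - p n x)\<^sup>2) \<le> 4 * (w x)\<^sup>2" for n
    proof (rule AE_I2)
      fix x
      have "\<bar>u x - p n x\<bar> \<le> 2 * w x" using ub[of x] bound[of n x] by linarith
      then have "\<bar>u x - p n x\<bar>\<^sup>2 \<le> (2 * w x)\<^sup>2" by (intro power_mono) auto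
      then show "norm ((u x - p n x)\<^sup>2) \<le> 4 * (w x)\<^sup>2" by (simp add: power_mult_distrib)
    qed
  qed (use iw in auto)
  then show "(\<lambda>n. L2_norm (\<lambda>x. u x - p n x)) \<longlonglongrightarrow> 0"
    unfolding L2_norm_def using tendsto_real_sqrt by fastforce
qed

section \<open>Fourier coefficients\<close>

lemma L2_fun_integrable_mode:
  assumes "h \<in> L2_fun"
  shows "integrable torus_lebesgue (\<lambda>x. of_real (h x) * fourier_mode k x)"
  by (rule Bochner_Integration.integrable_bound[OF L2_fun_integrable[OF assms]])
     (use L2_fun_measurable[OF assms] in \<open>auto simp: norm_mult\<close>)

lemma fourier_coeff_altdef:
  "fourier_coeff h k = (LINT x|torus_lebesgue. of_real (h x) * fourier_mode (- k) x)"
  by (simp add: fourier_coeff_def fourier_mode_minus)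

lemma fourier_coeff_minus: "fourier_coeff h (- k) = cnj (fourier_coeff h k)"
proof -
  have "fourier_coeff h (- k) = (LINT x|torus_lebesgue. cnj (of_real (h x) * cnj (fourier_mode k x)))"
    by (simp add: fourier_coeff_altdef)
  also have "\<dots> = cnj (fourier_coeff h k)"
    unfolding fourier_coeff_def by (rule Bochner_Integration.integral_cnj)
  finally show ?thesis .
qed

lemma fourier_coeff_0: "fourier_coeff h 0 = of_real (LINT x|torus_lebesgue. h x)"
  by (simp add: fourier_coeff_def)

lemma mean_zero_iff: "mean_zero h \<longleftrightarrow> fourier_coeff h 0 = 0"
  by (simp add: mean_zero_def fourier_coeff_0)

lemma fourier_coeff_add:
  "g \<in> L2_fun \<Longrightarrow> h \<in> L2_fun \<Longrightarrow>
    fourier_coeff (\<lambda>x. g x + h x) k = fourier_coeff g k + fourier_coeff h k"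
  by (simp add: fourier_coeff_altdef distrib_right L2_fun_integrable_mode)

lemma fourier_coeff_diff:
  "g \<in> L2_fun \<Longrightarrow> h \<in> L2_fun \<Longrightarrow>
    fourier_coeff (\<lambda>x. g x - h x) k = fourier_coeff g k - fourier_coeff h k"
  by (simp add: fourier_coeff_altdef left_diff_distrib L2_fun_integrable_mode)

lemma fourier_coeff_scale: "fourier_coeff (\<lambda>x. c * h x) k = of_real c * fourier_coeff h k"
  by (simp add: fourier_coeff_altdef mult.assoc)

lemma fourier_coeff_sum:
  "(\<And>i. i \<in> I \<Longrightarrow> h i \<in> L2_fun) \<Longrightarrow>
    fourier_coeff (\<lambda>x. \<Sum>i\<in>I. h i x) k = (\<Sum>i\<in>I. fourier_coeff (h i) k)"
proof (induction I rule: infinite_finite_induct)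
  case (insert i I)
  then show ?case by (simp add: fourier_coeff_add L2_fun_sum)
qed (simp_all add: fourier_coeff_def)

section \<open>Real trigonometric sums and orthogonal projection\<close>

text \<open>The real part keeps all functions real-valued. For finite symmetric \<open>K\<close> and
  Hermitian \<open>c\<close> the numbers \<open>c k\<close> are the Fourier coefficients on
  \<open>K\<close>; in general the frequencies k and -k mix.\<close>

definition trig_sum :: "(int^'n::finite) set \<Rightarrow> (int^'n \<Rightarrow> complex) \<Rightarrow> 'n torus \<Rightarrow> real" where
  "trig_sum K c x = Re (\<Sum>k\<in>K. c k * fourier_mode k x)"

definition symmetric_modes :: "(int^'n::finite) set \<Rightarrow> bool" where
  "symmetric_modes K \<longleftrightarrow> (\<forall>k\<in>K. - k \<in> K)"

lemma symmetric_modes_norm [simp]: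
  "symmetric_modes {k. norm (real_vec k) \<le> N}" "symmetric_modes {k. norm (real_vec k) < N}"
  by (simp_all add: symmetric_modes_def)

lemma symmetric_modes_iff: "symmetric_modes K \<Longrightarrow> - k \<in> K \<longleftrightarrow> k \<in> K"
  unfolding symmetric_modes_def by (metis minus_minus)

lemma trig_sum_eq_sum: "trig_sum K c x = (\<Sum>k\<in>K. Re (c k * fourier_mode k x))"
  by (simp add: trig_sum_def)

lemma continuous_Re_mode: "continuous_on UNIV (\<lambda>x. Re (c * fourier_mode k x))"
  by (intro continuous_intros continuous_fourier_mode)

lemma continuous_trig_sum: "continuous_on UNIV (trig_sum K c)"
  unfolding trig_sum_eq_sum[abs_def] by (intro continuous_on_sum continuous_Re_mode)

lemma L2_fun_trig_sum: "trig_sum K c \<in> L2_fun"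
  by (rule L2_fun_continuous[OF continuous_trig_sum])

lemma L2_inner_mode:
  assumes "h \<in> L2_fun"
  shows "L2_inner h (\<lambda>x. Re (c * fourier_mode k x)) = Re (c * cnj (fourier_coeff h k))"
proof -
  have "L2_inner h (\<lambda>x. Re (c * fourier_mode k x)) =
      (LINT x|torus_lebesgue. Re (c * (of_real (h x) * fourier_mode k x)))"
    unfolding L2_inner_def by (intro Bochner_Integration.integral_cong) (auto simp: algebra_simps)
  also have "\<dots> = Re (LINT x|torus_lebesgue. c * (of_real (h x) * fourier_mode k x))"
    by (rule integral_Re) (simp add: L2_fun_integrable_mode[OF assms])
  also have "(LINT x|torus_lebesgue. c * (of_real (h x) * fourier_mode k x)) = c * fourier_coeff h (- k)"
    by (simp add: fourier_coeff_altdef)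
  finally show ?thesis by (simp add: fourier_coeff_minus)
qed

lemma L2_inner_trig_sum:
  assumes "h \<in> L2_fun"
  shows "L2_inner h (trig_sum K c) = (\<Sum>k\<in>K. Re (c k * cnj (fourier_coeff h k)))"
proof -
  have "L2_inner h (trig_sum K c) = (\<Sum>k\<in>K. L2_inner h (\<lambda>x. Re (c k * fourier_mode k x)))"
    unfolding L2_inner_def trig_sum_eq_sum sum_distrib_left
    by (intro Bochner_Integration.integral_sum L2_fun_integrable_mult assms L2_fun_continuous continuous_Re_mode)
  then show ?thesis by (simp only: L2_inner_mode[OF assms])
qed

text \<open>The real part is the average of mode k with weight \<open>c\<close> and mode -k with
  weight \<open>cnj c\<close>; for k = l = 0 both cases apply and give \<open>Re c\<close>.\<close>

lemma fourier_coeff_mode: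
  "fourier_coeff (\<lambda>x. Re (c * fourier_mode k x)) l =
    ((if k = l then c else 0) + (if k = - l then cnj c else 0)) / 2"
proof -
  have "fourier_coeff (\<lambda>x. Re (c * fourier_mode k x)) l =
     (LINT x|torus_lebesgue. c / 2 * fourier_mode (k - l) x + cnj c / 2 * fourier_mode (- k - l) x)"
    unfolding fourier_coeff_altdef
  proof (intro Bochner_Integration.integral_cong refl)
    fix x
    have "complex_of_real (Re (c * fourier_mode k x)) = (c * fourier_mode k x + cnj (c * fourier_mode k x)) / 2"
      by (simp only: complex_add_cnj) simp
    also have "\<dots> = (c * fourier_mode k x + cnj c * fourier_mode (- k) x) / 2"
      by (simp only: fourier_mode_minus complex_cnj_mult)
    finally have *: "complex_of_real (Re (c * fourier_mode k x)) = (c * fourier_mode k x + cnj c * fourier_mode (- k) x) / 2" .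
    show "of_real (Re (c * fourier_mode k x)) * fourier_mode (- l) x =
       c / 2 * fourier_mode (k - l) x + cnj c / 2 * fourier_mode (- k - l) x"
      unfolding diff_conv_add_uminus fourier_mode_add *
      by (simp add: field_simps del: times_complex.sel)
  qed
  also have "\<dots> = (LINT x|torus_lebesgue. c / 2 * fourier_mode (k - l) x) +
      (LINT x|torus_lebesgue. cnj c / 2 * fourier_mode (- k - l) x)"
    by (intro Bochner_Integration.integral_add integrable_mult_right continuous_torus_integrable
        continuous_fourier_mode)
  also have "\<dots> = c / 2 * (if k - l = 0 then 1 else 0) + cnj c / 2 * (if - k - l = 0 then 1 else 0)"
    by (simp only: integral_mult_right_zero integral_fourier_mode)
  also have "- k - l = 0 \<longleftrightarrow> k = - l"
    unfolding eq_neg_iff_add_eq_0 by (metis minus_add_distrib diff_conv_add_uminus neg_equal_0_iff_equal)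
  finally show ?thesis by (auto simp: add_divide_distrib)
qed

text \<open>Each l in \<open>K\<close> receives two halves, from k = l and from k = -l, and
  Hermitian symmetry makes them equal.\<close>

lemma fourier_coeff_trig_sum:
  assumes "finite K" "symmetric_modes K" "\<And>k. k \<in> K \<Longrightarrow> c (- k) = cnj (c k)"
  shows "fourier_coeff (trig_sum K c) l = (if l \<in> K then c l else 0)"
proof -
  have "fourier_coeff (trig_sum K c) l =
     (\<Sum>k\<in>K. (if k = l then c k / 2 else 0) + (if k = - l then cnj (c k) / 2 else 0))"
    unfolding trig_sum_eq_sum[abs_def]
    by (subst fourier_coeff_sum)
       (auto intro!: sum.cong L2_fun_continuous continuous_Re_mode
          simp: fourier_coeff_mode add_divide_distrib
          simp del: times_complex.sel)
  also have "\<dots> = (if l \<in> K then c l / 2 else 0) + (if - l \<in> K then cnj (c (- l)) / 2 else 0)"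
    using assms(1) by (simp add: sum.distrib sum.delta)
  also have "\<dots> = (if l \<in> K then c l else 0)"
    using assms(3)[of "- l"] symmetric_modes_iff[OF assms(2)] by auto
  finally show ?thesis .
qed

lemma L2_norm_trig_sum:
  assumes "finite K" "symmetric_modes K" "\<And>k. k \<in> K \<Longrightarrow> c (- k) = cnj (c k)"
  shows "(L2_norm (trig_sum K c))\<^sup>2 = (\<Sum>k\<in>K. (norm (c k))\<^sup>2)"
  unfolding L2_norm_power2 L2_inner_trig_sum[OF L2_fun_trig_sum]
  by (intro sum.cong refl)
     (simp add: fourier_coeff_trig_sum[of K c, OF assms] complex_mult_cnj cmod_power2)

lemma L2_norm_minus_partial_sum:
  assumes "h \<in> L2_fun" "finite K" "symmetric_modes K"
  shows "(L2_norm (\<lambda>x. h x - trig_sum K (fourier_coeff h) x))\<^sup>2 =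
    (L2_norm h)\<^sup>2 - (\<Sum>k\<in>K. (norm (fourier_coeff h k))\<^sup>2)"
proof -
  have "L2_inner h (trig_sum K (fourier_coeff h)) = (\<Sum>k\<in>K. (norm (fourier_coeff h k))\<^sup>2)"
    unfolding L2_inner_trig_sum[OF assms(1)]
    by (intro sum.cong refl) (simp add: complex_mult_cnj cmod_power2)
  then show ?thesis
    using assms by (simp add: L2_norm_power2_diff L2_fun_trig_sum L2_norm_trig_sum fourier_coeff_minus)
qed

text \<open>Symmetrising the index set makes the partial sum the orthogonal projection of
  \<open>h\<close>, and the squared distance to it is nonnegative; the added modes only increase the
  sum.\<close>

lemma bessel:
  assumes "h \<in> L2_fun" "finite K"
  shows "(\<Sum>k\<in>K. (norm (fourier_coeff h k))\<^sup>2) \<le> (L2_norm h)\<^sup>2"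
proof -
  let ?K = "K \<union> uminus ` K"
  have sym: "symmetric_modes ?K" by (auto simp: symmetric_modes_def)
  have "(\<Sum>k\<in>K. (norm (fourier_coeff h k))\<^sup>2) \<le> (\<Sum>k\<in>?K. (norm (fourier_coeff h k))\<^sup>2)"
    using assms by (intro sum_mono2) auto
  also have "\<dots> \<le> (L2_norm h)\<^sup>2"
    using L2_norm_minus_partial_sum[OF assms(1) _ sym] assms(2)
      zero_le_power2[of "L2_norm (\<lambda>x. h x - trig_sum ?K (fourier_coeff h) x)"] by simp
  finally show ?thesis .
qed

lemma norm_fourier_coeff_le: "h \<in> L2_fun \<Longrightarrow> norm (fourier_coeff h k) \<le> L2_norm h"
  using bessel[of h "{k}"] by (simp add: power2_le_iff_abs_le)

text \<open>The remainder \<open>u\<close> has no coefficients in \<open>K\<close>, hence is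
  orthogonal to every real trigonometric sum over \<open>K\<close>, whether \<open>c\<close> is
  Hermitian or not. This lets approximants from a density theorem be replaced by Fourier
  sums.\<close>

lemma partial_sum_best_approx:
  assumes h: "h \<in> L2_fun" and K: "finite K" "symmetric_modes K"
  shows "L2_norm (\<lambda>x. h x - trig_sum K (fourier_coeff h) x) \<le> L2_norm (\<lambda>x. h x - trig_sum K c x)"
proof (rule power2_le_imp_le)
  let ?t = "trig_sum K (fourier_coeff h)"
  define u v where "u = (\<lambda>x. h x - ?t x)" and "v = trig_sum K (\<lambda>k. c k - fourier_coeff h k)"
  have u: "u \<in> L2_fun" unfolding u_def by (intro L2_fun_diff h L2_fun_trig_sum)
  have v: "v \<in> L2_fun" unfolding v_def by (rule L2_fun_trig_sum)
  have "fourier_coeff u k = 0" if "k \<in> K" for k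
    using that h K unfolding u_def
    by (simp add: fourier_coeff_diff L2_fun_trig_sum fourier_coeff_trig_sum fourier_coeff_minus)
  then have "L2_inner u v = 0"
    unfolding v_def L2_inner_trig_sum[OF u] by simp
  moreover have "(\<lambda>x. h x - trig_sum K c x) = (\<lambda>x. u x - v x)"
    by (auto simp: u_def v_def trig_sum_def left_diff_distrib sum_subtractf)
  ultimately have "(L2_norm (\<lambda>x. h x - trig_sum K c x))\<^sup>2 = (L2_norm u)\<^sup>2 + (L2_norm v)\<^sup>2"
    using L2_norm_power2_diff[OF u v] by simp
  then show "(L2_norm (\<lambda>x. h x - ?t x))\<^sup>2 \<le> (L2_norm (\<lambda>x. h x - trig_sum K c x))\<^sup>2"
    by (simp add: u_def)
qed simp

section \<open>Completeness of the Fourier modes\<close>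

inductive_set trig_poly :: "('n::finite torus \<Rightarrow> real) set" where
  mode: "(\<lambda>x. Re (c * fourier_mode k x)) \<in> trig_poly"
| add: "p \<in> trig_poly \<Longrightarrow> q \<in> trig_poly \<Longrightarrow> (\<lambda>x. p x + q x) \<in> trig_poly"

lemma trig_poly_const: "(\<lambda>_. c) \<in> trig_poly"
  using trig_poly.mode[of "of_real c" 0] by simp

text \<open>Product-to-sum: Re a Re b is the real part of (a b + a cnj b) / 2, and modes multiply by
  adding or subtracting frequencies.\<close>

lemma trig_poly_mult:
  assumes "p \<in> trig_poly" "q \<in> trig_poly"
  shows "(\<lambda>x. p x * q x) \<in> trig_poly"
  using assms
proof (induction p rule: trig_poly.induct)
  case (mode c k)
  from mode.prems show ?case
  proof (induction q rule: trig_poly.induct)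
    case (mode d l)
    have "Re a * Re b = Re (a * b / 2) + Re (a * cnj b / 2)" for a b :: complex
      by (simp add: field_simps)
    then have "Re (c * fourier_mode k x) * Re (d * fourier_mode l x) =
       Re (c * d / 2 * fourier_mode (k + l) x) + Re (c * cnj d / 2 * fourier_mode (k - l) x)" for x
      unfolding diff_conv_add_uminus fourier_mode_add fourier_mode_minus
      by (simp only: complex_cnj_mult mult_ac times_divide_eq_left times_divide_eq_right)
    then show ?case by (simp only:) (intro trig_poly.intros)
  next
    case (add p q)
    then show ?case by (simp only: distrib_left) (intro trig_poly.intros)
  qed
next
  case (add p q)
  then show ?case by (simp only: distrib_right) (intro trig_poly.intros; blast)
qed

lemma trig_poly_scale: "p \<in> trig_poly \<Longrightarrow> (\<lambda>x. c * p x) \<in> trig_poly"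
  by (rule trig_poly_mult[OF trig_poly_const])

lemma trig_poly_sum: "(\<And>i. i \<in> I \<Longrightarrow> p i \<in> trig_poly) \<Longrightarrow> (\<lambda>x. \<Sum>i\<in>I. p i x) \<in> trig_poly"
  by (induction I rule: infinite_finite_induct) (auto intro: trig_poly_const trig_poly.add)

lemma trig_sum_extend:
  assumes "finite K'" "K \<subseteq> K'"
  shows "trig_sum K c = trig_sum K' (\<lambda>k. if k \<in> K then c k else 0)"
proof
  fix x
  have "(\<Sum>k\<in>K'. (if k \<in> K then c k else 0) * fourier_mode k x) = (\<Sum>k\<in>K. c k * fourier_mode k x)"
    using assms by (intro sum.mono_neutral_cong_right) auto
  then show "trig_sum K c x = trig_sum K' (\<lambda>k. if k \<in> K then c k else 0) x"
    unfolding trig_sum_def by simp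
qed

lemma trig_poly_eq_trig_sum:
  "p \<in> trig_poly \<Longrightarrow> \<exists>K c. finite K \<and> symmetric_modes K \<and> p = trig_sum K c"
proof (induction rule: trig_poly.induct)
  case (mode c k)
  have "(\<lambda>x. Re (c * fourier_mode k x)) = trig_sum {k} (\<lambda>_. c)"
    by (simp add: trig_sum_def fun_eq_iff)
  also have "\<dots> = trig_sum {k, - k} (\<lambda>l. if l \<in> {k} then c else 0)"
    by (rule trig_sum_extend) auto
  finally show ?case
    by (intro exI[of _ "{k, - k}"]) (auto simp: symmetric_modes_def)
next
  case (add p q)
  then obtain K c L d where p: "finite K" "symmetric_modes K" "p = trig_sum K c"
    and q: "finite L" "symmetric_modes L" "q = trig_sum L d" by blast
  define c' d' where "c' k = (if k \<in> K then c k else 0)" and "d' k = (if k \<in> L then d k else 0)" for k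
  have "p = trig_sum (K \<union> L) c'" "q = trig_sum (K \<union> L) d'"
    unfolding p q c'_def d'_def by (intro trig_sum_extend; use p q in auto)+
  then have "(\<lambda>x. p x + q x) = trig_sum (K \<union> L) (\<lambda>k. c' k + d' k)"
    by (simp add: trig_sum_def fun_eq_iff distrib_right sum.distrib)
  then show ?case using p q
    by (intro exI[of _ "K \<union> L"]) (auto simp: symmetric_modes_def)
qed

section \<open>Uniform density by Stone-Weierstrass\<close>

text \<open>Embedding by the basic modes, so that polynomial approximation on compact subsets of
  Euclidean space applies and polynomials pull back to trigonometric ones. It also supplies the
  distance functions used to approximate indicators.\<close>

definition torus_embedding :: "'n::finite torus \<Rightarrow> complex^'n" where
  "torus_embedding p = (\<chi> i. fourier_mode (axis i 1) p)"

lemma continuous_torus_embedding: "continuous_on UNIV torus_embedding"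
  unfolding torus_embedding_def by (intro continuous_on_vec_lambda continuous_fourier_mode)

lemma inj_torus_embedding: "inj torus_embedding"
proof (rule injI)
  fix p q :: "'n::finite torus" assume eq: "torus_embedding p = torus_embedding q"
  obtain x y where p: "p = abs_torus x" and q: "q = abs_torus y"
    by (metis torus_representative)
  have "x $ i - y $ i \<in> \<int>" for i
  proof -
    have ax: "real_vec (axis i 1) \<bullet> z = z $ i" for z :: "real^'n"
    proof -
      have "real_vec (axis i 1) = axis i 1" by (simp add: vec_eq_iff axis_def)
      then show ?thesis by (simp add: inner_axis')
    qed
    have "fourier_mode (axis i 1) p = fourier_mode (axis i 1) q"
      using eq by (simp add: torus_embedding_def vec_eq_iff)
    then have "exp (\<i> * complex_of_real (2 * pi * x $ i)) = exp (\<i> * complex_of_real (2 * pi * y $ i))"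
      by (simp add: p q fourier_mode_abs ax cis_conv_exp)
    then obtain n :: int where
      "\<i> * complex_of_real (2 * pi * x $ i) = \<i> * complex_of_real (2 * pi * y $ i) + of_int (2 * n) * (of_real pi * \<i>)"
      unfolding exp_eq by (auto simp: mult_ac)
    then have "2 * pi * x $ i = 2 * pi * y $ i + 2 * n * pi"
      by (auto simp: complex_eq_iff)
    then have "2 * pi * (x $ i - y $ i) = 2 * pi * n" by (simp add: algebra_simps)
    then have "x $ i - y $ i = of_int n" by simp
    then show ?thesis by simp
  qed
  then show "p = q" by (simp add: p q abs_torus_eq_iff)
qed

lemma trig_poly_real_polynomial:
  "real_polynomial_function g \<Longrightarrow> (\<lambda>p. g (torus_embedding p)) \<in> trig_poly"
proof (induction rule: real_polynomial_function.induct)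
  case (linear f)
  interpret f: bounded_linear f by fact
  \<comment> \<open>A real-linear functional is a combination of real and imaginary parts of the
    coordinates, and Im z = Re (- \<i> z) is again the real part of a multiple of a mode.\<close>
  have "f (torus_embedding p) = (\<Sum>i\<in>UNIV. f (axis i 1) * Re (1 * fourier_mode (axis i 1) p) +
      f (axis i \<i>) * Re (- \<i> * fourier_mode (axis i 1) p))" for p
  proof -
    have "torus_embedding p = (\<Sum>i\<in>UNIV. Re (fourier_mode (axis i 1) p) *\<^sub>R axis i 1 +
        Im (fourier_mode (axis i 1) p) *\<^sub>R axis i \<i>)" (is "_ = ?r")
    proof (rule vec_eq_iff[THEN iffD2], rule allI)
      fix j
      have "?r $ j = (\<Sum>i\<in>UNIV. if i = j then fourier_mode (axis i 1) p else 0)"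
        unfolding sum_component
        by (intro sum.cong refl) (auto simp: axis_def complex_eq_iff)
      then show "torus_embedding p $ j = ?r $ j" by (simp add: torus_embedding_def)
    qed
    then have "f (torus_embedding p) = f ?r" by simp
    also have "\<dots> = (\<Sum>i\<in>UNIV. Re (fourier_mode (axis i 1) p) * f (axis i 1) +
        Im (fourier_mode (axis i 1) p) * f (axis i \<i>))"
      by (simp add: f.sum f.add f.scaleR)
    finally show ?thesis by (simp add: mult.commute)
  qed
  then show ?case
    by (simp only:) (intro trig_poly_sum trig_poly.add trig_poly_scale trig_poly.mode)
qed (auto intro: trig_poly_const trig_poly.add trig_poly_mult)

text \<open>A continuous injection of a compact space into a Hausdorff space has a continuous
  inverse on its image, so \<open>h\<close> becomes a continuous function on a compact set.\<close>

lemma trig_poly_uniformly_dense: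
  assumes h: "continuous_on UNIV h" and "e > 0"
  obtains q where "q \<in> trig_poly" "\<And>p. \<bar>h p - q p\<bar> < e"
proof -
  let ?S = "range (torus_embedding :: 'a torus \<Rightarrow> complex^'a)"
  have S: "compact ?S"
    by (intro compact_continuous_image continuous_torus_embedding compact_torus)
  have inv: "continuous_on ?S (inv torus_embedding)"
    by (intro continuous_on_inv continuous_torus_embedding compact_torus)
       (simp add: inj_torus_embedding)
  have "continuous_on ?S (\<lambda>z. h (inv torus_embedding z))"
    by (rule continuous_on_compose2[OF h inv]) auto
  then obtain g where g: "real_polynomial_function g" "\<And>z. z \<in> ?S \<Longrightarrow> \<bar>h (inv torus_embedding z) - g z\<bar> < e"
    using Stone_Weierstrass_real_polynomial_function[OF S _ \<open>e > 0\<close>] by blast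
  show thesis
  proof
    show "(\<lambda>p. g (torus_embedding p)) \<in> trig_poly" by (rule trig_poly_real_polynomial[OF g(1)])
    show "\<bar>h p - g (torus_embedding p)\<bar> < e" for p
      using g(2)[of "torus_embedding p"] by (simp add: inj_torus_embedding)
  qed
qed

section \<open>From uniform density to density in L2\<close>

text \<open>Lipschitz bumps that equal 1 on \<open>C\<close> and decrease to its indicator as m
  grows; they serve both for density in L2 and for comparing laws on closed sets.\<close>

lemma closed_indicator_limit:
  fixes C :: "'a::metric_space set"
  assumes "closed C" "C \<noteq> {}"
  shows "(\<lambda>m. max 0 (1 - real m * infdist x C)) \<longlonglongrightarrow> indicator C x"
proof (cases "x \<in> C")
  case False
  then have pos: "infdist x C > 0"
    using assms in_closed_iff_infdist_zero[of C x] infdist_nonneg[of x C] by linarith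
  obtain m0 :: nat where m0: "1 < real m0 * infdist x C" using pos reals_Archimedean3 by blast
  have "eventually (\<lambda>m. max 0 (1 - real m * infdist x C) = indicator C x) sequentially"
    using eventually_ge_at_top[of m0]
  proof eventually_elim
    case (elim m)
    then have "real m0 * infdist x C \<le> real m * infdist x C"
      using pos by (intro mult_right_mono) auto
    then show ?case using m0 False by simp
  qed
  then show ?thesis by (rule tendsto_eventually)
qed simp

lemma L2_fun_trig_poly: "p \<in> trig_poly \<Longrightarrow> p \<in> L2_fun"
  using trig_poly_eq_trig_sum L2_fun_trig_sum by blast

definition trig_closure :: "('n::finite torus \<Rightarrow> real) set" where
  "trig_closure = {h \<in> L2_fun. \<forall>e>0. \<exists>q\<in>trig_poly. L2_norm (\<lambda>x. h x - q x) < e}"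

lemma trig_closure_L2: "h \<in> trig_closure \<Longrightarrow> h \<in> L2_fun"
  by (simp add: trig_closure_def)

lemma trig_closure_approx:
  assumes "h \<in> trig_closure" "e > 0"
  obtains q where "q \<in> trig_poly" "L2_norm (\<lambda>x. h x - q x) < e"
  using assms unfolding trig_closure_def by blast

lemma trig_closure_add:
  assumes g: "g \<in> trig_closure" and h: "h \<in> trig_closure"
  shows "(\<lambda>x. g x + h x) \<in> trig_closure"
  unfolding trig_closure_def
proof (intro CollectI conjI allI impI)
  show "(\<lambda>x. g x + h x) \<in> L2_fun" by (intro L2_fun_add trig_closure_L2 g h)
  fix e :: real assume "e > 0"
  then have e: "e / 2 > 0" by simp
  obtain p where p: "p \<in> trig_poly" "L2_norm (\<lambda>x. g x - p x) < e / 2"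
    using trig_closure_approx[OF g e] .
  obtain q where q: "q \<in> trig_poly" "L2_norm (\<lambda>x. h x - q x) < e / 2"
    using trig_closure_approx[OF h e] .
  have "L2_norm (\<lambda>x. (g x + h x) - (p x + q x)) = L2_norm (\<lambda>x. (g x - p x) + (h x - q x))"
    by (simp add: algebra_simps)
  also have "\<dots> \<le> L2_norm (\<lambda>x. g x - p x) + L2_norm (\<lambda>x. h x - q x)"
    by (intro L2_norm_triangle L2_fun_diff trig_closure_L2 g h L2_fun_trig_poly p q)
  also have "\<dots> < e" using p q by simp
  finally show "\<exists>r\<in>trig_poly. L2_norm (\<lambda>x. (g x + h x) - r x) < e"
    using trig_poly.add[OF p(1) q(1)] by (rule bexI)
qed

lemma trig_closure_scale:
  assumes h: "h \<in> trig_closure"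
  shows "(\<lambda>x. c * h x) \<in> trig_closure"
  unfolding trig_closure_def
proof (intro CollectI conjI allI impI)
  show "(\<lambda>x. c * h x) \<in> L2_fun" by (intro L2_fun_scale trig_closure_L2 h)
  fix e :: real assume e: "e > 0"
  then have "e / (\<bar>c\<bar> + 1) > 0" by simp
  then obtain q where q: "q \<in> trig_poly" "L2_norm (\<lambda>x. h x - q x) < e / (\<bar>c\<bar> + 1)"
    using h unfolding trig_closure_def by blast
  have "L2_norm (\<lambda>x. c * h x - c * q x) = \<bar>c\<bar> * L2_norm (\<lambda>x. h x - q x)"
    using L2_norm_scale[of c "\<lambda>x. h x - q x"] by (simp add: algebra_simps)
  also have "\<dots> \<le> \<bar>c\<bar> * (e / (\<bar>c\<bar> + 1))" using q by (intro mult_left_mono) auto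
  also have "\<dots> < e" using e by (simp add: divide_simps)
  finally show "\<exists>r\<in>trig_poly. L2_norm (\<lambda>x. c * h x - r x) < e"
    using trig_poly_scale[OF q(1)] by (rule bexI)
qed

lemma trig_poly_subset_closure: "q \<in> trig_poly \<Longrightarrow> q \<in> trig_closure"
  using L2_fun_trig_poly by (force simp: trig_closure_def L2_norm_def intro!: bexI[of _ q])

lemma trig_closure_sum: "(\<And>i. i \<in> I \<Longrightarrow> p i \<in> trig_closure) \<Longrightarrow> (\<lambda>x. \<Sum>i\<in>I. p i x) \<in> trig_closure"
  by (induction I rule: infinite_finite_induct)
     (auto intro: trig_poly_subset_closure trig_poly_const trig_closure_add)

lemma trig_closure_limit:
  assumes "\<And>n. p n \<in> trig_closure" "w \<in> L2_fun" "\<And>n x. \<bar>p n x\<bar> \<le> w x" "\<And>x. (\<lambda>n. p n x) \<longlonglongrightarrow> u x"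
  shows "u \<in> trig_closure"
  unfolding trig_closure_def
proof (intro CollectI conjI allI impI)
  have pm: "p n \<in> borel_measurable torus_lebesgue" for n
    by (intro L2_fun_measurable trig_closure_L2 assms)
  note lim = L2_limit_dominated[OF pm assms(2-4)]
  show u: "u \<in> L2_fun" by (rule lim)
  fix e :: real assume "e > 0"
  then have "eventually (\<lambda>n. L2_norm (\<lambda>x. u x - p n x) < e / 2) sequentially"
    using order_tendstoD(2)[OF lim(2) half_gt_zero] by blast
  then obtain n where n: "L2_norm (\<lambda>x. u x - p n x) < e / 2"
    by (auto simp: eventually_sequentially)
  obtain q where q: "q \<in> trig_poly" "L2_norm (\<lambda>x. p n x - q x) < e / 2"
    using trig_closure_approx[OF assms(1)[of n] half_gt_zero[OF \<open>e > 0\<close>]] .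
  have "L2_norm (\<lambda>x. u x - q x) \<le> L2_norm (\<lambda>x. u x - p n x) + L2_norm (\<lambda>x. p n x - q x)"
    by (intro L2_norm_triangle_diff u trig_closure_L2 assms L2_fun_trig_poly q)
  also have "\<dots> < e" using n q by simp
  finally show "\<exists>q\<in>trig_poly. L2_norm (\<lambda>x. u x - q x) < e" using q(1) by blast
qed

lemma trig_closure_continuous:
  assumes h: "continuous_on UNIV h"
  shows "h \<in> trig_closure"
  unfolding trig_closure_def
proof (intro CollectI conjI allI impI)
  show "h \<in> L2_fun" by (rule L2_fun_continuous[OF h])
  fix e :: real assume "e > 0"
  then obtain q where q: "q \<in> trig_poly" "\<And>p. \<bar>h p - q p\<bar> < e / 2"
    using trig_poly_uniformly_dense[OF h, of "e / 2"] by auto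
  have "L2_norm (\<lambda>x. h x - q x) \<le> e / 2"
    using q(2) L2_fun_measurable[OF L2_fun_diff[OF \<open>h \<in> L2_fun\<close> L2_fun_trig_poly[OF q(1)]]]
    by (intro L2_norm_le_bound) (auto simp: less_imp_le)
  then show "\<exists>q\<in>trig_poly. L2_norm (\<lambda>x. h x - q x) < e" using q(1) \<open>e > 0\<close> by force
qed

lemma trig_closure_indicator_closed:
  assumes "closed (A :: 'n::finite torus set)"
  shows "(indicator A :: _ \<Rightarrow> real) \<in> trig_closure"
proof (cases "A = {}")
  case True
  then show ?thesis using trig_poly_subset_closure[OF trig_poly_const[of 0]] by (simp add: True indicator_def[abs_def])
next
  case False
  let ?C = "torus_embedding ` A"
  have "compact A" using compact_Int_closed[OF compact_torus assms] by simp
  then have C: "closed ?C" "?C \<noteq> {}" using False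
    by (auto intro!: compact_imp_closed compact_continuous_image continuous_on_subset[OF continuous_torus_embedding])
  have ind: "indicator ?C (torus_embedding p) = (indicator A p :: real)" for p
    using inj_torus_embedding by (auto simp: indicator_def inj_def)
  show ?thesis
  proof (rule trig_closure_limit[where p="\<lambda>m p. max 0 (1 - real m * infdist (torus_embedding p) ?C)" and w="\<lambda>_. 1"])
    show "(\<lambda>p. max 0 (1 - real m * infdist (torus_embedding p) ?C)) \<in> trig_closure" for m
      by (intro trig_closure_continuous continuous_intros continuous_torus_embedding)
    show "\<bar>max 0 (1 - real m * infdist (torus_embedding p) ?C)\<bar> \<le> 1" for m p
      using infdist_nonneg[of "torus_embedding p" ?C] by (simp add: abs_le_iff)
    show "(\<lambda>m. max 0 (1 - real m * infdist (torus_embedding p) ?C)) \<longlonglongrightarrow> indicator A p" for p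
      using closed_indicator_limit[OF C, of "torus_embedding p"] by (simp add: ind)
  qed simp
qed

text \<open>Dynkin argument: closed sets form an intersection-stable generator, and the sets whose
  indicator lies in \<open>trig_closure\<close> are stable under complements and, by dominated
  limits with majorant 1, under countable disjoint unions.\<close>

lemma trig_closure_indicator:
  assumes "A \<in> sets borel"
  shows "(indicator A :: 'n::finite torus \<Rightarrow> real) \<in> trig_closure"
proof -
  have "Int_stable (Collect closed)" "Collect closed \<subseteq> Pow (UNIV :: 'n torus set)"
    by (auto simp: Int_stable_def)
  moreover have "A \<in> sigma_sets UNIV (Collect closed)" using assms by (simp add: borel_eq_closed)
  ultimately show ?thesis
  proof (induction rule: sigma_sets_induct_disjoint)
    case (basic A)
    then show ?case by (simp add: trig_closure_indicator_closed)
  next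
    case empty
    show ?case by (rule trig_closure_indicator_closed) simp
  next
    case (compl A)
    have "(indicator (UNIV - A) :: 'n torus \<Rightarrow> real) = (\<lambda>x. 1 + (-1) * indicator A x)"
      by (auto simp: indicator_def)
    moreover have "\<dots> \<in> trig_closure"
      by (intro trig_closure_add trig_closure_scale compl.IH trig_poly_subset_closure trig_poly_const)
    ultimately show ?case by simp
  next
    case (union A)
    show ?case
    proof (rule trig_closure_limit[where p="\<lambda>n x. \<Sum>i<n. indicator (A i) x" and w="\<lambda>_. 1"])
      show "(\<lambda>x. \<Sum>i<n. indicator (A i) x) \<in> trig_closure" for n
        by (intro trig_closure_sum union.IH)
      have eq: "(\<Sum>i<n. indicator (A i) x) = (indicator (\<Union>i<n. A i) x :: real)" for n x
      proof (rule indicator_UN_disjoint[symmetric])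
        show "disjoint_family_on A {..<n}"
          by (rule disjoint_family_on_mono[OF _ union.hyps(1)]) simp
      qed simp
      show "\<bar>\<Sum>i<n. indicator (A i) x\<bar> \<le> (1::real)" for n x
        unfolding eq by (simp add: indicator_def)
      show "(\<lambda>n. \<Sum>i<n. indicator (A i) x) \<longlonglongrightarrow> (indicator (\<Union>i. A i) x :: real)" for x
        unfolding eq by (rule LIMSEQ_indicator_UN)
    qed simp
  qed
qed

text \<open>Simple functions bounded by 2 |h| converge pointwise to \<open>h\<close>, and this
  majorant is in L2.\<close>

lemma trig_closure_eq_L2: "trig_closure = L2_fun"
proof (intro equalityI subsetI)
  fix h :: "'a torus \<Rightarrow> real" assume h: "h \<in> L2_fun"
  obtain s where s: "\<And>i. simple_function torus_lebesgue (s i)" "\<And>x. (\<lambda>i. s i x) \<longlonglongrightarrow> h x"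
    "\<And>i x. \<bar>s i x\<bar> \<le> 2 * \<bar>h x\<bar>"
    using borel_measurable_implies_sequence_metric[OF L2_fun_measurable[OF h], of 0] by auto
  show "h \<in> trig_closure"
  proof (rule trig_closure_limit[OF _ _ s(3) s(2)])
    fix i
    have fin: "finite (range (s i))" using simple_functionD(1)[OF s(1)[of i]] by simp
    have sets: "s i -` {y} \<in> sets borel" for y
      using simple_functionD(2)[OF s(1)[of i]] by simp
    have "s i = (\<lambda>x. \<Sum>y\<in>range (s i). y * indicator (s i -` {y}) x)"
    proof
      fix x
      have "(\<Sum>y\<in>range (s i). y * indicator (s i -` {y}) x) = (\<Sum>y\<in>range (s i). if y = s i x then y else 0)"
        by (intro sum.cong) (auto simp: indicator_def)
      then show "s i x = (\<Sum>y\<in>range (s i). y * indicator (s i -` {y}) x)" using fin by simp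
    qed
    then show "s i \<in> trig_closure"
      by (rule ssubst) (intro trig_closure_sum trig_closure_scale trig_closure_indicator sets)
    show "(\<lambda>x. 2 * \<bar>h x\<bar>) \<in> L2_fun"
      using h by (intro L2_fun_scale) (auto simp: L2_fun_def)
  qed
qed (rule trig_closure_L2)

lemma partial_sums_converge:
  assumes h: "h \<in> L2_fun" and "e > 0"
  obtains K where "finite K" "symmetric_modes K"
    "L2_norm (\<lambda>x. h x - trig_sum K (fourier_coeff h) x) < e"
proof -
  obtain q where q: "q \<in> trig_poly" "L2_norm (\<lambda>x. h x - q x) < e"
    using h \<open>e > 0\<close> unfolding trig_closure_eq_L2[symmetric] by (auto simp: trig_closure_def)
  obtain K c where K: "finite K" "symmetric_modes K" "q = trig_sum K c"
    using trig_poly_eq_trig_sum[OF q(1)] by blast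
  have "L2_norm (\<lambda>x. h x - trig_sum K (fourier_coeff h) x) < e"
    using partial_sum_best_approx[OF h K(1,2), of c] q(2) K(3) by simp
  then show thesis using K that by blast
qed

text \<open>By Bessel no finite sum exceeds the squared norm; by density some finite sum comes
  within e of it, and then so do all larger ones.\<close>

lemma parseval:
  assumes h: "h \<in> L2_fun"
  shows "((\<lambda>k. (norm (fourier_coeff h k))\<^sup>2) has_sum (L2_norm h)\<^sup>2) UNIV"
  unfolding has_sum_def tendsto_iff eventually_finite_subsets_at_top
proof (intro allI impI)
  fix e :: real assume "e > 0"
  then obtain K where K: "finite K" "symmetric_modes K"
    "L2_norm (\<lambda>x. h x - trig_sum K (fourier_coeff h) x) < sqrt e"
    using partial_sums_converge[OF h, of "sqrt e"] by auto
  let ?S = "\<lambda>K. \<Sum>k\<in>K. (norm (fourier_coeff h k))\<^sup>2"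
  have "(L2_norm (\<lambda>x. h x - trig_sum K (fourier_coeff h) x))\<^sup>2 < (sqrt e)\<^sup>2"
    using K(3) by (intro power_strict_mono) auto
  then have *: "(L2_norm h)\<^sup>2 - ?S K < e"
    using \<open>e > 0\<close> L2_norm_minus_partial_sum[OF h K(1,2)] by simp
  have "dist (?S Y) ((L2_norm h)\<^sup>2) < e" if Y: "finite Y" "K \<subseteq> Y" for Y
  proof -
    have "?S K \<le> ?S Y" using Y by (intro sum_mono2) auto
    moreover have "?S Y \<le> (L2_norm h)\<^sup>2" by (rule bessel[OF h Y(1)])
    ultimately show ?thesis using * by (simp add: dist_real_def)
  qed
  then show "\<exists>X. finite X \<and> X \<subseteq> UNIV \<and>
      (\<forall>Y. finite Y \<and> X \<subseteq> Y \<and> Y \<subseteq> UNIV \<longrightarrow> dist (?S Y) ((L2_norm h)\<^sup>2) < e)"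
    using K(1) by blast
qed

section \<open>The Borel structure on mean-zero square-integrable functions\<close>

lemma L2_zero_iff: "h \<in> L2_zero \<longleftrightarrow> h \<in> L2_fun \<and> fourier_coeff h 0 = 0"
  by (auto simp: L2_zero_def L2_fun_def mean_zero_iff)

lemma L2_zero_imp_L2: "h \<in> L2_zero \<Longrightarrow> h \<in> L2_fun"
  by (simp add: L2_zero_iff)

lemma L2_zero_add: "g \<in> L2_zero \<Longrightarrow> h \<in> L2_zero \<Longrightarrow> (\<lambda>x. g x + h x) \<in> L2_zero"
  by (simp add: L2_zero_iff L2_fun_add fourier_coeff_add)

lemma L2_zero_scale: "h \<in> L2_zero \<Longrightarrow> (\<lambda>x. c * h x) \<in> L2_zero"
  by (simp add: L2_zero_iff L2_fun_scale fourier_coeff_scale)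

lemma L2_zero_0: "(\<lambda>_. 0) \<in> L2_zero"
  using L2_fun_const[of 0] by (simp add: L2_zero_iff fourier_coeff_def)

lemma L2_zero_sum: "(\<And>i. i \<in> I \<Longrightarrow> h i \<in> L2_zero) \<Longrightarrow> (\<lambda>x. \<Sum>i\<in>I. h i x) \<in> L2_zero"
  by (induction I rule: infinite_finite_induct) (simp_all add: L2_zero_add L2_zero_0)

lemma space_L2_zero_borel [simp]: "space L2_zero_borel = L2_zero"
  by (simp add: L2_zero_borel_def space_measure_of_conv)

text \<open>Describes a closed ball by countably many inequalities between coefficients, which makes
  balls measurable with respect to the coefficient map.\<close>

lemma L2_norm_le_iff_partial_sums:
  assumes "h \<in> L2_fun" "r \<ge> 0"
  shows "L2_norm h \<le> r \<longleftrightarrow> (\<forall>K. finite K \<longrightarrow> (\<Sum>k\<in>K. (norm (fourier_coeff h k))\<^sup>2) \<le> r\<^sup>2)"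
proof
  assume "L2_norm h \<le> r"
  then have "(L2_norm h)\<^sup>2 \<le> r\<^sup>2" by (intro power_mono) auto
  then show "\<forall>K. finite K \<longrightarrow> (\<Sum>k\<in>K. (norm (fourier_coeff h k))\<^sup>2) \<le> r\<^sup>2"
    using bessel[OF assms(1)] by (meson order_trans)
next
  assume "\<forall>K. finite K \<longrightarrow> (\<Sum>k\<in>K. (norm (fourier_coeff h k))\<^sup>2) \<le> r\<^sup>2"
  then have "(L2_norm h)\<^sup>2 \<le> r\<^sup>2"
    by (intro has_sum_le_finite_sums[OF parseval[OF assms(1)]]) auto
  then show "L2_norm h \<le> r" using assms(2) by (rule power2_le_imp_le)
qed

lemma L2_zero_borel_openI:
  assumes "U \<subseteq> L2_zero"
    and "\<And>g. g \<in> U \<Longrightarrow> \<exists>e>0. \<forall>h\<in>L2_zero. L2_norm (\<lambda>x. h x - g x) < e \<longrightarrow> h \<in> U"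
  shows "U \<in> sets L2_zero_borel"
  unfolding L2_zero_borel_def by (rule in_measure_of) (use assms in auto)

text \<open>Preimages of open sets under a map continuous for the seminorm are among the generators
  of the \<sigma>-algebra.\<close>

lemma lipschitz_measurable_L2_zero:
  fixes F :: "('n::finite torus \<Rightarrow> real) \<Rightarrow> 'b::metric_space"
  assumes lip: "\<And>g h. g \<in> L2_zero \<Longrightarrow> h \<in> L2_zero \<Longrightarrow> dist (F h) (F g) \<le> L2_norm (\<lambda>x. h x - g x)"
  shows "F \<in> borel_measurable L2_zero_borel"
proof (rule borel_measurableI)
  fix S :: "'b set" assume S: "open S"
  show "F -` S \<inter> space L2_zero_borel \<in> sets L2_zero_borel"
  proof (rule L2_zero_borel_openI)
    fix g assume g: "g \<in> F -` S \<inter> space L2_zero_borel"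
    then obtain e where "e > 0" "ball (F g) e \<subseteq> S"
      using S by (auto elim: openE)
    moreover have "F h \<in> ball (F g) e" if "h \<in> L2_zero" "L2_norm (\<lambda>x. h x - g x) < e" for h
      using lip[of g h] g that by (simp add: dist_commute)
    ultimately show "\<exists>e>0. \<forall>h\<in>L2_zero. L2_norm (\<lambda>x. h x - g x) < e \<longrightarrow> h \<in> F -` S \<inter> space L2_zero_borel"
      by (intro exI[of _ e]) auto
  qed auto
qed

lemma fourier_coeff_measurable_L2_zero [measurable]:
  "(\<lambda>h. fourier_coeff h k) \<in> borel_measurable L2_zero_borel"
proof (rule lipschitz_measurable_L2_zero)
  fix g h :: "'a torus \<Rightarrow> real" assume "g \<in> L2_zero" "h \<in> L2_zero"
  then show "dist (fourier_coeff h k) (fourier_coeff g k) \<le> L2_norm (\<lambda>x. h x - g x)"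
    using norm_fourier_coeff_le[of "\<lambda>x. h x - g x" k]
    by (simp add: dist_norm fourier_coeff_diff L2_zero_imp_L2 L2_fun_diff)
qed

section \<open>Separability and the coefficient map\<close>

text \<open>Finite lists of indices form a countable set, and the corresponding sums turn out to be
  dense in \<open>L2_zero\<close>. The zero frequency is suppressed so that every such sum has mean
  zero.\<close>

definition rational_mode :: "(int^'n) \<times> rat \<times> rat \<Rightarrow> ('n::finite) torus \<Rightarrow> real" where
  "rational_mode = (\<lambda>(k, a, b) x. if k = 0 then 0 else Re (Complex (of_rat a) (of_rat b) * fourier_mode k x))"

lemma rational_mode_L2_zero: "rational_mode t \<in> L2_zero"
proof (cases t)
  case (fields k a b)
  show ?thesis
  proof (cases "k = 0")
    case False
    then have "fourier_coeff (\<lambda>x. Re (Complex (of_rat a) (of_rat b) * fourier_mode k x)) 0 = 0"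
      by (subst fourier_coeff_mode) auto
    then show ?thesis
      using False L2_fun_continuous[OF continuous_Re_mode]
      unfolding L2_zero_iff by (simp add: fields rational_mode_def del: times_complex.sel)
  qed (simp add: fields rational_mode_def L2_zero_0)
qed

lemma rational_modes_dense:
  assumes h: "h \<in> L2_zero" and e: "e > 0"
  obtains ts where "L2_norm (\<lambda>x. h x - (\<Sum>t\<leftarrow>ts. rational_mode t x)) < e"
proof -
  let ?h = "fourier_coeff h"
  obtain K where K: "finite K" "symmetric_modes K" "L2_norm (\<lambda>x. h x - trig_sum K ?h x) < e / 2"
    using partial_sums_converge[OF L2_zero_imp_L2[OF h] half_gt_zero[OF e]] .
  \<comment> \<open>Rounding real and imaginary parts costs at most 2 d per mode, and
    \<open>card K\<close> times 2 d is at most e / 2; the + 1 covers empty \<open>K\<close>.\<close>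
  define d where "d = e / (4 * (real (card K) + 1))"
  have d: "d > 0" using e by (simp add: d_def)
  have "\<exists>q. \<bar>x - of_rat q\<bar> < d" for x :: real
    using of_rat_dense[of "x - d" "x + d"] d by (auto simp: abs_less_iff) (metis add.commute diff_less_eq)
  then obtain r where r: "\<And>x. \<bar>x - of_rat (r x)\<bar> < d" by metis
  obtain ks where ks: "set ks = K" "distinct ks" using finite_distinct_list[OF K(1)] by blast
  define ts where "ts = map (\<lambda>k. (k, r (Re (?h k)), r (Im (?h k)))) ks"
  let ?q = "\<lambda>x. \<Sum>t\<leftarrow>ts. rational_mode t x"
  have q: "?q x = (\<Sum>k\<in>K. rational_mode (k, r (Re (?h k)), r (Im (?h k))) x)" for x
    using ks by (simp add: ts_def sum_list_distinct_conv_sum_set o_def)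
  have bound: "\<bar>trig_sum K ?h x - ?q x\<bar> \<le> e / 2" for x
  proof -
    have "\<bar>Re (?h k * fourier_mode k x) - rational_mode (k, r (Re (?h k)), r (Im (?h k))) x\<bar> \<le> 2 * d" for k
    proof (cases "k = 0")
      case True
      then show ?thesis using h d by (simp add: rational_mode_def L2_zero_iff)
    next
      case False
      let ?z = "Complex (of_rat (r (Re (?h k)))) (of_rat (r (Im (?h k))))"
      have "\<bar>Re (?h k * fourier_mode k x) - Re (?z * fourier_mode k x)\<bar> = \<bar>Re ((?h k - ?z) * fourier_mode k x)\<bar>"
        by (simp only: left_diff_distrib minus_complex.sel)
      also have "\<dots> \<le> norm ((?h k - ?z) * fourier_mode k x)" by (rule abs_Re_le_cmod)
      also have "\<dots> = norm (?h k - ?z)" by (simp add: norm_mult)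
      also have "\<dots> \<le> \<bar>Re (?h k - ?z)\<bar> + \<bar>Im (?h k - ?z)\<bar>" by (rule cmod_le)
      also have "\<dots> \<le> 2 * d" using r[of "Re (?h k)"] r[of "Im (?h k)"] by simp
      finally show ?thesis using False by (simp add: rational_mode_def del: times_complex.sel)
    qed
    then have "\<bar>trig_sum K ?h x - ?q x\<bar> \<le> (\<Sum>k\<in>K. 2 * d)"
      unfolding q trig_sum_eq_sum sum_subtractf[symmetric]
      by (intro order_trans[OF sum_abs] sum_mono)
    also have "\<dots> = e * (real (card K) / (2 * (real (card K) + 1)))" by (simp add: d_def field_simps)
    also have "\<dots> \<le> e * (1 / 2)" using e by (intro mult_left_mono) (auto simp: divide_simps)
    finally show ?thesis by simp
  qed
  have qL2: "?q \<in> L2_fun"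
    unfolding q by (intro L2_fun_sum L2_zero_imp_L2 rational_mode_L2_zero)
  have "L2_norm (\<lambda>x. h x - ?q x) \<le> L2_norm (\<lambda>x. h x - trig_sum K ?h x) + L2_norm (\<lambda>x. trig_sum K ?h x - ?q x)"
    by (intro L2_norm_triangle_diff L2_zero_imp_L2[OF h] L2_fun_trig_sum qL2)
  also have "L2_norm (\<lambda>x. trig_sum K ?h x - ?q x) \<le> e / 2"
    by (intro L2_norm_le_bound bound L2_fun_measurable L2_fun_diff L2_fun_trig_sum qL2)
  finally have "L2_norm (\<lambda>x. h x - ?q x) < e" using K(3) by simp
  then show thesis by (rule that)
qed

text \<open>A seminorm-open set is a countable union of closed balls about rational trigonometric
  sums, and each ball is cut out by countably many conditions on coefficients. So measurable
  coefficients suffice, although the generating family is uncountable.\<close>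

lemma measurable_L2_zero_borelI:
  fixes X :: "'w \<Rightarrow> 'n::finite torus \<Rightarrow> real"
  assumes X: "\<And>w. w \<in> space M \<Longrightarrow> X w \<in> L2_zero"
    and meas: "\<And>k. (\<lambda>w. fourier_coeff (X w) k) \<in> borel_measurable M"
  shows "X \<in> measurable M L2_zero_borel"
  unfolding L2_zero_borel_def
proof (rule measurable_measure_of)
  note [measurable] = meas
  fix U :: "('n torus \<Rightarrow> real) set" assume "U \<in> {U. U \<subseteq> L2_zero \<and>
     (\<forall>g\<in>U. \<exists>e>0. \<forall>h\<in>L2_zero. L2_norm (\<lambda>x. h x - g x) < e \<longrightarrow> h \<in> U)}"
  then have U: "U \<subseteq> L2_zero" "\<And>g. g \<in> U \<Longrightarrow> \<exists>e>0. \<forall>h\<in>L2_zero. L2_norm (\<lambda>x. h x - g x) < e \<longrightarrow> h \<in> U"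
    by auto
  define c :: "((int^'n) \<times> rat \<times> rat) list \<Rightarrow> 'n torus \<Rightarrow> real"
    where "c ts x = (\<Sum>t\<leftarrow>ts. rational_mode t x)" for ts x
  define B where "B ts n = {h \<in> L2_zero. L2_norm (\<lambda>x. h x - c ts x) \<le> inverse (real (Suc n))}" for ts n
  have c: "c ts \<in> L2_zero" for ts
    unfolding c_def by (induction ts) (simp_all add: L2_zero_0 L2_zero_add rational_mode_L2_zero)
  have "U = (\<Union>(ts, n)\<in>{(ts, n). B ts n \<subseteq> U}. B ts n)"
  proof (intro equalityI subsetI)
    fix g assume g: "g \<in> U"
    then have gz: "g \<in> L2_zero" using U by auto
    obtain e where e: "e > 0" "\<And>h. h \<in> L2_zero \<Longrightarrow> L2_norm (\<lambda>x. h x - g x) < e \<Longrightarrow> h \<in> U"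
      using U(2)[OF g] by auto
    obtain n where n: "inverse (real (Suc n)) < e / 2" using reals_Archimedean[of "e / 2"] e by auto
    obtain ts where ts: "L2_norm (\<lambda>x. g x - c ts x) < inverse (real (Suc n))"
      using rational_modes_dense[OF gz, of "inverse (real (Suc n))"] unfolding c_def by auto
    have "B ts n \<subseteq> U"
    proof
      fix h assume h: "h \<in> B ts n"
      then have "L2_norm (\<lambda>x. h x - g x) \<le> L2_norm (\<lambda>x. h x - c ts x) + L2_norm (\<lambda>x. c ts x - g x)"
        by (intro L2_norm_triangle_diff L2_zero_imp_L2 c gz) (simp add: B_def)
      also have "\<dots> < e" using h ts n by (simp add: B_def L2_norm_minus[of "c ts"])
      finally show "h \<in> U" using h e(2) by (simp add: B_def)
    qed
    moreover have "g \<in> B ts n" using gz ts by (simp add: B_def)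
    ultimately show "g \<in> (\<Union>(ts, n)\<in>{(ts, n). B ts n \<subseteq> U}. B ts n)" by blast
  qed auto
  then have "X -` U \<inter> space M = (\<Union>(ts, n)\<in>{(ts, n). B ts n \<subseteq> U}. X -` B ts n \<inter> space M)" by blast
  also have "\<dots> \<in> sets M"
  proof (rule sets.countable_UN', safe)
    fix ts n
    have "X -` B ts n \<inter> space M = {w \<in> space M. \<forall>K\<in>Collect finite.
        (\<Sum>k\<in>K. (norm (fourier_coeff (X w) k - fourier_coeff (c ts) k))\<^sup>2) \<le> (inverse (real (Suc n)))\<^sup>2}"
      using X by (auto simp: B_def L2_norm_le_iff_partial_sums L2_fun_diff L2_zero_imp_L2 c fourier_coeff_diff)
    also have "\<dots> \<in> sets M"
      by (intro sets.sets_Collect_countable_All' countable_Collect_finite) measurable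
    finally show "X -` B ts n \<inter> space M \<in> sets M" .
  qed (auto simp: countable_subset[OF subset_UNIV])
  finally show "X -` U \<inter> space M \<in> sets M" .
qed (use X in auto)

lemma fourier_coeff_measurable_fun: "fourier_coeff \<in> borel_measurable L2_zero_borel"
  by (rule measurable_coordinatewise_then_product) measurable

text \<open>The identity is measurable from the \<sigma>-algebra pulled back along the coefficient
  map, so every event is a pullback. Consequently a law on \<open>L2_zero\<close> is fixed by its
  image on coefficient families.\<close>

lemma sets_L2_zero_borel_vimage:
  assumes "A \<in> sets L2_zero_borel"
  obtains B where "B \<in> sets borel" "A = fourier_coeff -` B \<inter> L2_zero"
proof -
  let ?V = "vimage_algebra L2_zero fourier_coeff (borel :: (int^'a \<Rightarrow> complex) measure)"
  have m: "fourier_coeff \<in> borel_measurable ?V"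
    by (rule measurable_vimage_algebra1) auto
  have "(\<lambda>h. h) \<in> measurable ?V L2_zero_borel"
  proof (rule measurable_L2_zero_borelI)
    show "(\<lambda>h. fourier_coeff h k) \<in> borel_measurable ?V" for k
      using measurable_compose[OF m borel_measurable_continuous_onI[OF continuous_on_product_coordinates]] .
  qed simp
  from measurable_sets[OF this assms] have "A \<in> sets ?V"
    using sets.sets_into_space[OF assms] by (simp add: Int_absorb2)
  then show thesis using that by (subst (asm) sets_vimage_algebra2) auto
qed

lemma fourier_coeff_in_sets_L2_zero_borel:
  assumes "A \<in> sets L2_zero_borel" "g \<in> L2_zero" "h \<in> L2_zero" "fourier_coeff g = fourier_coeff h"
  shows "g \<in> A \<longleftrightarrow> h \<in> A"
  by (rule sets_L2_zero_borel_vimage[OF assms(1)]) (use assms in auto)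

section \<open>The heat semigroup\<close>

lemma finite_vec_components: "finite A \<Longrightarrow> finite {k :: 'a^'n::finite. \<forall>i. k $ i \<in> A}"
proof -
  assume "finite A"
  then have "finite (vec_lambda ` (PiE UNIV (\<lambda>_::'n. A)))" by (intro finite_imageI finite_PiE) auto
  moreover have "{k :: 'a^'n. \<forall>i. k $ i \<in> A} \<subseteq> vec_lambda ` (PiE UNIV (\<lambda>_::'n. A))"
    by (auto intro!: image_eqI[where x="vec_nth _"])
  ultimately show ?thesis by (rule finite_subset[rotated])
qed

lemma finite_modes_le [simp]: "finite {k :: int^'n::finite. norm (real_vec k) \<le> N}"
proof (rule finite_subset[OF _ finite_vec_components])
  show "{k :: int^'n. norm (real_vec k) \<le> N} \<subseteq> {k. \<forall>i. k $ i \<in> {- \<lfloor>N\<rfloor>..\<lfloor>N\<rfloor>}}"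
  proof safe
    fix k :: "int^'n" and i assume "norm (real_vec k) \<le> N"
    then have "\<bar>real_of_int (k $ i)\<bar> \<le> N" using component_le_norm_cart[of "real_vec k" i] by simp
    then show "k $ i \<in> {- \<lfloor>N\<rfloor>..\<lfloor>N\<rfloor>}" by (auto simp: abs_le_iff le_floor_iff)
      (metis le_floor_iff of_int_minus neg_le_iff_le add.inverse_inverse minus_le_iff)
  qed
qed simp

lemma finite_modes_less [simp]: "finite {k :: int^'n::finite. norm (real_vec k) < N}"
  by (rule finite_subset[OF _ finite_modes_le[of N]]) auto

lemma norm_real_vec_ge_1: "k \<noteq> 0 \<Longrightarrow> 1 \<le> norm (real_vec k)"
proof -
  assume "k \<noteq> 0"
  then obtain i where "k $ i \<noteq> 0" by (auto simp: vec_eq_iff)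
  then have "1 \<le> \<bar>real_of_int (k $ i)\<bar>" by linarith
  also have "\<dots> \<le> norm (real_vec k)" using component_le_norm_cart[of "real_vec k" i] by simp
  finally show ?thesis .
qed

text \<open>Since m^2 \<ge> |m|, a geometric series for each sign dominates the sum; the two series,
  both containing 0, give the factor 2.\<close>

lemma gaussian_int_sum_bound:
  assumes "finite F" "c > 0"
  shows "(\<Sum>m\<in>F. exp (- c * (real_of_int m)\<^sup>2)) \<le> 2 / (1 - exp (- c))"
proof -
  let ?q = "exp (- c)"
  have q: "0 < ?q" "?q < 1" using assms by auto
  obtain n :: nat where n: "F \<subseteq> {- int n..int n}"
  proof
    show "F \<subseteq> {- int (Max (insert 0 ((\<lambda>m. nat \<bar>m\<bar>) ` F)))..int (Max (insert 0 ((\<lambda>m. nat \<bar>m\<bar>) ` F)))}"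
    proof
      fix m assume "m \<in> F"
      then have "nat \<bar>m\<bar> \<le> Max (insert 0 ((\<lambda>m. nat \<bar>m\<bar>) ` F))" using assms by (intro Max_ge) auto
      then show "m \<in> {- int (Max (insert 0 ((\<lambda>m. nat \<bar>m\<bar>) ` F)))..int (Max (insert 0 ((\<lambda>m. nat \<bar>m\<bar>) ` F)))}"
        by auto
    qed
  qed
  have "{- int n..int n} = int ` {..n} \<union> (\<lambda>i. - int i) ` {..n}"
  proof (intro equalityI subsetI)
    fix m assume "m \<in> {- int n..int n}"
    then show "m \<in> int ` {..n} \<union> (\<lambda>i. - int i) ` {..n}"
      by (cases "m \<ge> 0") (auto intro: image_eqI[where x="nat m"] image_eqI[where x="nat (- m)"])
  qed auto
  then have "F \<subseteq> int ` {..n} \<union> (\<lambda>i. - int i) ` {..n}" using n by simp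
  moreover have sq: "exp (- c * (real_of_int m)\<^sup>2) \<le> ?q ^ nat \<bar>m\<bar>" for m
  proof -
    have "\<bar>m\<bar> * 1 \<le> \<bar>m\<bar> * \<bar>m\<bar>"
      by (cases "m = 0", simp, rule mult_left_mono, linarith, linarith)
    then have "\<bar>m\<bar> \<le> m\<^sup>2" by (simp add: power2_eq_square)
    then have "real_of_int \<bar>m\<bar> \<le> real_of_int (m\<^sup>2)" by (simp only: of_int_le_iff)
    then have "c * real (nat \<bar>m\<bar>) \<le> c * (real_of_int m)\<^sup>2" using assms by (intro mult_left_mono) auto
    then have "exp (- c * (real_of_int m)\<^sup>2) \<le> exp (real (nat \<bar>m\<bar>) * (- c))" by (simp add: mult.commute)
    then show ?thesis by (simp only: exp_of_nat_mult)
  qed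
  ultimately have "(\<Sum>m\<in>F. exp (- c * (real_of_int m)\<^sup>2)) \<le>
      (\<Sum>m\<in>int ` {..n} \<union> (\<lambda>i. - int i) ` {..n}. ?q ^ nat \<bar>m\<bar>)"
    by (intro order_trans[OF sum_mono[OF sq] sum_mono2]) auto
  also have "\<dots> \<le> (\<Sum>m\<in>int ` {..n}. ?q ^ nat \<bar>m\<bar>) + (\<Sum>m\<in>(\<lambda>i. - int i) ` {..n}. ?q ^ nat \<bar>m\<bar>)"
    by (subst sum.union_inter[symmetric]) (auto intro!: sum_nonneg)
  also have "\<dots> = 2 * (\<Sum>i\<le>n. ?q ^ i)"
    by (simp add: sum.reindex inj_on_def)
  also have "\<dots> = 2 * ((1 - ?q ^ Suc n) / (1 - ?q))"
    using q by (simp only: lessThan_Suc_atMost[symmetric] sum_gp_strict) auto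
  also have "\<dots> \<le> 2 * (1 / (1 - ?q))"
    using q by (intro mult_left_mono divide_right_mono) auto
  finally show ?thesis by simp
qed

text \<open>A finite set of frequencies lies in a box, over which the Gaussian factorises into
  one-dimensional sums; the resulting bound does not depend on the set.\<close>

lemma gaussian_summable:
  assumes "t > 0"
  shows "(\<lambda>k :: int^'n::finite. exp (- 4 * pi\<^sup>2 * t * (norm (real_vec k))\<^sup>2)) summable_on UNIV"
proof (rule nonneg_bdd_above_summable_on)
  let ?c = "4 * pi\<^sup>2 * t"
  have c: "?c > 0" using assms by simp
  show "bdd_above (sum (\<lambda>k :: int^'n. exp (- 4 * pi\<^sup>2 * t * (norm (real_vec k))\<^sup>2)) ` {F. F \<subseteq> UNIV \<and> finite F})"
  proof (rule bdd_aboveI2)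
    fix F :: "(int^'n) set" assume "F \<in> {F. F \<subseteq> UNIV \<and> finite F}"
    then have F: "finite F" by simp
    define I where "I = (\<Union>i\<in>UNIV. (\<lambda>k. k $ i) ` F)"
    have I: "finite I" using F by (auto simp: I_def)
    have ex: "exp (- 4 * pi\<^sup>2 * t * (norm (real_vec k))\<^sup>2) = (\<Prod>i\<in>UNIV. exp (- ?c * (real_of_int (k $ i))\<^sup>2))" for k :: "int^'n"
      by (simp add: norm_vec_def L2_set_def sum_nonneg exp_sum[symmetric] sum_distrib_left mult.assoc)
    have bij: "inj_on vec_nth {k :: int^'n. \<forall>i. k $ i \<in> I}" by (auto simp: inj_on_def vec_eq_iff)
    have im: "vec_nth ` {k :: int^'n. \<forall>i. k $ i \<in> I} = PiE UNIV (\<lambda>_. I)"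
    proof (intro equalityI subsetI)
      fix u :: "'n \<Rightarrow> int" assume "u \<in> PiE UNIV (\<lambda>_. I)"
      then show "u \<in> vec_nth ` {k :: int^'n. \<forall>i. k $ i \<in> I}"
        by (intro image_eqI[where x="vec_lambda u"]) auto
    qed auto
    have "(\<Sum>k\<in>F. exp (- 4 * pi\<^sup>2 * t * (norm (real_vec k))\<^sup>2)) \<le>
       (\<Sum>k\<in>{k :: int^'n. \<forall>i. k $ i \<in> I}. exp (- 4 * pi\<^sup>2 * t * (norm (real_vec k))\<^sup>2))"
      by (rule sum_mono2[OF finite_vec_components[OF I]]) (auto simp: I_def)
    also have "\<dots> = (\<Sum>k\<in>{k :: int^'n. \<forall>i. k $ i \<in> I}. \<Prod>i\<in>UNIV. exp (- ?c * (real_of_int (k $ i))\<^sup>2))"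
      by (simp only: ex)
    also have "\<dots> = (\<Sum>u\<in>vec_nth ` {k :: int^'n. \<forall>i. k $ i \<in> I}. \<Prod>i\<in>UNIV. exp (- ?c * (real_of_int (u i))\<^sup>2))"
      by (subst sum.reindex[OF bij]) (simp only: o_def)
    also have "vec_nth ` {k :: int^'n. \<forall>i. k $ i \<in> I} = PiE UNIV (\<lambda>_. I)" by (rule im)
    also have "(\<Sum>u\<in>PiE (UNIV :: 'n set) (\<lambda>_. I). \<Prod>i\<in>UNIV. exp (- ?c * (real_of_int (u i))\<^sup>2)) =
        (\<Prod>i\<in>(UNIV :: 'n set). \<Sum>m\<in>I. exp (- ?c * (real_of_int m)\<^sup>2))"
      by (rule prod_sum_PiE[symmetric]) (use I in auto)
    also have "\<dots> \<le> (\<Prod>i\<in>(UNIV :: 'n set). 2 / (1 - exp (- ?c)))"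
      using gaussian_int_sum_bound[OF I c] by (intro prod_mono) (auto intro!: sum_nonneg)
    finally show "(\<Sum>k\<in>F. exp (- 4 * pi\<^sup>2 * t * (norm (real_vec k))\<^sup>2)) \<le> (2 / (1 - exp (- ?c))) ^ CARD('n)" by simp
  qed
qed simp

lemma filterlim_modes_at_top:
  "filterlim (\<lambda>n. {k :: int^'n::finite. norm (real_vec k) \<le> real n}) (finite_subsets_at_top UNIV) sequentially"
proof (rule filterlim_finite_subsets_at_top[THEN iffD2], safe)
  fix X :: "(int^'n) set" assume "finite X"
  then obtain B where B: "\<And>k. k \<in> X \<Longrightarrow> norm (real_vec k) \<le> B"
    using finite_imp_bounded[of "real_vec ` X"] by (auto simp: bounded_iff)
  obtain n0 :: nat where "B \<le> real n0" using real_arch_simple by blast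
  then have "eventually (\<lambda>n. B \<le> real n) sequentially"
    by (intro eventually_mono[OF eventually_ge_at_top[of n0]]) linarith
  then show "eventually (\<lambda>n. finite {k :: int^'n. norm (real_vec k) \<le> real n} \<and>
      X \<subseteq> {k. norm (real_vec k) \<le> real n} \<and> {k :: int^'n. norm (real_vec k) \<le> real n} \<subseteq> UNIV) sequentially"
    by eventually_elim (use B in force)
qed

lemma fourier_coeff_L2_limit:
  assumes "\<And>n. p n \<in> L2_fun" "u \<in> L2_fun" "(\<lambda>n. L2_norm (\<lambda>x. u x - p n x)) \<longlonglongrightarrow> 0"
  shows "(\<lambda>n. fourier_coeff (p n) k) \<longlonglongrightarrow> fourier_coeff u k"
proof -
  have "(\<lambda>n. fourier_coeff u k - fourier_coeff (p n) k) \<longlonglongrightarrow> 0"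
  proof (rule Lim_null_comparison[OF always_eventually assms(3)], rule allI)
    fix n show "norm (fourier_coeff u k - fourier_coeff (p n) k) \<le> L2_norm (\<lambda>x. u x - p n x)"
      using norm_fourier_coeff_le[OF L2_fun_diff[OF assms(2,1)], of n k]
      by (simp add: fourier_coeff_diff assms)
  qed
  from tendsto_diff[OF tendsto_const[of "fourier_coeff u k"] this] show ?thesis by simp
qed

text \<open>The partial sums over balls are bounded by the constant \<Sum> |c k|, so pointwise
  convergence is also L2 convergence and coefficients pass to the limit. Hermitian symmetry
  guarantees that the real part has coefficients \<open>c\<close>.\<close>

lemma absolutely_convergent_fourier_series:
  fixes c :: "int^'n::finite \<Rightarrow> complex"
  assumes summable: "(\<lambda>k. norm (c k)) summable_on UNIV" and herm: "\<And>k. c (- k) = cnj (c k)"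
  defines "u \<equiv> \<lambda>x. Re (\<Sum>\<^sub>\<infinity>k. c k * fourier_mode k x)"
  shows "u \<in> L2_fun" "fourier_coeff u k = c k" "\<bar>u x\<bar> \<le> (\<Sum>\<^sub>\<infinity>k. norm (c k))"
proof -
  define K where "K n = {k :: int^'n. norm (real_vec k) \<le> real n}" for n :: nat
  have K: "finite (K n)" "symmetric_modes (K n)" for n by (simp_all add: K_def)
  have lim: "(\<lambda>n. trig_sum (K n) c x) \<longlonglongrightarrow> u x" for x
  proof -
    have "(\<lambda>k. norm (c k * fourier_mode k x)) summable_on UNIV" using summable by (simp add: norm_mult)
    then have "((\<lambda>k. c k * fourier_mode k x) has_sum (\<Sum>\<^sub>\<infinity>k. c k * fourier_mode k x)) UNIV"
      by (rule has_sum_infsum[OF abs_summable_summable])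
    then have "(\<lambda>n. \<Sum>k\<in>K n. c k * fourier_mode k x) \<longlonglongrightarrow> (\<Sum>\<^sub>\<infinity>k. c k * fourier_mode k x)"
      unfolding has_sum_def K_def by (rule filterlim_compose[OF _ filterlim_modes_at_top])
    then show ?thesis unfolding u_def trig_sum_def by (rule tendsto_Re)
  qed
  have bound: "\<bar>trig_sum (K n) c x\<bar> \<le> (\<Sum>\<^sub>\<infinity>k. norm (c k))" for n x
  proof -
    have "\<bar>trig_sum (K n) c x\<bar> \<le> norm (\<Sum>k\<in>K n. c k * fourier_mode k x)"
      unfolding trig_sum_def by (rule abs_Re_le_cmod)
    also have "\<dots> \<le> (\<Sum>k\<in>K n. norm (c k))"
      by (rule order_trans[OF norm_sum]) (simp add: norm_mult)
    also have "\<dots> \<le> (\<Sum>\<^sub>\<infinity>k. norm (c k))"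
      by (rule finite_sum_le_infsum[OF summable K(1)]) auto
    finally show ?thesis .
  qed
  have lims: "u \<in> L2_fun" "(\<lambda>n. L2_norm (\<lambda>x. u x - trig_sum (K n) c x)) \<longlonglongrightarrow> 0"
    using L2_limit_dominated[OF L2_fun_measurable[OF L2_fun_trig_sum] L2_fun_const bound lim] by auto
  show "u \<in> L2_fun" by (rule lims)
  show "\<bar>u x\<bar> \<le> (\<Sum>\<^sub>\<infinity>k. norm (c k))"
    by (rule LIMSEQ_le_const2[OF tendsto_rabs[OF lim]]) (auto simp: bound)
  have "(\<lambda>n. fourier_coeff (trig_sum (K n) c) k) \<longlonglongrightarrow> fourier_coeff u k"
    by (rule fourier_coeff_L2_limit[OF L2_fun_trig_sum lims])
  moreover have "(\<lambda>n. fourier_coeff (trig_sum (K n) c) k) \<longlonglongrightarrow> c k"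
  proof (rule tendsto_eventually)
    obtain n0 :: nat where "norm (real_vec k) \<le> real n0" using real_arch_simple by blast
    then have "k \<in> K n" if "n \<ge> n0" for n using that by (simp add: K_def)
    then show "eventually (\<lambda>n. fourier_coeff (trig_sum (K n) c) k = c k) sequentially"
      by (intro eventually_mono[OF eventually_ge_at_top[of n0]])
         (simp add: fourier_coeff_trig_sum[of _ c, OF K herm])
  qed
  ultimately show "fourier_coeff u k = c k" by (rule LIMSEQ_unique)
qed

section \<open>Heat flow as a Fourier multiplier\<close>

definition heat_multiplier :: "real \<Rightarrow> int^'n::finite \<Rightarrow> real" where
  "heat_multiplier t k = exp (- 4 * pi\<^sup>2 * t * (norm (real_vec k))\<^sup>2)"

lemma heat_multiplier_pos: "0 < heat_multiplier t k"
  by (simp add: heat_multiplier_def)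

lemma heat_multiplier_le_1: "t \<ge> 0 \<Longrightarrow> heat_multiplier t k \<le> 1"
  by (simp add: heat_multiplier_def)

text \<open>The third claim is the smoothing from L2 to bounded functions; it supplies the pointwise
  majorants for the random series.\<close>

lemma heat_properties:
  fixes v :: "'n::finite torus \<Rightarrow> real"
  assumes v: "v \<in> L2_fun" and t: "t > 0"
  shows "heat t v \<in> L2_fun" "fourier_coeff (heat t v) k = of_real (heat_multiplier t k) * fourier_coeff v k"
    "\<bar>heat t v x\<bar> \<le> (\<Sum>\<^sub>\<infinity>k :: int^'n. heat_multiplier t k) * L2_norm v"
proof -
  let ?c = "\<lambda>k. of_real (heat_multiplier t k) * fourier_coeff v k"
  have sm: "(\<lambda>k :: int^'n. heat_multiplier t k) summable_on UNIV"
    using gaussian_summable[OF t] by (simp add: heat_multiplier_def)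
  have le: "norm (?c k) \<le> heat_multiplier t k * L2_norm v" for k
    using norm_fourier_coeff_le[OF v] heat_multiplier_pos[of t k] by (simp add: norm_mult)
  have sm': "(\<lambda>k :: int^'n. heat_multiplier t k * L2_norm v) summable_on UNIV"
    by (rule summable_on_cmult_left[OF sm])
  have summable: "(\<lambda>k. norm (?c k)) summable_on UNIV"
    by (rule summable_on_comparison_test[OF sm']) (use le in auto)
  have herm: "?c (- k) = cnj (?c k)" for k
    by (simp add: heat_multiplier_def fourier_coeff_minus)
  have eq: "heat t v = (\<lambda>x. Re (\<Sum>\<^sub>\<infinity>k. ?c k * fourier_mode k x))"
    using t by (simp add: heat_def heat_multiplier_def)
  note * = absolutely_convergent_fourier_series[of ?c, OF summable herm]
  show "heat t v \<in> L2_fun" "fourier_coeff (heat t v) k = ?c k"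
    unfolding eq using * by auto
  have "\<bar>heat t v x\<bar> \<le> (\<Sum>\<^sub>\<infinity>k. norm (?c k))" unfolding eq using * by auto
  also have "\<dots> \<le> (\<Sum>\<^sub>\<infinity>k :: int^'n. heat_multiplier t k * L2_norm v)"
    by (rule infsum_mono[OF summable sm' le])
  also have "\<dots> = (\<Sum>\<^sub>\<infinity>k :: int^'n. heat_multiplier t k) * L2_norm v"
    by (rule infsum_cmult_left) (simp add: sm)
  finally show "\<bar>heat t v x\<bar> \<le> (\<Sum>\<^sub>\<infinity>k :: int^'n. heat_multiplier t k) * L2_norm v" .
qed

section \<open>Differentiation on the torus\<close>

definition C1_torus :: "('n::finite torus \<Rightarrow> real) \<Rightarrow> bool" where
  "C1_torus h \<longleftrightarrow> Ck (Suc 0) (\<lambda>x. h (abs_torus x))"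

definition torus_partial :: "'n::finite \<Rightarrow> ('n torus \<Rightarrow> real) \<Rightarrow> 'n torus \<Rightarrow> real" where
  "torus_partial i h p = frechet_derivative (\<lambda>x. h (abs_torus x)) (at (rep_torus p)) (axis i 1)"

lemma Ck_1I:
  assumes "\<And>x. (U has_derivative U' x) (at x)" "\<And>v. continuous_on UNIV (\<lambda>x. U' x v)"
  shows "Ck (Suc 0) U"
proof -
  have "frechet_derivative U (at x) = U' x" for x
    using frechet_derivative_at[OF assms(1)] by simp
  then show ?thesis using assms by (auto simp: differentiable_def)
qed

lemma Ck_1D:
  assumes "Ck (Suc 0) U"
  shows "(U has_derivative frechet_derivative U (at x)) (at x)"
    "continuous_on UNIV (\<lambda>x. frechet_derivative U (at x) v)"
  using assms by (simp_all add: frechet_derivative_works)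

lemma Ck_1_continuous:
  assumes "Ck (Suc 0) U" shows "continuous_on UNIV U"
  by (rule has_derivative_continuous_on) (rule has_derivative_at_withinI[OF Ck_1D(1)[OF assms]])

text \<open>The constant is 0 for functions on the torus and an integer vector for lifts of maps;
  either way the derivative is periodic.\<close>

lemma frechet_derivative_translate:
  assumes F: "(F has_derivative D) (at y)" and tr: "\<And>z. F (z + (y - x)) = F z + c"
  shows "(F has_derivative D) (at x)"
proof -
  have "((\<lambda>z. F (z + (y - x))) has_derivative D) (at x)"
  proof (rule has_derivative_compose[of "\<lambda>z. z + (y - x)" "\<lambda>z. z" x UNIV F D])
    show "((\<lambda>z. z + (y - x)) has_derivative (\<lambda>z. z)) (at x)" by (auto intro!: derivative_eq_intros)
    show "(F has_derivative D) (at (x + (y - x)))" using F by simp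
  qed
  then have "((\<lambda>z. F (z + (y - x)) - c) has_derivative (\<lambda>v. D v - 0)) (at x)"
    by (intro derivative_intros)
  then show ?thesis by (simp add: tr)
qed

lemma C1_torus_derivative:
  assumes h: "C1_torus h"
  shows "((\<lambda>x. h (abs_torus x)) has_derivative (\<lambda>v. \<Sum>i\<in>UNIV. v $ i * torus_partial i h (abs_torus x))) (at x)"
proof -
  let ?U = "\<lambda>x. h (abs_torus x)" and ?y = "rep_torus (abs_torus x)"
  let ?D = "frechet_derivative ?U (at ?y)"
  have U: "Ck (Suc 0) ?U" using h by (simp add: C1_torus_def)
  have y: "(?U has_derivative ?D) (at ?y)" by (rule Ck_1D(1)[OF U])
  have "abs_torus (z + (?y - x)) = abs_torus z" for z
    using abs_torus_eq_iff[of ?y x] by (simp add: abs_torus_eq_iff)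
  then have "(?U has_derivative ?D) (at x)"
    by (intro frechet_derivative_translate[OF y, of _ 0]) simp
  moreover have "?D v = (\<Sum>i\<in>UNIV. v $ i * torus_partial i h (abs_torus x))" for v
  proof -
    interpret bounded_linear ?D using y by (rule has_derivative_bounded_linear)
    have "?D v = ?D (\<Sum>i\<in>UNIV. (v $ i) *\<^sub>R axis i 1)"
      by (simp add: basis_expansion scalar_mult_eq_scaleR[symmetric])
    then show ?thesis by (simp add: sum scaleR torus_partial_def)
  qed
  then have "?D = (\<lambda>v. \<Sum>i\<in>UNIV. v $ i * torus_partial i h (abs_torus x))" by blast
  ultimately show ?thesis by simp
qed

lemma torus_partial_abs:
  assumes h: "C1_torus h"
  shows "torus_partial i h (abs_torus x) = frechet_derivative (\<lambda>x. h (abs_torus x)) (at x) (axis i 1)"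
  unfolding frechet_derivative_at[OF C1_torus_derivative[OF h], symmetric]
  by (simp add: axis_def if_distrib[of "\<lambda>x. x * _"] cong: if_cong)

lemma continuous_torus_partial:
  assumes h: "C1_torus h"
  shows "continuous_on UNIV (torus_partial i h)"
  unfolding continuous_torus_iff torus_partial_abs[OF h]
  by (rule Ck_1D(2)) (use h in \<open>simp add: C1_torus_def\<close>)

lemma C1_torus_continuous: "C1_torus h \<Longrightarrow> continuous_on UNIV h"
  unfolding C1_torus_def continuous_torus_iff by (rule Ck_1_continuous)

lemma smooth_function_C1: "smooth_function h \<Longrightarrow> C1_torus h"
  unfolding smooth_function_def C_inf_def C1_torus_def by blast

text \<open>By translation invariance the difference quotients of \<open>g\<close> have mean zero.\<close>

lemma integral_derivative_zero:
  fixes g g' :: "'n::finite torus \<Rightarrow> complex"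
  assumes g: "continuous_on UNIV g" and g': "continuous_on UNIV g'"
    and deriv: "\<And>x. ((\<lambda>s. g (abs_torus (x + s *\<^sub>R axis i 1))) has_vector_derivative g' (abs_torus x)) (at 0)"
  shows "(LINT p|torus_lebesgue. g' p) = 0"
proof -
  have [measurable]: "g \<in> borel_measurable borel" "g' \<in> borel_measurable borel"
    using g g' by (auto intro: borel_measurable_continuous_onI)
  obtain B where B: "B > 0" "\<And>p. norm (g' p) \<le> B" using continuous_torus_bounded[OF g'] by blast
  define t where "t n = inverse (real (Suc n))" for n
  have t: "t n > 0" "t n \<le> 1" for n by (auto simp: t_def inverse_le_1_iff)
  have tlim: "t \<longlonglongrightarrow> 0" unfolding t_def by (rule LIMSEQ_inverse_real_of_nat)
  let ?\<gamma> = "\<lambda>x s. g (abs_torus (x + s *\<^sub>R axis i 1))"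
  define q where "q n x = (?\<gamma> x (t n) - g (abs_torus x)) /\<^sub>R t n" for n x
  \<comment> \<open>Differentiability is given at s = 0 only; moving the base point along the axis
    yields it at every s, as the mean value inequality behind \<open>qb\<close> requires.\<close>
  have d: "(?\<gamma> x has_derivative (\<lambda>h. h *\<^sub>R g' (abs_torus (x + s *\<^sub>R axis i 1)))) (at s)" for x s
  proof -
    have "((\<lambda>r. g (abs_torus ((x + s *\<^sub>R axis i 1) + (r - s) *\<^sub>R axis i 1))) has_derivative
        (\<lambda>h. h *\<^sub>R g' (abs_torus (x + s *\<^sub>R axis i 1)))) (at s)"
      by (rule has_derivative_eq_rhs[OF has_derivative_compose[of "\<lambda>r. r - s" _ _ _
              "?\<gamma> (x + s *\<^sub>R axis i 1)"]])
         (use deriv[of "x + s *\<^sub>R axis i 1"] in \<open>auto simp: has_vector_derivative_def intro!: derivative_eq_intros\<close>)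
    then show ?thesis by (simp add: algebra_simps)
  qed
  have qb: "norm (q n x) \<le> B" for n x
  proof -
    have "norm (?\<gamma> x (t n) - ?\<gamma> x 0) \<le> B * norm (t n - 0)"
      by (rule differentiable_bound[OF convex_UNIV has_derivative_at_withinI[OF d]])
         (use B in \<open>auto intro!: onorm_bound mult_left_mono simp: mult.commute[of B]\<close>)
    then show ?thesis using t[of n] by (simp add: q_def divide_simps norm_divide)
  qed
  have qlim: "(\<lambda>n. q n x) \<longlonglongrightarrow> g' (abs_torus x)" for x
  proof -
    have "(?\<gamma> x has_vector_derivative g' (abs_torus x)) (at 0)" by (rule deriv)
    then have "((\<lambda>s. norm ((?\<gamma> x s - g (abs_torus x)) - s *\<^sub>R g' (abs_torus x)) / \<bar>s\<bar>) \<longlongrightarrow> 0) (at 0)"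
      by (simp add: has_vector_derivative_def has_derivative_iff_norm)
    moreover have "filterlim t (at 0) sequentially"
      using tlim t by (auto simp: filterlim_at intro!: always_eventually) (metis less_irrefl)
    ultimately have "(\<lambda>n. norm ((?\<gamma> x (t n) - g (abs_torus x)) - t n *\<^sub>R g' (abs_torus x)) / \<bar>t n\<bar>) \<longlonglongrightarrow> 0"
      by (rule filterlim_compose)
    moreover have "norm ((?\<gamma> x (t n) - g (abs_torus x)) - t n *\<^sub>R g' (abs_torus x)) / \<bar>t n\<bar> =
        norm (q n x - g' (abs_torus x))" for n
    proof -
      have "q n x - g' (abs_torus x) = ((?\<gamma> x (t n) - g (abs_torus x)) - t n *\<^sub>R g' (abs_torus x)) /\<^sub>R t n"
        using t[of n] by (simp add: q_def scaleR_diff_right)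
      then show ?thesis using t[of n] by (simp add: divide_inverse mult.commute)
    qed
    ultimately show ?thesis by (simp add: LIM_zero_iff tendsto_norm_zero_iff)
  qed
  have int0: "(LINT x|lborel. indicator unit_cube x *\<^sub>R q n x) = 0" for n
  proof -
    have i1: "integrable lborel (\<lambda>x. indicator unit_cube x *\<^sub>R g (abs_torus x))"
      using continuous_torus_integrable[OF g] by (simp add: torus_integrable_iff)
    obtain Bg where Bg: "\<And>p. norm (g p) \<le> Bg" using continuous_torus_bounded[OF g] by blast
    have i2: "integrable lborel (\<lambda>x. indicator unit_cube x *\<^sub>R ?\<gamma> x (t n))"
    proof (rule Bochner_Integration.integrable_bound)
      show "integrable lborel (\<lambda>x::real^'n. Bg * indicator unit_cube x)"
        by (simp add: integrable_mult_right_iff emeasure_unit_cube integrable_indicator_iff)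
    qed (use Bg order_trans[OF norm_ge_zero Bg] in \<open>auto simp: indicator_def\<close>)
    have "indicator unit_cube x *\<^sub>R q n x = (indicator unit_cube x *\<^sub>R ?\<gamma> x (t n) -
        indicator unit_cube x *\<^sub>R g (abs_torus x)) /\<^sub>R t n" for x
      by (simp add: q_def scaleR_diff_right mult.commute)
    then have "(LINT x|lborel. indicator unit_cube x *\<^sub>R q n x) =
       ((LINT x|lborel. indicator unit_cube x *\<^sub>R ?\<gamma> x (t n)) -
        (LINT x|lborel. indicator unit_cube x *\<^sub>R g (abs_torus x))) /\<^sub>R t n"
      using i1 i2 by (simp only: integral_scaleR_right Bochner_Integration.integral_diff)
    also have "(LINT x|lborel. indicator unit_cube x *\<^sub>R ?\<gamma> x (t n)) = (LINT p|torus_lebesgue. g p)"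
      by (rule torus_integral_shift[OF g]) (use t[of n] in auto)
    finally show ?thesis by (simp add: torus_integral)
  qed
  have "(\<lambda>n. LINT x|lborel. indicator unit_cube x *\<^sub>R q n x) \<longlonglongrightarrow>
      (LINT x|lborel. indicator unit_cube x *\<^sub>R g' (abs_torus x))"
  proof (rule integral_dominated_convergence)
    show "integrable lborel (\<lambda>x::real^'n. B * indicator unit_cube x)"
      by (simp add: integrable_mult_right_iff emeasure_unit_cube integrable_indicator_iff)
    show "(\<lambda>x. indicator unit_cube x *\<^sub>R q n x) \<in> borel_measurable lborel" for n
      unfolding q_def by measurable
    show "AE x in lborel. (\<lambda>n. indicator unit_cube x *\<^sub>R q n x) \<longlonglongrightarrow> indicator unit_cube x *\<^sub>R g' (abs_torus x)"
      by (intro AE_I2 tendsto_intros qlim)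
    show "AE x in lborel. norm (indicator unit_cube x *\<^sub>R q n x) \<le> B * indicator unit_cube x" for n
      using qb B by (auto simp: indicator_def)
  qed simp
  then have "(LINT x|lborel. indicator unit_cube x *\<^sub>R g' (abs_torus x)) = 0"
    unfolding int0 using LIMSEQ_unique tendsto_const by blast
  then show ?thesis by (simp add: torus_integral)
qed

lemma fourier_mode_has_vector_derivative:
  "((\<lambda>s. fourier_mode k (abs_torus (x + s *\<^sub>R axis i 1))) has_vector_derivative
     2 * pi * \<i> * (k $ i) * fourier_mode k (abs_torus x)) (at 0)"
proof -
  have "fourier_mode k (abs_torus (x + s *\<^sub>R axis i 1)) =
      fourier_mode k (abs_torus x) * exp (of_real s * (2 * pi * \<i> * (k $ i)))" for s
    unfolding fourier_mode_abs inner_add_right distrib_left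
    by (simp add: inner_axis cis_conv_exp exp_add[symmetric] algebra_simps)
  moreover have "((\<lambda>s. fourier_mode k (abs_torus x) * exp (of_real s * (2 * pi * \<i> * (k $ i)))) has_vector_derivative
     2 * pi * \<i> * (k $ i) * fourier_mode k (abs_torus x)) (at 0)"
    by (auto intro!: derivative_eq_intros has_vector_derivative_real_field)
  ultimately show ?thesis by simp
qed

text \<open>Integration by parts: \<open>g'\<close> is the derivative of \<open>h\<close> times the
  conjugate mode, so its integral vanishes and its two terms balance.\<close>

lemma fourier_coeff_partial:
  assumes h: "C1_torus h"
  shows "fourier_coeff (torus_partial i h) k = 2 * pi * \<i> * (k $ i) * fourier_coeff h k"
proof -
  let ?e = "fourier_mode (- k)"
  define g' where "g' p = of_real (torus_partial i h p) * ?e p - 2 * pi * \<i> * (k $ i) * (of_real (h p) * ?e p)" for p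
  have "(LINT p|torus_lebesgue. g' p) = 0"
  proof (rule integral_derivative_zero)
    show "continuous_on UNIV (\<lambda>p. of_real (h p) * ?e p)"
      by (intro continuous_intros C1_torus_continuous h continuous_fourier_mode)
    show "continuous_on UNIV g'" unfolding g'_def
      by (intro continuous_intros C1_torus_continuous h continuous_fourier_mode continuous_torus_partial)
    fix x :: "real^'a"
    have "((\<lambda>s. h (abs_torus (x + s *\<^sub>R axis i 1))) has_derivative (\<lambda>s. s * torus_partial i h (abs_torus x))) (at 0)"
    proof (rule has_derivative_eq_rhs[OF has_derivative_compose[of "\<lambda>s. x + s *\<^sub>R axis i 1" "\<lambda>s. s *\<^sub>R axis i 1"]])
      show "((\<lambda>s. x + s *\<^sub>R axis i 1) has_derivative (\<lambda>s. s *\<^sub>R axis i 1)) (at 0)"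
        by (auto intro!: derivative_eq_intros)
      show "((\<lambda>x. h (abs_torus x)) has_derivative (\<lambda>v. \<Sum>i\<in>UNIV. v $ i * torus_partial i h (abs_torus x)))
         (at (x + 0 *\<^sub>R axis i 1))" using C1_torus_derivative[OF h] by simp
    qed (simp add: axis_def if_distrib[of "\<lambda>x. _ * x * _"] if_distrib[of "\<lambda>x. x * _"] cong: if_cong)
    then have "((\<lambda>s. h (abs_torus (x + s *\<^sub>R axis i 1))) has_vector_derivative torus_partial i h (abs_torus x)) (at 0)"
      by (simp add: has_vector_derivative_def)
    from has_vector_derivative_mult[OF has_vector_derivative_of_real[OF this[folded has_real_derivative_iff_has_vector_derivative]]
        fourier_mode_has_vector_derivative[of "- k" x i]]
    show "((\<lambda>s. of_real (h (abs_torus (x + s *\<^sub>R axis i 1))) * ?e (abs_torus (x + s *\<^sub>R axis i 1)))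
       has_vector_derivative g' (abs_torus x)) (at 0)"
      by (simp add: g'_def algebra_simps)
  qed
  moreover have "(LINT p|torus_lebesgue. g' p) =
      fourier_coeff (torus_partial i h) k - 2 * pi * \<i> * (k $ i) * fourier_coeff h k"
    unfolding g'_def fourier_coeff_altdef
    by (subst Bochner_Integration.integral_diff)
       (auto intro!: L2_fun_integrable_mode L2_fun_continuous C1_torus_continuous h continuous_torus_partial integrable_mult_right)
  ultimately show ?thesis by simp
qed

text \<open>Parseval for each partial derivative, summed over the coordinates; 4 pi^2 |k|^2 is the
  squared symbol of the gradient.\<close>

lemma dirichlet_parseval:
  assumes h: "C1_torus h"
  shows "((\<lambda>k. 4 * pi\<^sup>2 * ((norm (real_vec k))\<^sup>2 * (norm (fourier_coeff h k))\<^sup>2)) has_sum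
     (\<Sum>i\<in>UNIV. (L2_norm (torus_partial i h))\<^sup>2)) UNIV"
proof -
  have "((\<lambda>k. \<Sum>i\<in>I. (norm (fourier_coeff (torus_partial i h) k))\<^sup>2) has_sum
     (\<Sum>i\<in>I. (L2_norm (torus_partial i h))\<^sup>2)) UNIV" for I
    by (induction I rule: infinite_finite_induct)
       (auto intro!: has_sum_add parseval L2_fun_continuous continuous_torus_partial h)
  then have "((\<lambda>k. \<Sum>i\<in>UNIV. (norm (fourier_coeff (torus_partial i h) k))\<^sup>2) has_sum
     (\<Sum>i\<in>UNIV. (L2_norm (torus_partial i h))\<^sup>2)) UNIV" .
  moreover have "(\<Sum>i\<in>UNIV. (norm (fourier_coeff (torus_partial i h) k))\<^sup>2) =
      4 * pi\<^sup>2 * ((norm (real_vec k))\<^sup>2 * (norm (fourier_coeff h k))\<^sup>2)" for k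
  proof -
    have "(norm (fourier_coeff (torus_partial i h) k))\<^sup>2 = (4 * pi\<^sup>2 * (norm (fourier_coeff h k))\<^sup>2) * (real_of_int (k $ i))\<^sup>2" for i
      by (simp add: fourier_coeff_partial[OF h] norm_mult power_mult_distrib)
    then show ?thesis
      by (simp add: sum_distrib_left[symmetric] norm_vec_def L2_set_def sum_nonneg)
  qed
  ultimately show ?thesis by simp
qed

lemma C1_torus_trig_sum: "C1_torus (trig_sum K c)"
  unfolding C1_torus_def
proof (rule Ck_1I)
  let ?t = "\<lambda>k x. 2 * pi * (real_vec k \<bullet> x)"
  show "((\<lambda>x. trig_sum K c (abs_torus x)) has_derivative
     (\<lambda>v. \<Sum>k\<in>K. (- Re (c k) * sin (?t k x) - Im (c k) * cos (?t k x)) * ?t k v)) (at x)" for x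
    unfolding trig_sum_eq_sum fourier_mode_abs
    by (auto intro!: derivative_eq_intros sum.cong simp: algebra_simps)
  show "continuous_on UNIV (\<lambda>x. \<Sum>k\<in>K. (- Re (c k) * sin (?t k x) - Im (c k) * cos (?t k x)) * ?t k v)" for v
    by (intro continuous_intros)
qed

section \<open>Volume-preserving diffeomorphisms\<close>

text \<open>A continuous map into a discrete set is constant on a connected space. Applied to
  differences of lifts, this makes them differ by a fixed integer vector.\<close>

lemma integer_valued_constant:
  fixes \<phi> :: "'a::real_normed_vector \<Rightarrow> real^'n::finite"
  assumes "continuous_on UNIV \<phi>" "\<And>x i. \<phi> x $ i \<in> \<int>"
  obtains c where "\<And>x. \<phi> x = c"
proof -
  have "(\<lambda>x. \<phi> x $ i) constant_on UNIV" for i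
  proof (rule continuous_discrete_range_constant)
    show "\<exists>e>0. \<forall>y. y \<in> UNIV \<and> \<phi> y $ i \<noteq> \<phi> x $ i \<longrightarrow> e \<le> norm (\<phi> y $ i - \<phi> x $ i)" for x
    proof (intro exI[of _ 1] conjI allI impI)
      fix y assume "y \<in> UNIV \<and> \<phi> y $ i \<noteq> \<phi> x $ i"
      moreover obtain a b where "\<phi> y $ i = of_int a" "\<phi> x $ i = of_int b"
        using assms(2) by (metis Ints_cases)
      ultimately show "1 \<le> norm (\<phi> y $ i - \<phi> x $ i)" by (simp flip: of_int_diff)
    qed simp
  qed (auto intro!: continuous_intros assms)
  then have "\<phi> x = \<phi> 0" for x unfolding vec_eq_iff constant_on_def by (metis UNIV_I)
  then show thesis by (rule that)
qed

lemma smooth_lift_Ck1: "smooth_lift f F \<Longrightarrow> Ck (Suc 0) F"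
  unfolding smooth_lift_def C_inf_def by blast

lemma smooth_lift_continuous: "smooth_lift f F \<Longrightarrow> continuous_on UNIV f"
  unfolding continuous_torus_iff smooth_lift_def C_inf_def
  by (metis (no_types, lifting) Ck.simps(1) continuous_on_compose2 continuous_abs_torus continuous_on_cong subset_UNIV)

lemma smooth_lift_translate:
  assumes F: "smooth_lift f F" and xy: "abs_torus x = abs_torus y"
  shows "frechet_derivative F (at x) = frechet_derivative F (at y)"
proof -
  have cont: "continuous_on UNIV F" by (rule Ck_1_continuous[OF smooth_lift_Ck1[OF F]])
  have "abs_torus (F (z + (y - x))) = abs_torus (F z)" for z
  proof -
    have "abs_torus (z + (y - x)) = abs_torus z"
      using xy[symmetric] by (simp add: abs_torus_eq_iff)
    then show ?thesis using F by (metis smooth_lift_def)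
  qed
  then have int: "(F (z + (y - x)) - F z) $ i \<in> \<int>" for z i
    by (simp add: abs_torus_eq_iff)
  have "continuous_on UNIV (\<lambda>z. F (z + (y - x)) - F z)"
    by (intro continuous_on_diff continuous_on_compose2[OF cont] continuous_intros) auto
  then obtain c where c: "\<And>z. F (z + (y - x)) - F z = c"
    using integer_valued_constant int by blast
  have tr: "F (z + (y - x)) = F z + c" for z using c[of z] by (simp add: algebra_simps)
  have "(F has_derivative frechet_derivative F (at y)) (at x)"
    by (rule frechet_derivative_translate[OF Ck_1D(1)[OF smooth_lift_Ck1[OF F]] tr])
  then show ?thesis by (rule frechet_derivative_at[symmetric])
qed

locale volume_diffeo =
  fixes f :: "'n::finite torus \<Rightarrow> 'n torus"
  assumes diffeo: "smooth_diffeo f" and volume: "preserves_lebesgue f"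
begin

lemma f_inv_f [simp]: "f (inv f p) = p"
  using diffeo by (simp add: smooth_diffeo_def bij_is_surj surj_f_inv_f)

lemma inv_f_f [simp]: "inv f (f p) = p"
  using diffeo by (simp add: smooth_diffeo_def bij_is_inj)

lemma continuous_inv: "continuous_on UNIV (inv f)"
  using diffeo smooth_lift_continuous unfolding smooth_diffeo_def smooth_map_def by blast

lemma measurable_inv [measurable]: "inv f \<in> borel_measurable borel"
  by (rule borel_measurable_continuous_onI[OF continuous_inv])

lemma measurable_comp_inv:
  assumes "\<phi> \<in> borel_measurable torus_lebesgue"
  shows "(\<phi> \<circ> inv f) \<in> borel_measurable torus_lebesgue"
  using assms by (simp add: measurable_cong_sets[OF sets_torus_lebesgue refl] comp_def)

lemma distr_f: "distr torus_lebesgue torus_lebesgue f = torus_lebesgue"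
  and measurable_f: "f \<in> measurable torus_lebesgue torus_lebesgue"
  using volume by (simp_all add: preserves_lebesgue_def)

lemma integral_comp_inv:
  fixes \<phi> :: "'n torus \<Rightarrow> 'b::{banach,second_countable_topology}"
  assumes "\<phi> \<in> borel_measurable torus_lebesgue"
  shows "(LINT x|torus_lebesgue. \<phi> (inv f x)) = (LINT x|torus_lebesgue. \<phi> x)"
proof -
  have "(LINT x|torus_lebesgue. \<phi> (inv f x)) = (LINT x|distr torus_lebesgue torus_lebesgue f. \<phi> (inv f x))"
    by (simp add: distr_f)
  also have "\<dots> = (LINT x|torus_lebesgue. \<phi> (inv f (f x)))"
    by (rule integral_distr[OF measurable_f]) (use measurable_comp_inv[OF assms] in \<open>simp add: comp_def\<close>)
  finally show ?thesis by simp
qed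

lemma integrable_comp_inv:
  fixes \<phi> :: "'n torus \<Rightarrow> 'b::{banach,second_countable_topology}"
  assumes "integrable torus_lebesgue \<phi>"
  shows "integrable torus_lebesgue (\<lambda>x. \<phi> (inv f x))"
proof -
  have "(\<lambda>x. \<phi> (inv f x)) \<in> borel_measurable torus_lebesgue"
    using measurable_comp_inv[of \<phi>] assms by (simp add: comp_def)
  from integrable_distr_eq[OF measurable_f this] show ?thesis
    using assms by (simp add: distr_f)
qed

lemma L2_fun_comp_inv: "h \<in> L2_fun \<Longrightarrow> (h \<circ> inv f) \<in> L2_fun"
  using measurable_comp_inv integrable_comp_inv[of "\<lambda>x. (h x)\<^sup>2"]
  by (auto simp: L2_fun_def)

lemma L2_norm_comp_inv: "h \<in> L2_fun \<Longrightarrow> L2_norm (h \<circ> inv f) = L2_norm h"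
  using integral_comp_inv[of "\<lambda>x. (h x)\<^sup>2", OF borel_measurable_integrable]
  by (simp add: L2_norm_def L2_fun_def)

lemma L2_zero_comp_inv: "h \<in> L2_zero \<Longrightarrow> (h \<circ> inv f) \<in> L2_zero"
  using integral_comp_inv[of h] L2_fun_measurable[of h]
  by (simp add: L2_zero_iff L2_fun_comp_inv fourier_coeff_0)

lemma L2_norm_comp_inv_diff:
  "g \<in> L2_fun \<Longrightarrow> h \<in> L2_fun \<Longrightarrow>
    L2_norm (\<lambda>x. (g \<circ> inv f) x - (h \<circ> inv f) x) = L2_norm (\<lambda>x. g x - h x)"
  using L2_norm_comp_inv[OF L2_fun_diff, of g h] by (simp add: comp_def)

text \<open>Since \<open>F\<close> after \<open>G\<close> is a translation, the inverse of the
  derivative of \<open>f\<close> is the derivative of the lift \<open>G\<close> of the inverse map.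
  This turns the supremum behind \<open>Lambda_of\<close> into a bound on the derivative of
  \<open>G\<close>.\<close>

lemma inverse_lift:
  obtains G where "smooth_lift (inv f) G"
    "\<And>x. Lambda_of f > 0 \<Longrightarrow> onorm (frechet_derivative G (at x)) \<le> exp (Lambda_of f)"
proof -
  define F where "F = (SOME F. smooth_lift f F)"
  have F: "smooth_lift f F"
    using diffeo unfolding F_def smooth_diffeo_def smooth_map_def by (metis someI_ex)
  obtain G where G: "smooth_lift (inv f) G"
    using diffeo unfolding smooth_diffeo_def smooth_map_def by blast
  let ?DF = "\<lambda>x. frechet_derivative F (at x)" and ?DG = "\<lambda>x. frechet_derivative G (at x)"
  note dF = Ck_1D(1)[OF smooth_lift_Ck1[OF F]] and dG = Ck_1D(1)[OF smooth_lift_Ck1[OF G]]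
  have cF: "continuous_on UNIV F" and cG: "continuous_on UNIV G"
    using Ck_1_continuous smooth_lift_Ck1 F G by blast+
  have "abs_torus (F (G x)) = abs_torus x" for x
    using F G unfolding smooth_lift_def by (metis f_inv_f)
  then have int: "(F (G x) - x) $ i \<in> \<int>" for x i
    by (simp add: abs_torus_eq_iff)
  have "continuous_on UNIV (\<lambda>x. F (G x) - x)"
    by (intro continuous_on_diff continuous_on_compose2[OF cF cG] continuous_intros) auto
  then obtain c where c: "\<And>x. F (G x) - x = c"
    using integer_valued_constant int by blast
  have FG: "F (G x) = x + c" for x using c[of x] by (simp add: algebra_simps)
  have inv: "inv (?DF (G x)) = ?DG x" for x
  proof -
    have "((\<lambda>x. F (G x)) has_derivative (\<lambda>v. ?DF (G x) (?DG x v))) (at x)"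
      by (rule has_derivative_compose[OF dG dF])
    moreover have "((\<lambda>x. F (G x)) has_derivative (\<lambda>v. v)) (at x)"
      unfolding FG by (auto intro!: derivative_eq_intros)
    ultimately have "(\<lambda>v. ?DF (G x) (?DG x v)) = (\<lambda>v. v)" by (rule has_derivative_unique)
    then have 1: "?DF (G x) \<circ> ?DG x = id" by (simp add: fun_eq_iff)
    \<comment> \<open>In finite dimension a one-sided linear inverse is two-sided.\<close>
    moreover have "?DG x \<circ> ?DF (G x) = id"
      using 1 linear_inverse_left[of "?DF (G x)" "?DG x"]
        has_derivative_linear[OF dF] has_derivative_linear[OF dG] by blast
    ultimately show ?thesis by (simp add: inv_unique_comp)
  qed
  have deriv: "inv (torus_deriv f (inv f (abs_torus x))) = ?DG x" for x
  proof -
    have "abs_torus (rep_torus (inv f (abs_torus x))) = abs_torus (G x)"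
      using G by (simp add: smooth_lift_def)
    then show ?thesis
      unfolding torus_deriv_def F_def[symmetric] inv[symmetric]
      by (simp only: smooth_lift_translate[OF F, of "rep_torus (inv f (abs_torus x))" "G x"])
  qed
  \<comment> \<open>A supremum of reals bounds its family only if the family is bounded. The columns
    of the derivative are bounded on the closed cube, which represents every point.\<close>
  have "\<exists>B. \<forall>x\<in>cbox 0 1. norm (?DG x (axis i 1)) \<le> B" for i :: 'n
  proof -
    have "compact ((\<lambda>x. ?DG x (axis i 1)) ` cbox 0 1)"
      by (intro compact_continuous_image continuous_on_subset[OF Ck_1D(2)[OF smooth_lift_Ck1[OF G]]]) auto
    then show ?thesis by (auto dest!: compact_imp_bounded simp: bounded_iff)
  qed
  then obtain B where B: "\<And>i x. x \<in> cbox 0 1 \<Longrightarrow> norm (?DG x (axis i 1)) \<le> B i" by metis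
  have "onorm (?DG x) \<le> (\<Sum>i\<in>UNIV. \<bar>B i\<bar>)" if x: "x \<in> cbox 0 1" for x
  proof (rule onorm_bound)
    interpret bounded_linear "?DG x" using dG by (rule has_derivative_bounded_linear)
    fix v :: "real^'n"
    have "norm (?DG x v) = norm (?DG x (\<Sum>i\<in>UNIV. (v $ i) *\<^sub>R axis i 1))"
      by (simp add: basis_expansion scalar_mult_eq_scaleR[symmetric])
    also have "\<dots> \<le> (\<Sum>i\<in>UNIV. \<bar>v $ i\<bar> * norm (?DG x (axis i 1)))"
      unfolding sum scaleR by (rule order_trans[OF norm_sum]) simp
    also have "\<dots> \<le> (\<Sum>i\<in>UNIV. norm v * \<bar>B i\<bar>)"
      by (intro sum_mono mult_mono component_le_norm_cart order_trans[OF B[OF x] abs_ge_self]) auto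
    finally show "norm (?DG x v) \<le> (\<Sum>i\<in>UNIV. \<bar>B i\<bar>) * norm v"
      by (simp add: sum_distrib_left mult.commute)
  qed (simp add: sum_nonneg)
  moreover have "\<exists>x\<in>cbox 0 1. onorm (inv (torus_deriv f p)) = onorm (?DG x)" for p
  proof -
    obtain x where x: "x \<in> unit_cube" "f p = abs_torus x" by (rule torus_representative)
    then have "p = inv f (abs_torus x)" by (metis inv_f_f)
    then have "onorm (inv (torus_deriv f p)) = onorm (?DG x)" by (simp add: deriv)
    moreover have "x \<in> cbox 0 1" using x by (auto simp: unit_cube_def mem_box_cart less_imp_le)
    ultimately show ?thesis by blast
  qed
  ultimately have bdd: "bdd_above (range (\<lambda>p. onorm (inv (torus_deriv f p))))"
    by (intro bdd_aboveI2[where M="\<Sum>i\<in>UNIV. \<bar>B i\<bar>"]) (metis (no_types, lifting))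
  have "onorm (?DG x) \<le> exp (Lambda_of f)" if "Lambda_of f > 0" for x
  proof -
    define S where "S = (SUP p. onorm (inv (torus_deriv f p)))"
    have le: "onorm (?DG x) \<le> S"
      unfolding S_def deriv[symmetric] by (rule cSUP_upper[OF UNIV_I bdd])
    have "0 \<le> S"
      using order_trans[OF onorm_pos_le[OF has_derivative_bounded_linear[OF dG]] le] .
    \<comment> \<open>As ln 0 = 0, a positive \<open>Lambda_of f\<close> excludes S = 0, so that exp
      undoes ln.\<close>
    moreover have "S \<noteq> 0" using that by (auto simp: Lambda_of_def S_def)
    ultimately show ?thesis using le by (simp add: Lambda_of_def S_def[symmetric])
  qed
  with G show thesis by (rule that)
qed

text \<open>The gradient of \<open>p \<circ> f\<inverse>\<close> is the transpose of the differential of \<open>f\<inverse>\<close> applied to the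
  gradient of \<open>p\<close>.\<close>

lemma gradient_comp_inv:
  assumes p: "C1_torus p" and \<Lambda>: "Lambda_of f > 0"
  shows "C1_torus (p \<circ> inv f)"
    "(\<Sum>i\<in>UNIV. (torus_partial i (p \<circ> inv f) q)\<^sup>2) \<le>
       exp (2 * Lambda_of f) * (\<Sum>i\<in>UNIV. (torus_partial i p (inv f q))\<^sup>2)"
proof -
  obtain G where G: "smooth_lift (inv f) G"
    and on: "\<And>x. onorm (frechet_derivative G (at x)) \<le> exp (Lambda_of f)"
    using inverse_lift \<Lambda> by metis
  let ?DG = "\<lambda>x. frechet_derivative G (at x)"
  note dG = Ck_1D(1)[OF smooth_lift_Ck1[OF G]]
  have cG: "continuous_on UNIV G" using Ck_1_continuous smooth_lift_Ck1 G by blast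
  have lift: "inv f (abs_torus x) = abs_torus (G x)" for x
    using G by (simp add: smooth_lift_def)
  have d: "((\<lambda>x. (p \<circ> inv f) (abs_torus x)) has_derivative
     (\<lambda>v. \<Sum>i\<in>UNIV. ?DG x v $ i * torus_partial i p (abs_torus (G x)))) (at x)" for x
    unfolding comp_def lift by (rule has_derivative_compose[OF dG C1_torus_derivative[OF p]])
  show C1: "C1_torus (p \<circ> inv f)"
    unfolding C1_torus_def
  proof (rule Ck_1I[OF d])
    show "continuous_on UNIV (\<lambda>x. \<Sum>i\<in>UNIV. ?DG x v $ i * torus_partial i p (abs_torus (G x)))" for v
      by (intro continuous_on_sum continuous_on_mult continuous_on_component
          Ck_1D(2)[OF smooth_lift_Ck1[OF G]] continuous_on_compose2[OF continuous_torus_partial[OF p]]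
          continuous_on_compose2[OF continuous_abs_torus cG]) auto
  qed
  obtain x where q: "q = abs_torus x" by (metis torus_representative)
  interpret bounded_linear "?DG x" using dG by (rule has_derivative_bounded_linear)
  define a w :: "real^'n" where "a = (\<chi> i. torus_partial i (p \<circ> inv f) q)"
    and "w = (\<chi> i. torus_partial i p (inv f q))"
  have "(\<Sum>i\<in>UNIV. v $ i * torus_partial i (p \<circ> inv f) q) = ?DG x v \<bullet> w" for v
    using fun_cong[OF has_derivative_unique[OF C1_torus_derivative[OF C1] d[of x]], of v]
    by (simp add: q lift w_def inner_vec_def)
  \<comment> \<open>Testing with the gradient \<open>a\<close> itself bounds its norm without
    forming the transpose.\<close>
  from this[of a] have "a \<bullet> a = ?DG x a \<bullet> w" by (simp add: a_def inner_vec_def)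
  also have "\<dots> \<le> norm (?DG x a) * norm w" by (rule norm_cauchy_schwarz)
  also have "\<dots> \<le> (exp (Lambda_of f) * norm a) * norm w"
    by (intro mult_right_mono order_trans[OF onorm[OF bounded_linear_axioms]] on) auto
  finally have "norm a * norm a \<le> norm a * (exp (Lambda_of f) * norm w)"
    by (simp add: power2_norm_eq_inner[symmetric] power2_eq_square mult_ac)
  then have "norm a \<le> exp (Lambda_of f) * norm w"
    by (cases "norm a = 0") (auto simp: mult_le_cancel_left)
  then have "(norm a)\<^sup>2 \<le> (exp (Lambda_of f) * norm w)\<^sup>2" by (intro power_mono) auto
  also have "\<dots> = exp (2 * Lambda_of f) * (norm w)\<^sup>2"
    by (simp add: power_mult_distrib exp_double)
  finally show "(\<Sum>i\<in>UNIV. (torus_partial i (p \<circ> inv f) q)\<^sup>2) \<le>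
       exp (2 * Lambda_of f) * (\<Sum>i\<in>UNIV. (torus_partial i p (inv f q))\<^sup>2)"
    by (simp add: norm_vec_def L2_set_def sum_nonneg a_def w_def)
qed

lemma dirichlet_comp_inv_C1:
  assumes p: "C1_torus p" and \<Lambda>: "Lambda_of f > 0"
  shows "(\<Sum>i\<in>UNIV. (L2_norm (torus_partial i (p \<circ> inv f)))\<^sup>2) \<le>
    exp (2 * Lambda_of f) * (\<Sum>i\<in>UNIV. (L2_norm (torus_partial i p))\<^sup>2)"
proof -
  have sum: "(\<Sum>i\<in>UNIV. (L2_norm (torus_partial i h))\<^sup>2) = (LINT q|torus_lebesgue. (\<Sum>i\<in>UNIV. (torus_partial i h q)\<^sup>2))"
    and int: "integrable torus_lebesgue (\<lambda>q. \<Sum>i\<in>UNIV. (torus_partial i h q)\<^sup>2)"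
    if "C1_torus h" for h :: "'n torus \<Rightarrow> real"
    using L2_fun_continuous[OF continuous_torus_partial[OF that]]
    by (simp_all add: L2_norm_def L2_fun_def)
  note C1 = gradient_comp_inv(1)[OF p \<Lambda>]
  have "(LINT q|torus_lebesgue. (\<Sum>i\<in>UNIV. (torus_partial i (p \<circ> inv f) q)\<^sup>2)) \<le>
     (LINT q|torus_lebesgue. exp (2 * Lambda_of f) * (\<Sum>i\<in>UNIV. (torus_partial i p (inv f q))\<^sup>2))"
    by (intro integral_mono int C1 integrable_mult_right integrable_comp_inv[OF int[OF p]]
        gradient_comp_inv(2)[OF p \<Lambda>])
  also have "\<dots> = exp (2 * Lambda_of f) * (LINT q|torus_lebesgue. (\<Sum>i\<in>UNIV. (torus_partial i p q)\<^sup>2))"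
    using integral_comp_inv[OF borel_measurable_integrable[OF int[OF p]]] by simp
  finally show ?thesis by (simp add: sum C1 p)
qed

end

section \<open>Dirichlet energy of square-integrable functions\<close>

text \<open>A bound on the Dirichlet energy divided by 4 pi^2. The functions are merely in L2, so it
  is phrased through finite sums; in this form it survives coefficientwise limits and multiplication
  by heat factors.\<close>

definition dirichlet_le :: "('n::finite torus \<Rightarrow> real) \<Rightarrow> real \<Rightarrow> bool" where
  "dirichlet_le h B \<longleftrightarrow> (\<forall>K. finite K \<longrightarrow> (\<Sum>k\<in>K. (norm (real_vec k))\<^sup>2 * (norm (fourier_coeff h k))\<^sup>2) \<le> B)"

lemma dirichlet_le_C1:
  assumes "C1_torus h"
  shows "dirichlet_le h ((\<Sum>i\<in>UNIV. (L2_norm (torus_partial i h))\<^sup>2) / (4 * pi\<^sup>2))"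
  unfolding dirichlet_le_def
proof (intro allI impI)
  fix K :: "(int^'a) set" assume "finite K"
  then have "(\<Sum>k\<in>K. 4 * pi\<^sup>2 * ((norm (real_vec k))\<^sup>2 * (norm (fourier_coeff h k))\<^sup>2)) \<le>
      (\<Sum>i\<in>UNIV. (L2_norm (torus_partial i h))\<^sup>2)"
    by (intro finite_sum_le_has_sum[OF dirichlet_parseval[OF assms]]) auto
  then show "(\<Sum>k\<in>K. (norm (real_vec k))\<^sup>2 * (norm (fourier_coeff h k))\<^sup>2) \<le>
      (\<Sum>i\<in>UNIV. (L2_norm (torus_partial i h))\<^sup>2) / (4 * pi\<^sup>2)"
    by (simp add: sum_distrib_left[symmetric] pos_le_divide_eq mult.commute)
qed

context volume_diffeo
begin

text \<open>Applied to the partial Fourier sums of \<open>h\<close>, which are smooth; the bound on finitely many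
  modes then passes to the \<open>L\<^sup>2\<close> limit.\<close>

lemma dirichlet_comp_inv:
  assumes h: "h \<in> L2_fun" and B: "dirichlet_le h B" and \<Lambda>: "Lambda_of f > 0"
  shows "dirichlet_le (h \<circ> inv f) (exp (2 * Lambda_of f) * B)"
  unfolding dirichlet_le_def
proof (intro allI impI)
  fix L :: "(int^'n) set" assume L: "finite L"
  have "\<exists>K. finite K \<and> symmetric_modes K \<and>
      L2_norm (\<lambda>x. h x - trig_sum K (fourier_coeff h) x) < inverse (real (Suc n))" for n
    using partial_sums_converge[OF h, of "inverse (real (Suc n))"] by (metis inverse_positive_iff_positive of_nat_0_less_iff zero_less_Suc)
  then obtain K where K: "\<And>n. finite (K n)" "\<And>n. symmetric_modes (K n)"
    "\<And>n. L2_norm (\<lambda>x. h x - trig_sum (K n) (fourier_coeff h) x) < inverse (real (Suc n))"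
    by metis
  define p where "p n = trig_sum (K n) (fourier_coeff h)" for n
  have pL2: "p n \<in> L2_fun" for n unfolding p_def by (rule L2_fun_trig_sum)
  have C1: "C1_torus (p n)" for n unfolding p_def by (rule C1_torus_trig_sum)
  have pc: "fourier_coeff (p n) k = (if k \<in> K n then fourier_coeff h k else 0)" for n k
    unfolding p_def by (simp add: fourier_coeff_trig_sum[OF K(1,2)] fourier_coeff_minus)
  have "(\<lambda>n. L2_norm (\<lambda>x. h x - p n x)) \<longlonglongrightarrow> 0"
    by (rule tendsto_sandwich[OF _ _ tendsto_const LIMSEQ_inverse_real_of_nat])
       (use K(3) in \<open>auto simp: p_def less_imp_le intro!: always_eventually\<close>)
  then have lim: "(\<lambda>n. L2_norm (\<lambda>x. (h \<circ> inv f) x - (p n \<circ> inv f) x)) \<longlonglongrightarrow> 0"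
    by (simp only: L2_norm_comp_inv_diff[OF h pL2])
  have clim: "(\<lambda>n. fourier_coeff (p n \<circ> inv f) k) \<longlonglongrightarrow> fourier_coeff (h \<circ> inv f) k" for k
    by (rule fourier_coeff_L2_limit[OF L2_fun_comp_inv[OF pL2] L2_fun_comp_inv[OF h] lim])
  let ?D = "\<lambda>h. \<Sum>i\<in>UNIV. (L2_norm (torus_partial i h))\<^sup>2"
  have bound: "(\<Sum>k\<in>L. (norm (real_vec k))\<^sup>2 * (norm (fourier_coeff (p n \<circ> inv f) k))\<^sup>2) \<le> exp (2 * Lambda_of f) * B" for n
  proof -
    \<comment> \<open>Truncation only removes modes, so the smooth approximants obey the energy
      bound of \<open>h\<close>.\<close>
    have "?D (p n) \<le> 4 * pi\<^sup>2 * B"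
    proof (rule has_sum_le_finite_sums[OF dirichlet_parseval[OF C1]])
      fix F :: "(int^'n) set" assume F: "finite F"
      have "(\<Sum>k\<in>F. (norm (real_vec k))\<^sup>2 * (norm (fourier_coeff (p n) k))\<^sup>2) \<le>
          (\<Sum>k\<in>F. (norm (real_vec k))\<^sup>2 * (norm (fourier_coeff h k))\<^sup>2)"
        by (intro sum_mono mult_left_mono) (auto simp: pc)
      also have "\<dots> \<le> B" using B F by (simp add: dirichlet_le_def)
      finally show "(\<Sum>k\<in>F. 4 * pi\<^sup>2 * ((norm (real_vec k))\<^sup>2 * (norm (fourier_coeff (p n) k))\<^sup>2)) \<le> 4 * pi\<^sup>2 * B"
        by (simp add: sum_distrib_left[symmetric])
    qed
    have "(\<Sum>k\<in>L. (norm (real_vec k))\<^sup>2 * (norm (fourier_coeff (p n \<circ> inv f) k))\<^sup>2) \<le> ?D (p n \<circ> inv f) / (4 * pi\<^sup>2)"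
      using dirichlet_le_C1[OF gradient_comp_inv(1)[OF C1 \<Lambda>]] L by (simp add: dirichlet_le_def)
    also have "\<dots> \<le> exp (2 * Lambda_of f) * ?D (p n) / (4 * pi\<^sup>2)"
      by (intro divide_right_mono dirichlet_comp_inv_C1[OF C1 \<Lambda>]) auto
    also have "\<dots> \<le> exp (2 * Lambda_of f) * (4 * pi\<^sup>2 * B) / (4 * pi\<^sup>2)"
      using \<open>?D (p n) \<le> 4 * pi\<^sup>2 * B\<close> by (intro divide_right_mono mult_left_mono) auto
    finally show ?thesis by simp
  qed
  have "(\<lambda>n. \<Sum>k\<in>L. (norm (real_vec k))\<^sup>2 * (norm (fourier_coeff (p n \<circ> inv f) k))\<^sup>2) \<longlonglongrightarrow>
     (\<Sum>k\<in>L. (norm (real_vec k))\<^sup>2 * (norm (fourier_coeff (h \<circ> inv f) k))\<^sup>2)"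
    by (intro tendsto_intros clim)
  then show "(\<Sum>k\<in>L. (norm (real_vec k))\<^sup>2 * (norm (fourier_coeff (h \<circ> inv f) k))\<^sup>2) \<le> exp (2 * Lambda_of f) * B"
    by (rule LIMSEQ_le_const2) (auto simp: bound)
qed

end

section \<open>Fourier projections\<close>

lemma L2_norm_proj_le:
  assumes "h \<in> L2_fun"
  shows "(L2_norm (proj_le N h))\<^sup>2 = (\<Sum>k | norm (real_vec k) \<le> N. (norm (fourier_coeff h k))\<^sup>2)"
proof -
  have "proj_le N h = trig_sum {k. norm (real_vec k) \<le> N} (fourier_coeff h)"
    by (simp add: proj_le_def trig_sum_def fun_eq_iff)
  then show ?thesis by (simp add: L2_norm_trig_sum fourier_coeff_minus)
qed

lemma L2_norm_proj_ge:
  assumes "h \<in> L2_fun"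
  shows "(L2_norm (proj_ge N h))\<^sup>2 = (L2_norm h)\<^sup>2 - (\<Sum>k | norm (real_vec k) < N. (norm (fourier_coeff h k))\<^sup>2)"
proof -
  have "proj_ge N h = (\<lambda>x. h x - trig_sum {k. norm (real_vec k) < N} (fourier_coeff h) x)"
    by (simp add: proj_ge_def trig_sum_def fun_eq_iff)
  then show ?thesis using assms by (simp add: L2_norm_minus_partial_sum)
qed

lemma L2_norm_proj_le_le: "h \<in> L2_fun \<Longrightarrow> (L2_norm (proj_le N h))\<^sup>2 \<le> (L2_norm h)\<^sup>2"
  unfolding L2_norm_proj_le by (rule bessel) simp_all

text \<open>Chebyshev in frequency: where |k| > N the weight |k|^2 / N^2 exceeds 1, so these modes
  carry at most B / N^2.\<close>

lemma proj_le_lower_bound: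
  assumes h: "h \<in> L2_fun" and B: "dirichlet_le h B" and N: "N > 0"
  shows "(L2_norm h)\<^sup>2 - B / N\<^sup>2 \<le> (L2_norm (proj_le N h))\<^sup>2"
proof -
  let ?c = "\<lambda>k. (norm (fourier_coeff h k))\<^sup>2" and ?K = "{k :: int^'a. norm (real_vec k) \<le> N}"
  have "(L2_norm h)\<^sup>2 \<le> sum ?c ?K + B / N\<^sup>2"
  proof (rule has_sum_le_finite_sums[OF parseval[OF h]])
    fix F :: "(int^'a) set" assume F: "finite F"
    have "sum ?c F = sum ?c (F \<inter> ?K) + sum ?c (F - ?K)" using F by (metis Int_Diff_disjoint Int_Diff_Un finite_Diff finite_Int sum.union_disjoint)
    also have "sum ?c (F \<inter> ?K) \<le> sum ?c ?K" by (intro sum_mono2) auto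
    also have "sum ?c (F - ?K) \<le> (\<Sum>k\<in>F - ?K. (norm (real_vec k))\<^sup>2 * ?c k / N\<^sup>2)"
    proof (rule sum_mono)
      fix k assume "k \<in> F - ?K"
      then have "N\<^sup>2 \<le> (norm (real_vec k))\<^sup>2" using N by (intro power_mono) auto
      then have "?c k * N\<^sup>2 \<le> ?c k * (norm (real_vec k))\<^sup>2" by (intro mult_left_mono) auto
      then show "?c k \<le> (norm (real_vec k))\<^sup>2 * ?c k / N\<^sup>2"
        using N by (simp only: pos_le_divide_eq zero_less_power mult.commute)
    qed
    also have "\<dots> \<le> B / N\<^sup>2"
      using B F unfolding sum_divide_distrib[symmetric] dirichlet_le_def by (intro divide_right_mono) auto
    finally show "sum ?c F \<le> sum ?c ?K + B / N\<^sup>2" by simp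
  qed
  then show ?thesis by (simp add: L2_norm_proj_le[OF h])
qed

text \<open>For 0 < |k| \<le> N the weight |k|^(-2) is at least N^(-2), and mean zero disposes of k
  = 0. Nonzero integer frequencies have |k| \<ge> 1, so the weighted series converges.\<close>

lemma proj_le_upper_bound:
  assumes h: "h \<in> L2_zero" and N: "N > 0"
  shows "(L2_norm (proj_le N h))\<^sup>2 \<le> N\<^sup>2 * (sobolev_norm (-1) h)\<^sup>2"
proof -
  let ?c = "\<lambda>k. (norm (fourier_coeff h k))\<^sup>2" and ?K = "{k :: int^'a. norm (real_vec k) \<le> N}"
  let ?w = "\<lambda>k. norm (real_vec k) powr (2 * (-1)) * ?c k"
  have w: "?w k = ?c k / (norm (real_vec k))\<^sup>2" if "k \<noteq> 0" for k :: "int^'a"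
    using that by (simp add: powr_minus_divide powr_numeral)
  have hL: "h \<in> L2_fun" by (rule L2_zero_imp_L2[OF h])
  have "?c summable_on UNIV - {0}"
    by (rule summable_on_subset_banach[OF has_sum_imp_summable[OF parseval[OF hL]]]) auto
  then have sw: "?w summable_on UNIV - {0}"
  proof (rule summable_on_comparison_test)
    fix k :: "int^'a" assume "k \<in> UNIV - {0}"
    then have k: "k \<noteq> 0" by simp
    then have "1 \<le> (norm (real_vec k))\<^sup>2" by (intro one_le_power norm_real_vec_ge_1)
    then show "?w k \<le> ?c k" unfolding w[OF k]
      by (simp add: divide_le_eq mult_left_le_one_le mult_left_mono mult.commute[of "?c k"] mult_le_cancel_right1)
  qed auto
  have "(L2_norm (proj_le N h))\<^sup>2 = sum ?c (?K - {0})"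
    unfolding L2_norm_proj_le[OF hL] using h by (intro sum.mono_neutral_right) (auto simp: L2_zero_iff)
  also have "\<dots> \<le> (\<Sum>k\<in>?K - {0}. N\<^sup>2 * ?w k)"
  proof (rule sum_mono)
    fix k assume k: "k \<in> ?K - {0}"
    then have "(norm (real_vec k))\<^sup>2 \<le> N\<^sup>2" "k \<noteq> 0" by (auto intro: power_mono)
    then have "?c k * (norm (real_vec k))\<^sup>2 \<le> ?c k * N\<^sup>2" "0 < (norm (real_vec k))\<^sup>2"
      by (auto intro: mult_left_mono)
    then show "?c k \<le> N\<^sup>2 * ?w k"
      unfolding w[OF \<open>k \<noteq> 0\<close>] times_divide_eq_right
      by (simp only: pos_le_divide_eq mult.commute)
  qed
  also have "\<dots> = N\<^sup>2 * (\<Sum>k\<in>?K - {0}. ?w k)" by (simp add: sum_distrib_left)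
  also have "(\<Sum>k\<in>?K - {0}. ?w k) \<le> infsum ?w (UNIV - {0})"
    by (rule finite_sum_le_infsum[OF sw]) auto
  also have "infsum ?w (UNIV - {0}) = (sobolev_norm (-1) h)\<^sup>2"
    unfolding sobolev_norm_def by (subst real_sqrt_pow2) (auto intro: infsum_nonneg)
  finally show ?thesis by (simp add: mult_left_mono)
qed

section \<open>The transfer operator\<close>

lemma L2_norm_le_of_coeffs:
  assumes "u \<in> L2_fun" "v \<in> L2_fun" "c \<ge> 0"
    and le: "\<And>k. norm (fourier_coeff u k) \<le> c * norm (fourier_coeff v k)"
  shows "L2_norm u \<le> c * L2_norm v"
proof (rule L2_norm_le_iff_partial_sums[THEN iffD2], safe)
  fix K :: "(int^'a) set" assume K: "finite K"
  have "(\<Sum>k\<in>K. (norm (fourier_coeff u k))\<^sup>2) \<le> (\<Sum>k\<in>K. (c * norm (fourier_coeff v k))\<^sup>2)"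
    by (intro sum_mono power_mono le) auto
  also have "\<dots> = c\<^sup>2 * (\<Sum>k\<in>K. (norm (fourier_coeff v k))\<^sup>2)"
    by (simp add: power_mult_distrib sum_distrib_left)
  also have "\<dots> \<le> c\<^sup>2 * (L2_norm v)\<^sup>2" by (intro mult_left_mono bessel assms K) auto
  finally show "(\<Sum>k\<in>K. (norm (fourier_coeff u k))\<^sup>2) \<le> (c * L2_norm v)\<^sup>2"
    by (simp add: power_mult_distrib)
qed (use assms in auto)

context volume_diffeo
begin

context
  fixes \<kappa> :: real
  assumes \<kappa>: "\<kappa> > 0"
begin

lemma transfer_eq_heat: "transfer f \<kappa> g = heat \<kappa> (g \<circ> inv f)"
  by (simp add: transfer_def)

lemma transfer_L2_fun: "g \<in> L2_fun \<Longrightarrow> transfer f \<kappa> g \<in> L2_fun"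
  unfolding transfer_eq_heat by (intro heat_properties L2_fun_comp_inv \<kappa>)

lemma fourier_coeff_transfer:
  "g \<in> L2_fun \<Longrightarrow> fourier_coeff (transfer f \<kappa> g) k = of_real (heat_multiplier \<kappa> k) * fourier_coeff (g \<circ> inv f) k"
  unfolding transfer_eq_heat by (intro heat_properties L2_fun_comp_inv \<kappa>)

lemma transfer_L2_zero: "g \<in> L2_zero \<Longrightarrow> transfer f \<kappa> g \<in> L2_zero"
  using L2_zero_comp_inv by (auto simp: L2_zero_iff transfer_L2_fun fourier_coeff_transfer)

lemma transfer_bounded:
  "g \<in> L2_fun \<Longrightarrow> \<bar>transfer f \<kappa> g x\<bar> \<le> (\<Sum>\<^sub>\<infinity>k :: int^'n. heat_multiplier \<kappa> k) * L2_norm g"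
  using heat_properties(3)[OF L2_fun_comp_inv \<kappa>] by (simp add: transfer_eq_heat L2_norm_comp_inv)

lemma fourier_coeff_transfer_sum:
  assumes "\<And>i. i \<in> I \<Longrightarrow> h i \<in> L2_fun"
  shows "fourier_coeff (transfer f \<kappa> (\<lambda>x. \<Sum>i\<in>I. c i * h i x)) k =
    (\<Sum>i\<in>I. of_real (c i) * fourier_coeff (transfer f \<kappa> (h i)) k)"
proof -
  have "(\<lambda>x. \<Sum>i\<in>I. c i * h i x) \<circ> inv f = (\<lambda>x. \<Sum>i\<in>I. c i * (h i \<circ> inv f) x)"
    by (simp add: comp_def)
  then show ?thesis
    using assms by (simp add: fourier_coeff_transfer L2_fun_sum L2_fun_scale L2_fun_comp_inv fourier_coeff_sum
        fourier_coeff_scale sum_distrib_left mult_ac del: comp_apply cong: sum.cong)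
qed

lemma L2_norm_transfer_diff:
  assumes g: "g \<in> L2_fun" and h: "h \<in> L2_fun"
  shows "L2_norm (\<lambda>x. transfer f \<kappa> g x - transfer f \<kappa> h x) \<le> L2_norm (\<lambda>x. g x - h x)"
proof -
  have "L2_norm (\<lambda>x. transfer f \<kappa> g x - transfer f \<kappa> h x) \<le> 1 * L2_norm (\<lambda>x. (g \<circ> inv f) x - (h \<circ> inv f) x)"
  proof (rule L2_norm_le_of_coeffs)
    fix k
    have "fourier_coeff (\<lambda>x. transfer f \<kappa> g x - transfer f \<kappa> h x) k =
        of_real (heat_multiplier \<kappa> k) * fourier_coeff (\<lambda>x. (g \<circ> inv f) x - (h \<circ> inv f) x) k"
      by (simp only: fourier_coeff_diff transfer_L2_fun fourier_coeff_transfer L2_fun_comp_inv g h right_diff_distrib)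
    then show "norm (fourier_coeff (\<lambda>x. transfer f \<kappa> g x - transfer f \<kappa> h x) k) \<le>
        1 * norm (fourier_coeff (\<lambda>x. (g \<circ> inv f) x - (h \<circ> inv f) x) k)"
      using heat_multiplier_pos[of \<kappa> k] heat_multiplier_le_1[of \<kappa> k] \<kappa>
      by (simp add: norm_mult mult_left_le_one_le)
  qed (intro L2_fun_diff transfer_L2_fun L2_fun_comp_inv g h | simp)+
  then show ?thesis by (simp only: L2_norm_comp_inv_diff[OF g h] mult_1)
qed

text \<open>Spectral gap: mean-zero functions have only modes with |k| \<ge> 1, each damped by at
  least this factor. The rate degenerates as \<kappa> tends to 0 and serves convergence at fixed
  \<kappa>.\<close>

lemma L2_norm_transfer_le:
  assumes g: "g \<in> L2_zero"
  shows "L2_norm (transfer f \<kappa> g) \<le> exp (- 4 * pi\<^sup>2 * \<kappa>) * L2_norm g"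
proof -
  note gL = L2_zero_imp_L2[OF g]
  have "L2_norm (transfer f \<kappa> g) \<le> exp (- 4 * pi\<^sup>2 * \<kappa>) * L2_norm (g \<circ> inv f)"
  proof (rule L2_norm_le_of_coeffs[OF transfer_L2_fun[OF gL] L2_fun_comp_inv[OF gL]])
    fix k
    show "norm (fourier_coeff (transfer f \<kappa> g) k) \<le> exp (- 4 * pi\<^sup>2 * \<kappa>) * norm (fourier_coeff (g \<circ> inv f) k)"
    proof (cases "k = 0")
      case True
      then show ?thesis using L2_zero_comp_inv[OF g] by (simp add: fourier_coeff_transfer[OF gL] L2_zero_iff)
    next
      case False
      then have "1 \<le> (norm (real_vec k))\<^sup>2" by (intro one_le_power norm_real_vec_ge_1)
      then have "4 * pi\<^sup>2 * \<kappa> * 1 \<le> 4 * pi\<^sup>2 * \<kappa> * (norm (real_vec k))\<^sup>2"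
        using \<kappa> by (intro mult_left_mono) auto
      then have "heat_multiplier \<kappa> k \<le> exp (- 4 * pi\<^sup>2 * \<kappa>)" by (simp add: heat_multiplier_def)
      then show ?thesis
        using heat_multiplier_pos[of \<kappa> k] by (simp add: fourier_coeff_transfer[OF gL] norm_mult mult_right_mono)
    qed
  qed simp
  then show ?thesis by (simp add: L2_norm_comp_inv[OF gL])
qed

lemma dirichlet_transfer:
  assumes g: "g \<in> L2_fun" and B: "dirichlet_le g B" and \<Lambda>: "Lambda_of f > 0"
  shows "dirichlet_le (transfer f \<kappa> g) (exp (2 * Lambda_of f) * B)"
  unfolding dirichlet_le_def
proof (intro allI impI)
  fix K :: "(int^'n) set" assume K: "finite K"
  have "norm (fourier_coeff (transfer f \<kappa> g) k) \<le> norm (fourier_coeff (g \<circ> inv f) k)" for k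
    using heat_multiplier_pos[of \<kappa> k] heat_multiplier_le_1[of \<kappa> k] \<kappa>
    by (simp add: fourier_coeff_transfer[OF g] norm_mult mult_left_le_one_le)
  then have "(\<Sum>k\<in>K. (norm (real_vec k))\<^sup>2 * (norm (fourier_coeff (transfer f \<kappa> g) k))\<^sup>2) \<le>
      (\<Sum>k\<in>K. (norm (real_vec k))\<^sup>2 * (norm (fourier_coeff (g \<circ> inv f) k))\<^sup>2)"
    by (intro sum_mono mult_left_mono power_mono) auto
  also have "\<dots> \<le> exp (2 * Lambda_of f) * B"
    using dirichlet_comp_inv[OF g B \<Lambda>] K by (simp add: dirichlet_le_def)
  finally show "(\<Sum>k\<in>K. (norm (real_vec k))\<^sup>2 * (norm (fourier_coeff (transfer f \<kappa> g) k))\<^sup>2) \<le> exp (2 * Lambda_of f) * B" .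
qed

section \<open>Energy balance of the transfer operator\<close>

text \<open>Composition with the inverse map preserves the norm, so the whole loss is due to the
  heat factors and can be read off mode by mode.\<close>

lemma energy_has_sum:
  assumes g: "g \<in> L2_fun"
  shows "((\<lambda>k. (1 - (heat_multiplier \<kappa> k)\<^sup>2) * (norm (fourier_coeff (g \<circ> inv f) k))\<^sup>2) has_sum
    ((L2_norm g)\<^sup>2 - (L2_norm (transfer f \<kappa> g))\<^sup>2)) UNIV"
proof -
  have "((\<lambda>k. (norm (fourier_coeff (g \<circ> inv f) k))\<^sup>2 + (-1) * (norm (fourier_coeff (transfer f \<kappa> g) k))\<^sup>2) has_sum
     ((L2_norm (g \<circ> inv f))\<^sup>2 + (-1) * (L2_norm (transfer f \<kappa> g))\<^sup>2)) UNIV"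
    by (intro has_sum_add has_sum_cmult_right parseval L2_fun_comp_inv transfer_L2_fun g)
  then show ?thesis
    by (simp add: L2_norm_comp_inv[OF g] fourier_coeff_transfer[OF g] norm_mult power_mult_distrib left_diff_distrib)
qed

text \<open>By 1 - exp(-x) \<le> x with x = 8 pi^2 \<kappa> |k|^2, the loss is at most a multiple of
  \<kappa> times the Dirichlet energy after composition.\<close>

lemma energy_loss_le:
  assumes g: "g \<in> L2_fun" and B: "dirichlet_le g B" and \<Lambda>: "Lambda_of f > 0"
  shows "(L2_norm g)\<^sup>2 - (L2_norm (transfer f \<kappa> g))\<^sup>2 \<le> 8 * pi\<^sup>2 * \<kappa> * (exp (2 * Lambda_of f) * B)"
proof (rule has_sum_le_finite_sums[OF energy_has_sum[OF g]])
  fix K :: "(int^'n) set" assume K: "finite K"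
  have m: "1 - (heat_multiplier \<kappa> k)\<^sup>2 \<le> 8 * pi\<^sup>2 * \<kappa> * (norm (real_vec k))\<^sup>2" for k :: "int^'n"
  proof -
    have "(heat_multiplier \<kappa> k)\<^sup>2 = exp (- (8 * pi\<^sup>2 * \<kappa> * (norm (real_vec k))\<^sup>2))"
      by (simp add: heat_multiplier_def exp_double[symmetric])
    then show ?thesis using exp_ge_add_one_self[of "- (8 * pi\<^sup>2 * \<kappa> * (norm (real_vec k))\<^sup>2)"] by linarith
  qed
  have "(\<Sum>k\<in>K. (1 - (heat_multiplier \<kappa> k)\<^sup>2) * (norm (fourier_coeff (g \<circ> inv f) k))\<^sup>2) \<le>
     (\<Sum>k\<in>K. 8 * pi\<^sup>2 * \<kappa> * ((norm (real_vec k))\<^sup>2 * (norm (fourier_coeff (g \<circ> inv f) k))\<^sup>2))"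
    unfolding mult.assoc[symmetric] by (intro sum_mono mult_right_mono m[unfolded mult.assoc[symmetric]]) auto
  also have "\<dots> \<le> 8 * pi\<^sup>2 * \<kappa> * (exp (2 * Lambda_of f) * B)"
    unfolding sum_distrib_left[symmetric]
    using dirichlet_comp_inv[OF g B \<Lambda>] K \<kappa> by (intro mult_left_mono) (auto simp: dirichlet_le_def)
  finally show "(\<Sum>k\<in>K. (1 - (heat_multiplier \<kappa> k)\<^sup>2) * (norm (fourier_coeff (g \<circ> inv f) k))\<^sup>2) \<le>
      8 * pi\<^sup>2 * \<kappa> * (exp (2 * Lambda_of f) * B)" .
qed

text \<open>Modes with \<open>\<bar>k\<bar> \<ge> \<kappa>\<^sup>-\<^sup>1\<^sup>/\<^sup>2\<close> lose a fixed fraction of their energy in each heat step.\<close>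

lemma high_modes_le_energy_loss:
  assumes g: "g \<in> L2_fun"
  shows "(L2_norm (proj_ge (\<kappa> powr (-1/2)) (transfer f \<kappa> g)))\<^sup>2 \<le> (L2_norm g)\<^sup>2 - (L2_norm (transfer f \<kappa> g))\<^sup>2"
proof -
  let ?M = "\<kappa> powr (-1/2)" and ?w = "\<lambda>k. (norm (fourier_coeff (transfer f \<kappa> g) k))\<^sup>2"
  let ?K = "{k :: int^'n. norm (real_vec k) < ?M}"
  have "(?w has_sum sum ?w ?K) ?K" by (rule has_sum_finite) simp
  then have "((\<lambda>k. if k \<in> ?K then ?w k else 0) has_sum sum ?w ?K) UNIV"
    by (rule has_sum_cong_neutral[THEN iffD1, rotated -1]) auto
  \<comment> \<open>The claim becomes nonnegativity of one series: loss minus surviving mass plus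
    the mass below the cut-off, checked term by term.\<close>
  then have "((\<lambda>k. (1 - (heat_multiplier \<kappa> k)\<^sup>2) * (norm (fourier_coeff (g \<circ> inv f) k))\<^sup>2 +
      (-1) * ?w k + (if k \<in> ?K then ?w k else 0)) has_sum
      (((L2_norm g)\<^sup>2 - (L2_norm (transfer f \<kappa> g))\<^sup>2) + (-1) * (L2_norm (transfer f \<kappa> g))\<^sup>2 + sum ?w ?K)) UNIV"
    by (intro has_sum_add has_sum_cmult_right parseval transfer_L2_fun g energy_has_sum)
  then have "0 \<le> ((L2_norm g)\<^sup>2 - (L2_norm (transfer f \<kappa> g))\<^sup>2) + (-1) * (L2_norm (transfer f \<kappa> g))\<^sup>2 + sum ?w ?K"
  proof (rule has_sum_nonneg)
    fix k :: "int^'n"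
    let ?m = "(heat_multiplier \<kappa> k)\<^sup>2" and ?u = "(norm (fourier_coeff (g \<circ> inv f) k))\<^sup>2"
    have w: "?w k = ?m * ?u" by (simp add: fourier_coeff_transfer[OF g] norm_mult power_mult_distrib)
    have m1: "?m \<le> 1"
      using heat_multiplier_pos[of \<kappa> k] heat_multiplier_le_1[of \<kappa> k] \<kappa> by (simp add: power_le_one)
    show "0 \<le> (1 - ?m) * ?u + (-1) * ?w k + (if k \<in> ?K then ?w k else 0)"
    proof (cases "k \<in> ?K")
      case True
      then show ?thesis using m1 by simp
    next
      case False
      then have "?M\<^sup>2 \<le> (norm (real_vec k))\<^sup>2" by (intro power_mono) auto
      moreover have "?M\<^sup>2 = 1 / \<kappa>"
        using \<kappa> by (simp add: power2_eq_square powr_add[symmetric] powr_minus_divide)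
      ultimately have "1 / \<kappa> \<le> (norm (real_vec k))\<^sup>2" by (simp only:)
      then have "1 \<le> \<kappa> * (norm (real_vec k))\<^sup>2" using \<kappa> by (simp add: pos_divide_le_eq mult.commute)
      moreover have "1 * 1 \<le> 8 * pi\<^sup>2"
        using pi_ge_two by (intro mult_mono) (auto simp: one_le_power)
      ultimately have "1 * 1 \<le> (8 * pi\<^sup>2) * (\<kappa> * (norm (real_vec k))\<^sup>2)" by (intro mult_mono) auto
      \<comment> \<open>Here |k|^2 \<ge> 1 / \<kappa>, so the squared multiplier is at most 1/2 and
        a mode keeps no more than it loses.\<close>
      then have "?m \<le> exp (- 1)"
        by (simp add: heat_multiplier_def exp_double[symmetric] mult.assoc)
      also have "\<dots> \<le> 1 / 2" using exp_ge_add_one_self[of 1] by (simp add: exp_minus divide_simps)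
      finally have "0 \<le> (1 - 2 * ?m) * ?u" by simp
      then show ?thesis using False by (simp add: w algebra_simps)
    qed
  qed
  then show ?thesis by (simp add: L2_norm_proj_ge[OF transfer_L2_fun[OF g]])
qed

lemma transfer_pow_L2_zero: "b \<in> L2_zero \<Longrightarrow> (transfer f \<kappa> ^^ n) b \<in> L2_zero"
  by (induction n) (simp_all add: transfer_L2_zero)

lemma L2_norm_transfer_pow_le:
  assumes "b \<in> L2_zero"
  shows "L2_norm ((transfer f \<kappa> ^^ n) b) \<le> exp (- 4 * pi\<^sup>2 * \<kappa>) ^ n * L2_norm b"
proof (induction n)
  case (Suc n)
  have "L2_norm ((transfer f \<kappa> ^^ Suc n) b) \<le> exp (- 4 * pi\<^sup>2 * \<kappa>) * L2_norm ((transfer f \<kappa> ^^ n) b)"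
    using L2_norm_transfer_le[OF transfer_pow_L2_zero[OF assms]] by simp
  also have "\<dots> \<le> exp (- 4 * pi\<^sup>2 * \<kappa>) * (exp (- 4 * pi\<^sup>2 * \<kappa>) ^ n * L2_norm b)"
    by (intro mult_left_mono Suc) auto
  finally show ?case by (simp add: mult.assoc)
qed simp

lemma L2_norm_transfer_pow_le_1:
  assumes "b \<in> L2_zero"
  shows "L2_norm ((transfer f \<kappa> ^^ n) b) \<le> L2_norm b"
proof -
  have "exp (- 4 * pi\<^sup>2 * \<kappa>) ^ n \<le> 1" using \<kappa> by (intro power_le_one) auto
  then show ?thesis
    using L2_norm_transfer_pow_le[OF assms, of n] mult_left_le_one_le[of "L2_norm b" "exp (- 4 * pi\<^sup>2 * \<kappa>) ^ n"]
    by simp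
qed

text \<open>The losses telescope to at most ||b||^2. The term n = 0 has not passed through a heat
  step and is bounded separately, whence the factor 2.\<close>

lemma sum_high_modes_le:
  assumes b: "b \<in> L2_zero"
  shows "(\<Sum>n<m. (L2_norm (proj_ge (\<kappa> powr (-1/2)) ((transfer f \<kappa> ^^ n) b)))\<^sup>2) \<le> 2 * (L2_norm b)\<^sup>2"
proof -
  let ?a = "\<lambda>n. (transfer f \<kappa> ^^ n) b" and ?M = "\<kappa> powr (-1/2)"
  have aL: "?a n \<in> L2_fun" for n by (intro L2_zero_imp_L2 transfer_pow_L2_zero b)
  have tel: "(\<Sum>n<m. (L2_norm (proj_ge ?M (?a (Suc n))))\<^sup>2) \<le> (L2_norm (?a 0))\<^sup>2 - (L2_norm (?a m))\<^sup>2" for m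
  proof -
    have "(\<Sum>n<m. (L2_norm (proj_ge ?M (?a (Suc n))))\<^sup>2) \<le> (\<Sum>n<m. (L2_norm (?a n))\<^sup>2 - (L2_norm (?a (Suc n)))\<^sup>2)"
      using high_modes_le_energy_loss[OF aL] by (intro sum_mono) simp
    also have "\<dots> = (L2_norm (?a 0))\<^sup>2 - (L2_norm (?a m))\<^sup>2" by (rule sum_lessThan_telescope')
    finally show ?thesis .
  qed
  have "(\<Sum>n<m. (L2_norm (proj_ge ?M (?a n)))\<^sup>2) \<le> (\<Sum>n<Suc m. (L2_norm (proj_ge ?M (?a n)))\<^sup>2)" by simp
  also have "\<dots> = (L2_norm (proj_ge ?M b))\<^sup>2 + (\<Sum>n<m. (L2_norm (proj_ge ?M (?a (Suc n))))\<^sup>2)"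
    by (subst sum.lessThan_Suc_shift) simp
  also have "\<dots> \<le> (L2_norm b)\<^sup>2 + (L2_norm b)\<^sup>2"
  proof (rule add_mono)
    show "(L2_norm (proj_ge ?M b))\<^sup>2 \<le> (L2_norm b)\<^sup>2"
      using aL[of 0] by (simp add: L2_norm_proj_ge sum_nonneg)
    show "(\<Sum>n<m. (L2_norm (proj_ge ?M (?a (Suc n))))\<^sup>2) \<le> (L2_norm b)\<^sup>2"
      by (rule order_trans[OF tel]) simp
  qed
  finally show ?thesis by simp
qed

text \<open>The two summands of the constant are the two losses. Heat costs at most 8 pi^2 \<kappa>
  E B times a geometric sum, bounded by E^n / (E - 1), and \<kappa> \<le> 1 / N^2; cutting at
  frequency N costs E^n B / N^2.\<close>

lemma low_modes_lower_bound:
  assumes b: "b \<in> L2_zero" and B: "dirichlet_le b B" and \<Lambda>: "Lambda_of f > 0"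
    and N: "N > 0" "\<kappa> * N\<^sup>2 \<le> 1"
  defines "E \<equiv> exp (2 * Lambda_of f)"
  shows "(L2_norm b)\<^sup>2 - (8 * pi\<^sup>2 * E * B / (E - 1) + B) / N\<^sup>2 * E ^ n \<le>
    (L2_norm (proj_le N ((transfer f \<kappa> ^^ n) b)))\<^sup>2"
proof -
  let ?a = "\<lambda>n. (transfer f \<kappa> ^^ n) b"
  have aL: "?a n \<in> L2_fun" for n by (intro L2_zero_imp_L2 transfer_pow_L2_zero b)
  have E: "E > 1" using \<Lambda> by (simp add: E_def)
  have B0: "B \<ge> 0" using B[unfolded dirichlet_le_def, rule_format, of "{}"] by simp
  have dir: "dirichlet_le (?a n) (E ^ n * B)" for n
  proof (induction n)
    case (Suc n)
    from dirichlet_transfer[OF aL this \<Lambda>] show ?case by (simp add: E_def mult_ac)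
  qed (simp add: B)
  have energy: "(L2_norm b)\<^sup>2 - 8 * pi\<^sup>2 * \<kappa> * E * B * (\<Sum>j<n. E ^ j) \<le> (L2_norm (?a n))\<^sup>2" for n
  proof (induction n)
    case (Suc n)
    have "(L2_norm (?a n))\<^sup>2 - (L2_norm (?a (Suc n)))\<^sup>2 \<le> 8 * pi\<^sup>2 * \<kappa> * (E * (E ^ n * B))"
      using energy_loss_le[OF aL dir[of n] \<Lambda>] by (simp add: E_def)
    with Suc show ?case by (simp add: algebra_simps)
  qed simp
  have geo: "(\<Sum>j<n. E ^ j) \<le> E ^ n / (E - 1)"
    using E by (subst geometric_sum) (auto simp: divide_right_mono)
  have "\<kappa> \<le> 1 / N\<^sup>2" using N by (simp add: pos_le_divide_eq)
  then have "8 * pi\<^sup>2 * \<kappa> * E * B * (\<Sum>j<n. E ^ j) \<le> 8 * pi\<^sup>2 * (1 / N\<^sup>2) * E * B * (E ^ n / (E - 1))"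
    using E B0 geo \<kappa> by (intro mult_mono mult_nonneg_nonneg sum_nonneg) auto
  then have "(L2_norm b)\<^sup>2 - 8 * pi\<^sup>2 * (1 / N\<^sup>2) * E * B * (E ^ n / (E - 1)) - E ^ n * B / N\<^sup>2 \<le>
      (L2_norm (proj_le N (?a n)))\<^sup>2"
    using energy[of n] proj_le_lower_bound[OF aL dir[of n] N(1)] by linarith
  then show ?thesis by (simp add: add_divide_distrib algebra_simps)
qed

end

end

section \<open>Sums cut off at a logarithmic time\<close>

lemma suminf_upper_log_bound:
  fixes P :: "nat \<Rightarrow> real"
  assumes P: "\<And>n. 0 \<le> P n" "\<And>n. P n \<le> 1" "summable P"
    and decay: "\<And>n. n \<ge> 1 \<Longrightarrow> P n \<le> D * N\<^sup>2 * exp (- 2 * \<gamma> * real n)"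
    and "N \<ge> 1" "\<gamma> > 0" "D \<ge> 0"
  shows "suminf P \<le> ln N / \<gamma> + (2 + D / (1 - exp (- 2 * \<gamma>)))"
proof -
  \<comment> \<open>From n = (ln N) / \<gamma> on, N^2 exp(-2 \<gamma> n) \<le> 1, and the tail is
    geometric. The + 1 ensures m \<ge> 1, where the decay hypothesis begins.\<close>
  define m where "m = nat \<lceil>ln N / \<gamma>\<rceil> + 1"
  have L: "0 \<le> ln N / \<gamma>" using assms by simp
  then have m: "real m \<le> ln N / \<gamma> + 2" "ln N / \<gamma> \<le> real m" "m \<ge> 1"
    unfolding m_def by linarith+
  have q: "norm (exp (- 2 * \<gamma>)) < 1" using \<open>\<gamma> > 0\<close> by simp
  have "P (n + m) \<le> D * exp (- 2 * \<gamma>) ^ n" for n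
  proof -
    have "ln N * 2 \<le> 2 * \<gamma> * real m" using m(2) \<open>\<gamma> > 0\<close> by (simp add: field_simps)
    then have "N\<^sup>2 * exp (- 2 * \<gamma> * real m) \<le> exp (2 * ln N) * exp (- (2 * ln N))"
      using \<open>N \<ge> 1\<close> by (intro mult_mono) (auto simp: exp_double)
    then have le1: "N\<^sup>2 * exp (- 2 * \<gamma> * real m) \<le> 1" by (simp add: exp_minus)
    have "P (n + m) \<le> D * N\<^sup>2 * exp (- 2 * \<gamma> * real (n + m))" using m(3) by (intro decay) simp
    also have "\<dots> = D * (N\<^sup>2 * exp (- 2 * \<gamma> * real m)) * exp (real n * (- 2 * \<gamma>))"
      by (simp add: exp_add[symmetric] algebra_simps)
    also have "\<dots> \<le> D * 1 * exp (real n * (- 2 * \<gamma>))"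
      using le1 \<open>D \<ge> 0\<close> by (intro mult_right_mono mult_left_mono) auto
    finally show ?thesis by (simp only: exp_of_nat_mult mult_1_right)
  qed
  then have "(\<Sum>n. P (n + m)) \<le> (\<Sum>n. D * exp (- 2 * \<gamma>) ^ n)"
    by (intro suminf_le summable_ignore_initial_segment P summable_mult summable_geometric q)
  also have "\<dots> = D / (1 - exp (- 2 * \<gamma>))"
    using q by (simp add: suminf_mult[OF summable_geometric] suminf_geometric)
  finally have tail: "(\<Sum>n. P (n + m)) \<le> D / (1 - exp (- 2 * \<gamma>))" .
  have "(\<Sum>n<m. P n) \<le> (\<Sum>n<m. 1)" by (intro sum_mono P)
  then have "suminf P \<le> real m + D / (1 - exp (- 2 * \<gamma>))"
    using suminf_split_initial_segment[OF P(3), of m] tail by simp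
  then show ?thesis using m(1) by linarith
qed

lemma suminf_lower_log_bound:
  fixes P :: "nat \<Rightarrow> real"
  assumes P: "\<And>n. 0 \<le> P n" "summable P"
    and lower: "\<And>n. 1 - D / N\<^sup>2 * exp (2 * \<Lambda>) ^ n \<le> P n"
    and "N \<ge> 1" "\<Lambda> > 0" "D \<ge> 0"
  shows "ln N / \<Lambda> - D * exp (2 * \<Lambda>) / (exp (2 * \<Lambda>) - 1) \<le> suminf P"
proof -
  let ?E = "exp (2 * \<Lambda>)"
  \<comment> \<open>The largest m with E^m \<le> N^2, where E = exp(2 \<Lambda>). Summing m + 1
    terms makes up for the rounding and costs one further factor E in the error.\<close>
  define m where "m = nat \<lfloor>ln N / \<Lambda>\<rfloor>"
  have L: "0 \<le> ln N / \<Lambda>" using assms by simp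
  then have m: "real m \<le> ln N / \<Lambda>" "ln N / \<Lambda> \<le> real (Suc m)"
    unfolding m_def by linarith+
  have E: "?E > 1" using \<open>\<Lambda> > 0\<close> by simp
  have "?E ^ m = exp (real m * (2 * \<Lambda>))" by (simp add: exp_of_nat_mult)
  also have "\<dots> \<le> exp (2 * ln N)" using m(1) \<open>\<Lambda> > 0\<close> by (simp add: field_simps)
  also have "\<dots> = N\<^sup>2" using \<open>N \<ge> 1\<close> by (simp add: exp_double)
  finally have Em: "?E ^ m \<le> N\<^sup>2" .
  have "(\<Sum>n<Suc m. ?E ^ n) \<le> ?E ^ Suc m / (?E - 1)"
    using E by (subst geometric_sum) (auto simp: divide_right_mono)
  also have "\<dots> \<le> (?E * N\<^sup>2) / (?E - 1)"
    using E Em by (intro divide_right_mono) auto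
  finally have geo: "D / N\<^sup>2 * (\<Sum>n<Suc m. ?E ^ n) \<le> D / N\<^sup>2 * ((?E * N\<^sup>2) / (?E - 1))"
    using \<open>D \<ge> 0\<close> by (intro mult_left_mono) auto
  have "real (Suc m) - D / N\<^sup>2 * (\<Sum>n<Suc m. ?E ^ n) = (\<Sum>n<Suc m. 1 - D / N\<^sup>2 * ?E ^ n)"
    by (simp only: sum_subtractf sum_distrib_left sum_constant card_lessThan mult_1_right)
  also have "\<dots> \<le> (\<Sum>n<Suc m. P n)" by (intro sum_mono lower)
  also have "\<dots> \<le> suminf P" by (intro sum_le_suminf P) auto
  finally have "real (Suc m) - D / N\<^sup>2 * ((?E * N\<^sup>2) / (?E - 1)) \<le> suminf P" using geo by linarith
  moreover have "D / N\<^sup>2 * ((?E * N\<^sup>2) / (?E - 1)) = D * ?E / (?E - 1)"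
    using \<open>N \<ge> 1\<close> by simp
  ultimately show ?thesis using m(2) by linarith
qed

section \<open>Random series with independent coefficients\<close>

text \<open>Sums in the extended nonnegative reals always exist and are measurable, so convergence
  of a random series becomes a measurable event.\<close>

lemma summable_iff_suminf_ennreal:
  fixes f :: "nat \<Rightarrow> real"
  assumes "\<And>n. 0 \<le> f n"
  shows "summable f \<longleftrightarrow> (\<Sum>n. ennreal (f n)) \<noteq> \<top>"
  using assms summable_iff_suminf_neq_top[of f] ennreal_suminf_neq_top[of f] by blast

locale iid_innovations = prob_space M for M :: "'v measure" +
  fixes \<eta> :: "nat \<Rightarrow> 'v \<Rightarrow> real"
  assumes indep: "indep_vars (\<lambda>_. borel) \<eta> UNIV"
    and square_integrable: "\<And>n. integrable M (\<lambda>w. (\<eta> n w)\<^sup>2)"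
    and mean: "\<And>n. expectation (\<eta> n) = 0"
    and second_moment: "\<And>n. expectation (\<lambda>w. (\<eta> n w)\<^sup>2) = 1"
begin

lemma measurable_innovation [measurable]: "\<eta> n \<in> borel_measurable M"
  using indep by (simp add: indep_vars_def)

lemma integrable_innovation: "integrable M (\<eta> n)"
  by (rule square_integrable_imp_integrable[OF measurable_innovation square_integrable])

lemma expectation_mult:
  "integrable M (\<lambda>w. \<eta> i w * \<eta> j w)" "expectation (\<lambda>w. \<eta> i w * \<eta> j w) = (if i = j then 1 else 0)"
proof -
  have "integrable M (\<lambda>w. \<eta> i w * \<eta> j w) \<and> expectation (\<lambda>w. \<eta> i w * \<eta> j w) = (if i = j then 1 else 0)"
  proof (cases "i = j")
    case True
    then show ?thesis using square_integrable[of j] second_moment[of j] by (simp add: power2_eq_square)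
  next
    case False
    have "indep_vars (\<lambda>_. borel) \<eta> {i, j}" by (rule indep_vars_subset[OF indep]) simp
    with indep_vars_integrable[of "{i, j}" \<eta>] indep_vars_lebesgue_integral[of "{i, j}" \<eta>] False
    show ?thesis by (simp add: integrable_innovation mean)
  qed
  then show "integrable M (\<lambda>w. \<eta> i w * \<eta> j w)" "expectation (\<lambda>w. \<eta> i w * \<eta> j w) = (if i = j then 1 else 0)"
    by auto
qed

text \<open>The random sum has expectation \<Sum> r n by monotone convergence, hence is finite
  almost surely.\<close>

lemma AE_summable_squares:
  assumes "summable r" "\<And>n. 0 \<le> r n"
  shows "AE w in M. summable (\<lambda>n. r n * (\<eta> n w)\<^sup>2)"
proof -
  have "(\<integral>\<^sup>+w. (\<Sum>n. ennreal (r n * (\<eta> n w)\<^sup>2)) \<partial>M) = (\<Sum>n. \<integral>\<^sup>+w. ennreal (r n * (\<eta> n w)\<^sup>2) \<partial>M)"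
    by (rule nn_integral_suminf) measurable
  also have "\<dots> = (\<Sum>n. ennreal (r n))"
    using assms by (intro suminf_cong)
      (subst nn_integral_eq_integral, auto intro!: integrable_mult_right square_integrable simp: second_moment)
  also have "\<dots> \<noteq> \<infinity>" using assms summable_iff_suminf_ennreal by auto
  finally have "AE w in M. (\<Sum>n. ennreal (r n * (\<eta> n w)\<^sup>2)) \<noteq> \<infinity>"
    by (intro nn_integral_PInf_AE) measurable
  then show ?thesis
  proof eventually_elim
    case (elim w)
    then show ?case using assms by (subst summable_iff_suminf_ennreal) auto
  qed
qed

text \<open>Reduces to the squares by |x| \<le> 1 + x^2.\<close>

lemma AE_summable_abs:
  assumes "summable r" "\<And>n. 0 \<le> r n"
  shows "AE w in M. summable (\<lambda>n. r n * \<bar>\<eta> n w\<bar>)"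
  using AE_summable_squares[OF assms]
proof eventually_elim
  case (elim w)
  show ?case
  proof (rule summable_comparison_test_ev)
    show "summable (\<lambda>n. r n + r n * (\<eta> n w)\<^sup>2)" by (intro summable_add elim assms)
    have "\<bar>x\<bar> \<le> 1 + x\<^sup>2" for x :: real
      using sum_squares_bound[of "\<bar>x\<bar>" 1] by (simp add: power2_eq_square)
    then have "r n * \<bar>\<eta> n w\<bar> \<le> r n * (1 + (\<eta> n w)\<^sup>2)" for n
      using assms by (intro mult_left_mono) auto
    then show "eventually (\<lambda>n. norm (r n * \<bar>\<eta> n w\<bar>) \<le> r n + r n * (\<eta> n w)\<^sup>2) sequentially"
      using assms by (intro always_eventually) (simp add: distrib_left abs_mult)
  qed
qed

text \<open>Weighted Cauchy-Schwarz bounds all squared partial sums by the integrable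
  \<open>W\<close>, and dominated convergence carries the orthogonality of the innovations over to
  the infinite sum.\<close>

lemma second_moment_series_real:
  fixes r :: "nat \<Rightarrow> real"
  assumes r: "summable (\<lambda>n. \<bar>r n\<bar>)"
  shows "integrable M (\<lambda>w. (\<Sum>n. r n * \<eta> n w)\<^sup>2)"
    "expectation (\<lambda>w. (\<Sum>n. r n * \<eta> n w)\<^sup>2) = (\<Sum>n. (r n)\<^sup>2)"
    "summable (\<lambda>n. (r n)\<^sup>2)"
proof -
  define R W where "R = (\<Sum>n. \<bar>r n\<bar>)" and "W w = R * (\<Sum>n. \<bar>r n\<bar> * (\<eta> n w)\<^sup>2)" for w
  define s where "s n w = (\<Sum>j<n. r j * \<eta> j w)\<^sup>2" for n w
  have R: "0 \<le> R" unfolding R_def by (intro suminf_nonneg r) simp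
  note AE2 = AE_summable_squares[OF r abs_ge_zero] and AE1 = AE_summable_abs[OF r abs_ge_zero]
  have "integrable M (\<lambda>w. \<Sum>n. \<bar>r n\<bar> * (\<eta> n w)\<^sup>2)"
  proof (rule integrable_suminf)
    show "integrable M (\<lambda>w. \<bar>r n\<bar> * (\<eta> n w)\<^sup>2)" for n
      by (rule integrable_mult_right) (rule square_integrable)
    show "AE w in M. summable (\<lambda>n. norm (\<bar>r n\<bar> * (\<eta> n w)\<^sup>2))"
      using AE2 by (simp add: abs_mult)
    have "expectation (\<lambda>w. norm (\<bar>r n\<bar> * (\<eta> n w)\<^sup>2)) = \<bar>r n\<bar>" for n
      by (simp add: abs_mult second_moment)
    then show "summable (\<lambda>n. expectation (\<lambda>w. norm (\<bar>r n\<bar> * (\<eta> n w)\<^sup>2)))"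
      using r by (simp only:)
  qed
  then have W: "integrable M W" unfolding W_def by (intro integrable_mult_right)
  have bound: "AE w in M. norm (s n w) \<le> W w" for n
    using AE2
  proof eventually_elim
    case (elim w)
    \<comment> \<open>Splitting r into sqrt |r| and its signed root leaves the summable weight |r|
      on both factors of Cauchy-Schwarz.\<close>
    have "r j * \<eta> j w = sqrt \<bar>r j\<bar> * (sgn (r j) * sqrt \<bar>r j\<bar> * \<eta> j w)" for j
    proof -
      have "sqrt \<bar>r j\<bar> * (sgn (r j) * sqrt \<bar>r j\<bar> * \<eta> j w) = (sgn (r j) * (sqrt \<bar>r j\<bar> * sqrt \<bar>r j\<bar>)) * \<eta> j w"
        by (simp only: mult_ac)
      then show ?thesis by (simp only: real_sqrt_mult_self abs_idempotent sgn_mult_abs)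
    qed
    then have "(\<Sum>j<n. r j * \<eta> j w) = (\<Sum>j<n. sqrt \<bar>r j\<bar> * (sgn (r j) * sqrt \<bar>r j\<bar> * \<eta> j w))"
      by (intro sum.cong refl)
    then have "s n w \<le> (\<Sum>j<n. (sqrt \<bar>r j\<bar>)\<^sup>2) * (\<Sum>j<n. (sgn (r j) * sqrt \<bar>r j\<bar> * \<eta> j w)\<^sup>2)"
      unfolding s_def by (simp only: Cauchy_Schwarz_ineq_sum)
    also have "\<dots> = (\<Sum>j<n. \<bar>r j\<bar>) * (\<Sum>j<n. \<bar>r j\<bar> * (\<eta> j w)\<^sup>2)"
      by (intro arg_cong2[where f="(*)"] sum.cong refl) (auto simp: power_mult_distrib sgn_if)
    also have "\<dots> \<le> W w"
      unfolding W_def R_def by (intro mult_mono sum_le_suminf r elim suminf_nonneg sum_nonneg) auto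
    finally show ?case by (simp add: s_def)
  qed
  have lim: "AE w in M. (\<lambda>n. s n w) \<longlonglongrightarrow> (\<Sum>n. r n * \<eta> n w)\<^sup>2"
    using AE1
  proof eventually_elim
    case (elim w)
    then have "summable (\<lambda>n. r n * \<eta> n w)" by - (rule summable_rabs_cancel, simp add: abs_mult)
    then show ?case unfolding s_def by (intro tendsto_power summable_LIMSEQ)
  qed
  have meas: "(\<lambda>w. (\<Sum>n. r n * \<eta> n w)\<^sup>2) \<in> borel_measurable M" "s n \<in> borel_measurable M" for n
    unfolding s_def by measurable
  show "integrable M (\<lambda>w. (\<Sum>n. r n * \<eta> n w)\<^sup>2)"
    by (rule integrable_dominated_convergence[OF meas W lim bound])
  have "expectation (s n) = (\<Sum>j<n. (r j)\<^sup>2)" for n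
  proof -
    have "s n = (\<lambda>w. \<Sum>i<n. \<Sum>j<n. (r i * r j) * (\<eta> i w * \<eta> j w))"
      by (auto simp: s_def power2_eq_square sum_product fun_eq_iff mult_ac)
    then have "expectation (s n) = (\<Sum>i<n. \<Sum>j<n. (r i * r j) * (if i = j then 1 else 0))"
      by (simp only: Bochner_Integration.integral_sum Bochner_Integration.integrable_sum integrable_mult_right
          expectation_mult integral_mult_right_zero)
    also have "\<dots> = (\<Sum>i<n. (r i)\<^sup>2)"
      by (intro sum.cong refl) (simp add: if_distrib[of "\<lambda>x. _ * x"] power2_eq_square cong: if_cong)
    finally show ?thesis .
  qed
  moreover have "(\<lambda>n. expectation (s n)) \<longlonglongrightarrow> expectation (\<lambda>w. (\<Sum>n. r n * \<eta> n w)\<^sup>2)"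
    by (rule integral_dominated_convergence[OF meas W lim bound])
  ultimately have "(\<lambda>n. (r n)\<^sup>2) sums expectation (\<lambda>w. (\<Sum>n. r n * \<eta> n w)\<^sup>2)"
    by (simp add: sums_def)
  then show "expectation (\<lambda>w. (\<Sum>n. r n * \<eta> n w)\<^sup>2) = (\<Sum>n. (r n)\<^sup>2)" "summable (\<lambda>n. (r n)\<^sup>2)"
    by (auto simp: sums_iff)
qed

lemma second_moment_series:
  fixes c :: "nat \<Rightarrow> complex"
  assumes c: "summable (\<lambda>n. norm (c n))"
  shows "integrable M (\<lambda>w. (norm (\<Sum>n. of_real (\<eta> n w) * c n))\<^sup>2)"
    "expectation (\<lambda>w. (norm (\<Sum>n. of_real (\<eta> n w) * c n))\<^sup>2) = (\<Sum>n. (norm (c n))\<^sup>2)"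
    "summable (\<lambda>n. (norm (c n))\<^sup>2)"
proof -
  have re: "summable (\<lambda>n. \<bar>Re (c n)\<bar>)" and im: "summable (\<lambda>n. \<bar>Im (c n)\<bar>)"
    by (rule summable_comparison_test_ev[OF _ c], simp add: abs_Re_le_cmod abs_Im_le_cmod)+
  note re' = second_moment_series_real[OF re] and im' = second_moment_series_real[OF im]
  have eq: "AE w in M. (\<Sum>n. Re (c n) * \<eta> n w)\<^sup>2 + (\<Sum>n. Im (c n) * \<eta> n w)\<^sup>2 =
      (norm (\<Sum>n. of_real (\<eta> n w) * c n))\<^sup>2"
    using AE_summable_abs[OF c norm_ge_zero]
  proof eventually_elim
    case (elim w)
    then have s: "summable (\<lambda>n. of_real (\<eta> n w) * c n)"
      by - (rule summable_norm_cancel, simp add: norm_mult mult.commute)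
    have "Re (\<Sum>n. of_real (\<eta> n w) * c n) = (\<Sum>n. Re (c n) * \<eta> n w)"
      "Im (\<Sum>n. of_real (\<eta> n w) * c n) = (\<Sum>n. Im (c n) * \<eta> n w)"
      using Re_suminf[OF s] Im_suminf[OF s] by (simp_all add: mult.commute)
    then show ?case by (simp add: cmod_power2)
  qed
  have meas: "(\<lambda>w. (norm (\<Sum>n. complex_of_real (\<eta> n w) * c n))\<^sup>2) \<in> borel_measurable M" by measurable
  show "integrable M (\<lambda>w. (norm (\<Sum>n. of_real (\<eta> n w) * c n))\<^sup>2)"
    by (rule integrable_cong_AE_imp[OF Bochner_Integration.integrable_add[OF re'(1) im'(1)] meas]) (use eq in auto)
  have "expectation (\<lambda>w. (norm (\<Sum>n. of_real (\<eta> n w) * c n))\<^sup>2) =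
     expectation (\<lambda>w. (\<Sum>n. Re (c n) * \<eta> n w)\<^sup>2 + (\<Sum>n. Im (c n) * \<eta> n w)\<^sup>2)"
    by (rule integral_cong_AE[OF meas]) (use eq in \<open>auto simp: eq_commute\<close>)
  also have "\<dots> = (\<Sum>n. (Re (c n))\<^sup>2) + (\<Sum>n. (Im (c n))\<^sup>2)"
    using re' im' by simp
  also have "\<dots> = (\<Sum>n. (norm (c n))\<^sup>2)"
    using suminf_add[OF re'(3) im'(3)] by (simp add: cmod_power2)
  finally show "expectation (\<lambda>w. (norm (\<Sum>n. of_real (\<eta> n w) * c n))\<^sup>2) = (\<Sum>n. (norm (c n))\<^sup>2)" .
  show "summable (\<lambda>n. (norm (c n))\<^sup>2)"
    using summable_add[OF re'(3) im'(3)] by (simp add: cmod_power2)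
qed

end

section \<open>Second moments of the stationary solution\<close>

text \<open>Coefficients are L2-continuous, so those of any version of the random series are
  convergent scalar series, with one null set serving all k.\<close>

lemma random_series_fourier_coeff:
  assumes b: "\<And>n. (transfer f \<kappa> ^^ n) b \<in> L2_fun"
    and g: "is_random_series M \<eta> f \<kappa> b g"
  shows "AE w in M. \<forall>k. (\<lambda>n. of_real (\<eta> n w) * fourier_coeff ((transfer f \<kappa> ^^ n) b) k) sums fourier_coeff (g w) k"
proof -
  have "AE w in M. (\<lambda>n. L2_norm (\<lambda>x. g w x - (\<Sum>j<n. \<eta> j w * (transfer f \<kappa> ^^ j) b x))) \<longlonglongrightarrow> 0"
    using g by (simp add: is_random_series_def)
  then show ?thesis
    using AE_space
  proof eventually_elim
    case (elim w)
    have "g w \<in> space L2_zero_borel"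
      using g elim(2) unfolding is_random_series_def by (auto dest: measurable_space)
    then have gL: "g w \<in> L2_fun" by (simp add: L2_zero_imp_L2)
    have SL: "(\<lambda>x. \<Sum>j<n. \<eta> j w * (transfer f \<kappa> ^^ j) b x) \<in> L2_fun" for n
      by (intro L2_fun_sum L2_fun_scale b)
    show ?case
    proof
      fix k
      have "(\<lambda>n. fourier_coeff (\<lambda>x. \<Sum>j<n. \<eta> j w * (transfer f \<kappa> ^^ j) b x) k) \<longlonglongrightarrow> fourier_coeff (g w) k"
        by (rule fourier_coeff_L2_limit[OF SL gL elim(1)])
      then show "(\<lambda>n. of_real (\<eta> n w) * fourier_coeff ((transfer f \<kappa> ^^ n) b) k) sums fourier_coeff (g w) k"
        by (simp add: sums_def fourier_coeff_sum L2_fun_scale b fourier_coeff_scale)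
    qed
  qed
qed

lemma L2_norm_measurable_L2_zero: "L2_norm \<in> borel_measurable L2_zero_borel"
proof (rule lipschitz_measurable_L2_zero)
  fix g h :: "'a torus \<Rightarrow> real" assume "g \<in> L2_zero" "h \<in> L2_zero"
  then have gh: "g \<in> L2_fun" "h \<in> L2_fun" by (auto simp: L2_zero_imp_L2)
  have "L2_norm h \<le> L2_norm (\<lambda>x. h x - g x) + L2_norm g" "L2_norm g \<le> L2_norm (\<lambda>x. g x - h x) + L2_norm h"
    using L2_norm_triangle[OF L2_fun_diff[OF gh(2,1)] gh(1)] L2_norm_triangle[OF L2_fun_diff[OF gh] gh(2)] by simp_all
  then show "dist (L2_norm h) (L2_norm g) \<le> L2_norm (\<lambda>x. h x - g x)"
    using L2_norm_minus[of g h] by (simp add: dist_real_def)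
qed

text \<open>Fixes an arbitrary version \<open>g\<close> of the series; its second moments are
  computed through the coefficients and so do not depend on the version.\<close>

locale stationary_solution = volume_diffeo f + iid_innovations M \<eta>
  for f :: "'n::finite torus \<Rightarrow> 'n torus" and M :: "'v measure" and \<eta> +
  fixes \<kappa> :: real and b :: "'n torus \<Rightarrow> real" and g :: "'v \<Rightarrow> 'n torus \<Rightarrow> real"
  assumes \<kappa>: "\<kappa> > 0" and b: "b \<in> L2_zero" and g: "is_random_series M \<eta> f \<kappa> b g"
begin

abbreviation iterate :: "nat \<Rightarrow> 'n torus \<Rightarrow> real" where
  "iterate n \<equiv> (transfer f \<kappa> ^^ n) b"

lemma iterate_L2: "iterate n \<in> L2_fun"
  by (rule L2_zero_imp_L2[OF transfer_pow_L2_zero[OF \<kappa> b]])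

lemma iterate_norm_le: "L2_norm (iterate n) \<le> exp (- 4 * pi\<^sup>2 * \<kappa>) ^ n * L2_norm b"
  by (rule L2_norm_transfer_pow_le[OF \<kappa> b])

lemma summable_iterate: "summable (\<lambda>n. L2_norm (iterate n))"
proof (rule summable_comparison_test_ev)
  show "summable (\<lambda>n. exp (- 4 * pi\<^sup>2 * \<kappa>) ^ n * L2_norm b)"
    using \<kappa> by (intro summable_mult2 summable_geometric) auto
qed (use iterate_norm_le in \<open>simp add: always_eventually\<close>)

lemma summable_iterate_coeff: "summable (\<lambda>n. norm (fourier_coeff (iterate n) k))"
  by (rule summable_comparison_test_ev[OF _ summable_iterate])
     (simp add: always_eventually norm_fourier_coeff_le iterate_L2)

lemma g_measurable [measurable]: "g \<in> measurable M L2_zero_borel"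
  using g by (simp add: is_random_series_def)

lemma g_L2: "w \<in> space M \<Longrightarrow> g w \<in> L2_fun"
  using measurable_space[OF g_measurable] by (simp add: L2_zero_imp_L2)

lemma coeff_measurable [measurable]: "(\<lambda>w. fourier_coeff (g w) k) \<in> borel_measurable M"
  by measurable

lemma coeff_second_moment:
  shows "integrable M (\<lambda>w. (norm (fourier_coeff (g w) k))\<^sup>2)"
    "expectation (\<lambda>w. (norm (fourier_coeff (g w) k))\<^sup>2) = (\<Sum>n. (norm (fourier_coeff (iterate n) k))\<^sup>2)"
    "summable (\<lambda>n. (norm (fourier_coeff (iterate n) k))\<^sup>2)"
proof -
  note * = second_moment_series[OF summable_iterate_coeff[of k]]
  have eq: "AE w in M. (norm (\<Sum>n. of_real (\<eta> n w) * fourier_coeff (iterate n) k))\<^sup>2 = (norm (fourier_coeff (g w) k))\<^sup>2"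
    using random_series_fourier_coeff[OF iterate_L2 g]
  proof eventually_elim
    case (elim w)
    then show ?case by (simp only: sums_unique[OF elim[rule_format], symmetric])
  qed
  have meas: "(\<lambda>w. (norm (fourier_coeff (g w) k))\<^sup>2) \<in> borel_measurable M" by measurable
  show "integrable M (\<lambda>w. (norm (fourier_coeff (g w) k))\<^sup>2)"
    by (rule integrable_cong_AE_imp[OF *(1) meas]) (use eq in auto)
  show "expectation (\<lambda>w. (norm (fourier_coeff (g w) k))\<^sup>2) = (\<Sum>n. (norm (fourier_coeff (iterate n) k))\<^sup>2)"
    unfolding *(2)[symmetric] by (rule integral_cong_AE[OF meas]) (use eq in \<open>auto simp: eq_commute\<close>)
  show "summable (\<lambda>n. (norm (fourier_coeff (iterate n) k))\<^sup>2)" by (rule *)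
qed

lemma coeff_sum_second_moment:
  assumes "finite K"
  shows "integrable M (\<lambda>w. \<Sum>k\<in>K. (norm (fourier_coeff (g w) k))\<^sup>2)"
    "expectation (\<lambda>w. \<Sum>k\<in>K. (norm (fourier_coeff (g w) k))\<^sup>2) =
       (\<Sum>n. \<Sum>k\<in>K. (norm (fourier_coeff (iterate n) k))\<^sup>2)"
    "summable (\<lambda>n. \<Sum>k\<in>K. (norm (fourier_coeff (iterate n) k))\<^sup>2)"
proof -
  show "integrable M (\<lambda>w. \<Sum>k\<in>K. (norm (fourier_coeff (g w) k))\<^sup>2)"
    by (intro Bochner_Integration.integrable_sum coeff_second_moment)
  show "expectation (\<lambda>w. \<Sum>k\<in>K. (norm (fourier_coeff (g w) k))\<^sup>2) =
       (\<Sum>n. \<Sum>k\<in>K. (norm (fourier_coeff (iterate n) k))\<^sup>2)"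
    by (simp only: Bochner_Integration.integral_sum[OF coeff_second_moment(1)] coeff_second_moment(2)
        suminf_sum[OF coeff_second_moment(3)])
  show "summable (\<lambda>n. \<Sum>k\<in>K. (norm (fourier_coeff (iterate n) k))\<^sup>2)"
    by (intro summable_sum coeff_second_moment)
qed

lemma proj_le_second_moment:
  shows "integrable M (\<lambda>w. (L2_norm (proj_le N (g w)))\<^sup>2)"
    "expectation (\<lambda>w. (L2_norm (proj_le N (g w)))\<^sup>2) = (\<Sum>n. (L2_norm (proj_le N (iterate n)))\<^sup>2)"
    "summable (\<lambda>n. (L2_norm (proj_le N (iterate n)))\<^sup>2)"
proof -
  let ?K = "{k :: int^'n. norm (real_vec k) \<le> N}"
  note * = coeff_sum_second_moment[of ?K, OF finite_modes_le]
  have eq: "(L2_norm (proj_le N (g w)))\<^sup>2 = (\<Sum>k\<in>?K. (norm (fourier_coeff (g w) k))\<^sup>2)" if "w \<in> space M" for w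
    by (rule L2_norm_proj_le[OF g_L2[OF that]])
  show "integrable M (\<lambda>w. (L2_norm (proj_le N (g w)))\<^sup>2)"
    using *(1) by (subst Bochner_Integration.integrable_cong[OF refl eq])
  show "expectation (\<lambda>w. (L2_norm (proj_le N (g w)))\<^sup>2) = (\<Sum>n. (L2_norm (proj_le N (iterate n)))\<^sup>2)"
    using *(2) by (subst Bochner_Integration.integral_cong[OF refl eq]) (auto simp: L2_norm_proj_le[OF iterate_L2])
  show "summable (\<lambda>n. (L2_norm (proj_le N (iterate n)))\<^sup>2)"
    using *(3) by (simp add: L2_norm_proj_le[OF iterate_L2])
qed

text \<open>Infinitely many modes are involved, so the norm is exhausted by the finite sets
  \<open>L m\<close>, and Fatou gives integrability and bound at once. For each m the expectation is
  a series dominated termwise by the summands of the hypothesis.\<close>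

lemma proj_ge_second_moment:
  assumes bound: "\<And>m. (\<Sum>n<m. (L2_norm (proj_ge N (iterate n)))\<^sup>2) \<le> A"
  shows "integrable M (\<lambda>w. (L2_norm (proj_ge N (g w)))\<^sup>2)"
    "expectation (\<lambda>w. (L2_norm (proj_ge N (g w)))\<^sup>2) \<le> A"
proof -
  let ?K = "{k :: int^'n. norm (real_vec k) < N}"
  define L where "L m = {k :: int^'n. norm (real_vec k) \<le> real m} - ?K" for m
  have L: "finite (L m)" for m by (simp add: L_def)
  define X where "X m w = (\<Sum>k\<in>L m. (norm (fourier_coeff (g w) k))\<^sup>2)" for m w
  let ?P = "\<lambda>w. (L2_norm (proj_ge N (g w)))\<^sup>2"
  have A: "0 \<le> A" using bound[of 0] by simp
  have EX: "expectation (X m) \<le> A" for m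
    unfolding X_def coeff_sum_second_moment(2)[OF L]
  proof (rule suminf_le_const[OF coeff_sum_second_moment(3)[OF L]])
    fix n
    have "(\<Sum>k\<in>L m. (norm (fourier_coeff (iterate n) k))\<^sup>2) \<le> (L2_norm (proj_ge N (iterate n)))\<^sup>2" for n
    proof -
      have "(\<Sum>k\<in>L m. (norm (fourier_coeff (iterate n) k))\<^sup>2) + (\<Sum>k\<in>?K. (norm (fourier_coeff (iterate n) k))\<^sup>2) =
          (\<Sum>k\<in>L m \<union> ?K. (norm (fourier_coeff (iterate n) k))\<^sup>2)"
        by (rule sum.union_disjoint[symmetric]) (auto simp: L_def)
      also have "\<dots> \<le> (L2_norm (iterate n))\<^sup>2" by (rule bessel[OF iterate_L2]) (simp add: L)
      finally show ?thesis by (simp add: L2_norm_proj_ge[OF iterate_L2])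
    qed
    then show "(\<Sum>i<n. \<Sum>k\<in>L m. (norm (fourier_coeff (iterate i) k))\<^sup>2) \<le> A"
      by (intro order_trans[OF sum_mono bound])
  qed
  have lim: "(\<lambda>m. X m w) \<longlonglongrightarrow> ?P w" if w: "w \<in> space M" for w
  proof -
    let ?c = "\<lambda>k. (norm (fourier_coeff (g w) k))\<^sup>2"
    have "(\<lambda>m. sum ?c {k. norm (real_vec k) \<le> real m}) \<longlonglongrightarrow> (L2_norm (g w))\<^sup>2"
      using filterlim_compose[OF parseval[OF g_L2[OF w], unfolded has_sum_def] filterlim_modes_at_top] .
    then have "(\<lambda>m. sum ?c {k. norm (real_vec k) \<le> real m} - sum ?c ?K) \<longlonglongrightarrow> ?P w"
      unfolding L2_norm_proj_ge[OF g_L2[OF w]] by (intro tendsto_intros)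
    then show ?thesis
    proof (rule Lim_transform_eventually)
      obtain m0 :: nat where m0: "N \<le> real m0" using real_arch_simple by blast
      show "eventually (\<lambda>m. sum ?c {k. norm (real_vec k) \<le> real m} - sum ?c ?K = X m w) sequentially"
        using eventually_ge_at_top[of m0]
      proof eventually_elim
        case (elim m)
        then have "?K \<subseteq> {k. norm (real_vec k) \<le> real m}" using m0 by auto
        then show ?case unfolding X_def L_def by (subst sum_diff) auto
      qed
    qed
  qed
  have meas: "?P \<in> borel_measurable M"
  proof (subst measurable_cong)
    show "w \<in> space M \<Longrightarrow> ?P w = (L2_norm (g w))\<^sup>2 - (\<Sum>k\<in>?K. (norm (fourier_coeff (g w) k))\<^sup>2)" for w
      by (rule L2_norm_proj_ge[OF g_L2])
    show "(\<lambda>w. (L2_norm (g w))\<^sup>2 - (\<Sum>k\<in>?K. (norm (fourier_coeff (g w) k))\<^sup>2)) \<in> borel_measurable M"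
      using measurable_compose[OF g_measurable L2_norm_measurable_L2_zero] by measurable
  qed
  have "(\<integral>\<^sup>+w. ennreal (?P w) \<partial>M) = (\<integral>\<^sup>+w. liminf (\<lambda>m. ennreal (X m w)) \<partial>M)"
    by (intro nn_integral_cong lim_imp_Liminf[symmetric] tendsto_ennrealI lim) auto
  also have "\<dots> \<le> liminf (\<lambda>m. \<integral>\<^sup>+w. ennreal (X m w) \<partial>M)"
    by (rule nn_integral_liminf) (auto simp: X_def)
  also have "\<dots> \<le> ennreal A"
  proof (rule order_trans[OF Liminf_mono])
    show "eventually (\<lambda>m. (\<integral>\<^sup>+w. ennreal (X m w) \<partial>M) \<le> ennreal A) sequentially"
    proof (rule always_eventually, rule allI)
      fix m
      have "(\<integral>\<^sup>+w. ennreal (X m w) \<partial>M) = ennreal (expectation (X m))"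
        unfolding X_def by (rule nn_integral_eq_integral[OF coeff_sum_second_moment(1)[OF L]]) (intro AE_I2 sum_nonneg, simp)
      then show "(\<integral>\<^sup>+w. ennreal (X m w) \<partial>M) \<le> ennreal A" using EX by (simp add: ennreal_leI)
    qed
    show "liminf (\<lambda>_. ennreal A) \<le> ennreal A" by (simp add: Liminf_const)
  qed
  finally have le: "(\<integral>\<^sup>+w. ennreal (?P w) \<partial>M) \<le> ennreal A" .
  show int: "integrable M ?P"
    by (rule integrableI_bounded[OF meas]) (use le in \<open>auto intro: le_less_trans\<close>)
  show "expectation ?P \<le> A"
    using le A nn_integral_eq_integral[OF int] by simp
qed

end

section \<open>Laws of almost sure limits\<close>

lemma tendsto_fun_componentwise:
  fixes f :: "'c \<Rightarrow> 'a \<Rightarrow> 'b::topological_space"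
  assumes "\<And>i. ((\<lambda>n. f n i) \<longlongrightarrow> g i) F"
  shows "(f \<longlongrightarrow> g) F"
proof -
  have "limitin (product_topology (\<lambda>_. euclidean) UNIV) f g F"
    unfolding limitin_componentwise using assms by simp
  then show ?thesis by (simp add: euclidean_product_topology)
qed

text \<open>All \<open>X n\<close> share one law, so expectations of bounded continuous test
  functions pass to the limit unchanged. Bumps around closed sets then identify the measures on an
  intersection-stable generator.\<close>

lemma distr_AE_limit:
  fixes X :: "nat \<Rightarrow> 'a \<Rightarrow> 'b::metric_space"
  assumes "prob_space P" and X: "\<And>n. X n \<in> borel_measurable P" and Y: "Y \<in> borel_measurable P"
    and D: "\<And>n. distr P borel (X n) = D" and lim: "AE w in P. (\<lambda>n. X n w) \<longlonglongrightarrow> Y w"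
  shows "distr P borel Y = D"
proof -
  interpret P: prob_space P by fact
  interpret Y: prob_space "distr P borel Y" by (rule P.prob_space_distr[OF Y])
  interpret D: prob_space D using P.prob_space_distr[OF X[of 0]] by (simp add: D)
  have sD: "sets D = sets borel" "space D = UNIV" using D[of 0] by auto
  have eq: "emeasure (distr P borel Y) C = emeasure D C" if C: "closed C" for C
  proof (cases "C = {}")
    case False
    define \<phi> where "\<phi> m x = max 0 (1 - real m * infdist x C)" for m x
    have b: "\<bar>\<phi> m x\<bar> \<le> 1" for m x
      using infdist_nonneg[of x C] by (simp add: \<phi>_def abs_le_iff)
    have cont: "continuous_on UNIV (\<phi> m)" for m unfolding \<phi>_def by (intro continuous_intros)
    have [measurable]: "\<phi> m \<in> borel_measurable borel" for m
      by (rule borel_measurable_continuous_onI[OF cont])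
    note [measurable] = X Y
    have same: "(LINT x|distr P borel Y. \<phi> m x) = (LINT x|D. \<phi> m x)" for m
    proof -
      have "(\<lambda>n. LINT w|P. \<phi> m (X n w)) \<longlonglongrightarrow> (LINT w|P. \<phi> m (Y w))"
      proof (rule integral_dominated_convergence[where w="\<lambda>_. 1"])
        show "AE w in P. (\<lambda>n. \<phi> m (X n w)) \<longlonglongrightarrow> \<phi> m (Y w)"
          using lim by eventually_elim (rule continuous_on_tendsto_compose[OF cont], auto)
      qed (use b in auto)
      moreover have "(LINT w|P. \<phi> m (X n w)) = (LINT x|D. \<phi> m x)" for n
        by (simp add: D[of n, symmetric] integral_distr)
      ultimately show ?thesis by (simp add: integral_distr LIMSEQ_const_iff)
    qed
    have ind: "(\<lambda>m. LINT x|N. \<phi> m x) \<longlonglongrightarrow> measure N C" if N: "prob_space N" "sets N = sets borel" for N :: "'b measure"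
    proof -
      interpret N: prob_space N by fact
      have "C \<in> sets N" using C N(2) by simp
      then have "measure N C = (LINT x|N. indicator C x)" by simp
      moreover have "(\<lambda>m. LINT x|N. \<phi> m x) \<longlonglongrightarrow> (LINT x|N. indicator C x)"
      proof (rule integral_dominated_convergence[where w="\<lambda>_. 1"])
        show "AE x in N. (\<lambda>m. \<phi> m x) \<longlonglongrightarrow> indicator C x"
          unfolding \<phi>_def by (intro AE_I2 closed_indicator_limit C False)
        show "\<phi> m \<in> borel_measurable N" for m by (simp add: measurable_cong_sets[OF N(2) refl])
        show "(indicator C :: _ \<Rightarrow> real) \<in> borel_measurable N" using \<open>C \<in> sets N\<close> by simp
      qed (use b in auto)
      ultimately show ?thesis by simp
    qed
    have "measure (distr P borel Y) C = measure D C"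
      using LIMSEQ_unique[OF ind[OF Y.prob_space_axioms] ind[OF D.prob_space_axioms sD(1), folded same]] by simp
    then show ?thesis by (simp add: Y.emeasure_eq_measure D.emeasure_eq_measure)
  qed simp
  show ?thesis
  proof (rule measure_eqI_generator_eq[where E="Collect closed" and \<Omega>=UNIV and A="\<lambda>_. UNIV"])
    show "sets (distr P borel Y) = sigma_sets UNIV (Collect closed)" "sets D = sigma_sets UNIV (Collect closed)"
      by (simp_all add: sD borel_eq_closed)
    show "emeasure (distr P borel Y) C = emeasure D C" if "C \<in> Collect closed" for C
      using eq that by simp
  qed (auto simp: Int_stable_def Y.emeasure_finite)
qed

section \<open>The stationary measure\<close>

lemma nn_integral_distr_borel:
  "T \<in> measurable M N \<Longrightarrow> f \<in> borel_measurable N \<Longrightarrow> integral\<^sup>N (distr M N T) f = (\<integral>\<^sup>+x. f (T x) \<partial>M)"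
  by (rule nn_integral_distr) simp_all

locale noise_chain = volume_diffeo f for f :: "'n::finite torus \<Rightarrow> 'n torus" +
  fixes \<kappa> :: real and b :: "'n torus \<Rightarrow> real" and \<nu> :: "real measure"
  assumes \<kappa>: "\<kappa> > 0" and b: "b \<in> L2_zero"
    and prob_\<nu>: "prob_space \<nu>" and sets_\<nu>: "sets \<nu> = sets borel"
    and square_\<nu>: "integrable \<nu> (\<lambda>x. x\<^sup>2)" "(LINT x|\<nu>. x) = 0" "(LINT x|\<nu>. x\<^sup>2) = 1"
begin

interpretation nu: prob_space \<nu> by (rule prob_\<nu>)

text \<open>Canonical space of noise sequences; building the stationary law here makes it
  independent of the probability spaces that carry the innovations.\<close>

abbreviation noise :: "(nat \<Rightarrow> real) measure" where
  "noise \<equiv> Pi\<^sub>M UNIV (\<lambda>_. \<nu>)"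

interpretation S: sequence_space \<nu> ..

lemma space_\<nu>: "space \<nu> = UNIV"
  using sets_eq_imp_space_eq[OF sets_\<nu>] by simp

lemma sets_noise: "sets noise = sets (Pi\<^sub>M UNIV (\<lambda>_. borel))"
  by (intro sets_PiM_cong refl sets_\<nu>)

lemma space_noise: "space noise = UNIV"
  by (simp add: space_PiM space_\<nu> PiE_UNIV_domain)

lemma measurable_noise_component [measurable]: "(\<lambda>v. v n) \<in> borel_measurable noise"
  using measurable_component_singleton[of n UNIV "\<lambda>_. \<nu>"] by (simp add: measurable_cong_sets[OF refl sets_\<nu>])

lemma measurable_into_noise:
  assumes "\<And>n. X n \<in> borel_measurable M"
  shows "(\<lambda>w n. X n w) \<in> measurable M noise"
  by (rule measurable_PiM_single') (use assms in \<open>auto simp: measurable_cong_sets[OF refl sets_\<nu>] space_\<nu>\<close>)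

lemma distr_noise_component: "distr noise borel (\<lambda>v. v n) = \<nu>"
  using S.PiM_component[of n] by (simp cong: distr_cong add: distr_cong[OF refl sets_\<nu>[symmetric]])

lemma iid_innovationsI:
  assumes "prob_space M" "iid_on M \<eta> UNIV \<nu>"
  shows "iid_innovations M \<eta>"
proof -
  interpret prob_space M by fact
  have ind: "indep_vars (\<lambda>_. borel) \<eta> UNIV" and d: "distr M borel (\<eta> n) = \<nu>" for n
    using assms(2) by (auto simp: iid_on_def)
  then have m: "\<eta> n \<in> borel_measurable M" for n by (simp add: indep_vars_def)
  show ?thesis
  proof
    show "indep_vars (\<lambda>_. borel) \<eta> UNIV" by (rule ind)
    show "integrable M (\<lambda>w. (\<eta> n w)\<^sup>2)" for n
      using integrable_distr_eq[OF m[of n], of "\<lambda>x. x\<^sup>2"] square_\<nu>(1) by (simp add: d)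
    show "expectation (\<eta> n) = 0" for n
      using integral_distr[OF m[of n], of "\<lambda>x. x"] square_\<nu>(2) by (simp add: d)
    show "expectation (\<lambda>w. (\<eta> n w)\<^sup>2) = 1" for n
      using integral_distr[OF m[of n], of "\<lambda>x. x\<^sup>2"] square_\<nu>(3) by (simp add: d)
  qed
qed

text \<open>Independence with common marginals says that the joint law is the product measure; this
  moves any IID sequence to the canonical space.\<close>

lemma distr_iid_sequence:
  assumes "prob_space M" "iid_on M \<eta> UNIV \<nu>"
  shows "distr M noise (\<lambda>w n. \<eta> n w) = noise"
proof -
  interpret prob_space M by fact
  have ind: "indep_vars (\<lambda>_. borel) \<eta> UNIV" and d: "distr M borel (\<eta> n) = \<nu>" for n
    using assms(2) by (auto simp: iid_on_def)
  have m: "\<eta> n \<in> borel_measurable M" for n using ind by (simp add: indep_vars_def)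
  have "distr M (Pi\<^sub>M UNIV (\<lambda>_. borel)) (\<lambda>w. \<lambda>n\<in>UNIV. \<eta> n w) = Pi\<^sub>M UNIV (\<lambda>n. distr M borel (\<eta> n))"
    using indep_vars_iff_distr_eq_PiM[where I=UNIV and M'="\<lambda>_. borel" and X=\<eta>] ind m by simp
  then show ?thesis by (simp add: d restrict_UNIV distr_cong[OF refl sets_noise[symmetric] refl])
qed

lemma iid_noise_coordinates: "iid_on noise (\<lambda>n v. v n) UNIV \<nu>"
proof -
  have "S.indep_vars (\<lambda>_. borel) (\<lambda>n v. v n) UNIV"
    by (subst S.indep_vars_iff_distr_eq_PiM)
       (auto simp: distr_noise_component restrict_UNIV distr_id2 sets_noise)
  then show ?thesis by (simp add: iid_on_def distr_noise_component)
qed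

abbreviation iterate :: "nat \<Rightarrow> 'n torus \<Rightarrow> real" where
  "iterate n \<equiv> (transfer f \<kappa> ^^ n) b"

lemma iterate_L2_zero: "iterate n \<in> L2_zero"
  by (rule transfer_pow_L2_zero[OF \<kappa> b])

definition contraction :: real where
  "contraction = exp (- 4 * pi\<^sup>2 * \<kappa>)"

lemma contraction: "0 < contraction" "contraction < 1"
  using \<kappa> by (simp_all add: contraction_def)

section \<open>The random series on tame noise sequences\<close>

text \<open>The weights match the decay of the iterates at fixed \<kappa>. Extended reals make the
  condition a measurable event, and almost every noise sequence satisfies it.\<close>

definition tame :: "(nat \<Rightarrow> real) \<Rightarrow> bool" where
  "tame v \<longleftrightarrow> (\<Sum>n. ennreal (contraction ^ n * \<bar>v n\<bar>)) \<noteq> \<top>"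

lemma tame_iff: "tame v \<longleftrightarrow> summable (\<lambda>n. contraction ^ n * \<bar>v n\<bar>)"
  unfolding tame_def using contraction by (subst summable_iff_suminf_ennreal) auto

lemma tame_measurable [measurable]: "Measurable.pred noise tame"
  unfolding tame_def by measurable

lemma AE_tame:
  assumes "iid_innovations M \<eta>"
  shows "AE w in M. tame (\<lambda>n. \<eta> n w)"
  unfolding tame_iff using contraction
  by (intro iid_innovations.AE_summable_abs[OF assms] summable_geometric) auto

lemma AE_tame_noise: "AE v in noise. tame v"
  using AE_tame[OF iid_innovationsI[OF S.prob_space_axioms iid_noise_coordinates]] by simp

definition partial_series :: "nat \<Rightarrow> (nat \<Rightarrow> real) \<Rightarrow> 'n torus \<Rightarrow> real" where
  "partial_series n v x = (\<Sum>j<n. v j * iterate j x)"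

text \<open>For \<open>n \<ge> 1\<close> the functions \<open>\<L>\<^sup>n b\<close> are bounded by a multiple of \<open>contraction ^ n\<close>, so the
  series converges pointwise and no completeness of \<open>L\<^sup>2\<close> is needed.\<close>

definition series :: "(nat \<Rightarrow> real) \<Rightarrow> 'n torus \<Rightarrow> real" where
  "series v x = (if tame v then \<Sum>n. v n * iterate n x else 0)"

lemma partial_series_L2_zero: "partial_series n v \<in> L2_zero"
  unfolding partial_series_def by (intro L2_zero_sum L2_zero_scale iterate_L2_zero)

lemma partial_series_coeff:
  "fourier_coeff (partial_series n v) k = (\<Sum>j<n. of_real (v j) * fourier_coeff (iterate j) k)"
  unfolding partial_series_def
  by (simp add: fourier_coeff_sum L2_fun_scale L2_zero_imp_L2[OF iterate_L2_zero] fourier_coeff_scale)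

lemma series_converges:
  assumes v: "tame v"
  shows "series v \<in> L2_zero" "(\<lambda>n. L2_norm (\<lambda>x. series v x - partial_series n v x)) \<longlonglongrightarrow> 0"
proof -
  define c where "c = (\<Sum>\<^sub>\<infinity>k :: int^'n. heat_multiplier \<kappa> k) * L2_norm b"
  have c: "0 \<le> (\<Sum>\<^sub>\<infinity>k :: int^'n. heat_multiplier \<kappa> k)" "0 \<le> c"
    unfolding c_def by (auto intro!: infsum_nonneg mult_nonneg_nonneg simp: heat_multiplier_pos less_imp_le)
  \<comment> \<open>One application of the transfer operator turns the L2 decay of the previous
    iterate into a uniform bound, hence the index shift.\<close>
  have it: "\<bar>iterate (Suc n) x\<bar> \<le> c * contraction ^ n" for n x
  proof -
    have "\<bar>iterate (Suc n) x\<bar> \<le> (\<Sum>\<^sub>\<infinity>k :: int^'n. heat_multiplier \<kappa> k) * L2_norm (iterate n)"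
      using transfer_bounded[OF \<kappa> L2_zero_imp_L2[OF iterate_L2_zero]] by simp
    also have "\<dots> \<le> (\<Sum>\<^sub>\<infinity>k :: int^'n. heat_multiplier \<kappa> k) * (contraction ^ n * L2_norm b)"
      unfolding contraction_def by (intro mult_left_mono L2_norm_transfer_pow_le \<kappa> b c)
    finally show ?thesis by (simp add: c_def mult_ac)
  qed
  have "summable (\<lambda>n. contraction ^ Suc n * \<bar>v (Suc n)\<bar>)"
    using v unfolding tame_iff by (subst summable_Suc_iff)
  then have "summable (\<lambda>n. (c / contraction) * (contraction ^ Suc n * \<bar>v (Suc n)\<bar>))"
    by (rule summable_mult)
  then have sm: "summable (\<lambda>n. c * contraction ^ n * \<bar>v (Suc n)\<bar>)"
    using contraction by (simp add: field_simps)
  have le: "\<bar>v (Suc n) * iterate (Suc n) x\<bar> \<le> c * contraction ^ n * \<bar>v (Suc n)\<bar>" for n x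
    using mult_left_mono[OF it[of n x], of "\<bar>v (Suc n)\<bar>"] by (simp add: abs_mult mult_ac)
  have "summable (\<lambda>n. v (Suc n) * iterate (Suc n) x)" for x
    by (rule summable_comparison_test_ev[OF _ sm]) (use le in \<open>auto intro!: always_eventually\<close>)
  then have "summable (\<lambda>n. v n * iterate n x)" for x by (subst (asm) summable_Suc_iff)
  then have lim: "(\<lambda>n. partial_series n v x) \<longlonglongrightarrow> series v x" for x
    unfolding partial_series_def series_def using v by (simp add: summable_LIMSEQ)
  \<comment> \<open>The term n = 0 has no uniform bound, \<open>b\<close> being only
    square-integrable here, so |b| itself enters the majorant.\<close>
  define W where "W x = \<bar>v 0\<bar> * \<bar>b x\<bar> + (\<Sum>n. c * contraction ^ n * \<bar>v (Suc n)\<bar>)" for x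
  have bL: "b \<in> L2_fun" by (rule L2_zero_imp_L2[OF b])
  have WL: "W \<in> L2_fun" unfolding W_def
    using bL by (intro L2_fun_add L2_fun_scale L2_fun_const) (auto simp: L2_fun_def)
  have bound: "\<bar>partial_series n v x\<bar> \<le> W x" for n x
  proof -
    have "\<bar>partial_series n v x\<bar> \<le> (\<Sum>j<n. \<bar>v j * iterate j x\<bar>)"
      unfolding partial_series_def by (rule sum_abs)
    also have "\<dots> \<le> (\<Sum>j<Suc n. \<bar>v j * iterate j x\<bar>)" by simp
    also have "\<dots> = \<bar>v 0\<bar> * \<bar>b x\<bar> + (\<Sum>j<n. \<bar>v (Suc j) * iterate (Suc j) x\<bar>)"
      by (subst sum.lessThan_Suc_shift) (simp add: abs_mult)
    also have "(\<Sum>j<n. \<bar>v (Suc j) * iterate (Suc j) x\<bar>) \<le> (\<Sum>j<n. c * contraction ^ j * \<bar>v (Suc j)\<bar>)"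
      by (intro sum_mono le)
    also have "\<dots> \<le> (\<Sum>n. c * contraction ^ n * \<bar>v (Suc n)\<bar>)"
      using c contraction by (intro sum_le_suminf sm) auto
    finally show ?thesis by (simp add: W_def)
  qed
  note L = L2_limit_dominated[OF L2_fun_measurable[OF L2_zero_imp_L2[OF partial_series_L2_zero]] WL bound lim]
  show "(\<lambda>n. L2_norm (\<lambda>x. series v x - partial_series n v x)) \<longlonglongrightarrow> 0" by (rule L)
  have "(\<lambda>n. fourier_coeff (partial_series n v) 0) \<longlonglongrightarrow> fourier_coeff (series v) 0"
    by (rule fourier_coeff_L2_limit[OF L2_zero_imp_L2[OF partial_series_L2_zero] L])
  then show "series v \<in> L2_zero"
    using L(1) partial_series_L2_zero unfolding L2_zero_iff by (simp add: LIMSEQ_const_iff)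
qed

lemma series_L2_zero: "series v \<in> L2_zero"
  using series_converges(1)[of v] L2_zero_0 by (cases "tame v") (auto simp: series_def[abs_def])

lemma series_coeff:
  assumes "tame v"
  shows "(\<lambda>n. of_real (v n) * fourier_coeff (iterate n) k) sums fourier_coeff (series v) k"
  using fourier_coeff_L2_limit[OF L2_zero_imp_L2[OF partial_series_L2_zero] L2_zero_imp_L2 series_converges(2)[OF assms]]
    series_L2_zero by (simp add: sums_def partial_series_coeff)

text \<open>The value 0 off the tame sequences keeps the series in \<open>L2_zero\<close> everywhere
  and gives its coefficients by a measurable case distinction.\<close>

lemma series_measurable [measurable]: "series \<in> measurable noise L2_zero_borel"
proof (rule measurable_L2_zero_borelI)
  fix k
  have "fourier_coeff (series v) k = (if tame v then \<Sum>n. of_real (v n) * fourier_coeff (iterate n) k else 0)" for v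
    using sums_unique[OF series_coeff, of v k] by (auto simp: series_def[abs_def] fourier_coeff_def)
  then show "(\<lambda>v. fourier_coeff (series v) k) \<in> borel_measurable noise" by simp
qed (rule series_L2_zero)

lemma random_series_exists:
  assumes "prob_space M" "iid_on M \<eta> UNIV \<nu>"
  shows "is_random_series M \<eta> f \<kappa> b (\<lambda>w. series (\<lambda>n. \<eta> n w))"
  unfolding is_random_series_def
proof
  interpret iid_innovations M \<eta> by (rule iid_innovationsI[OF assms])
  show "(\<lambda>w. series (\<lambda>n. \<eta> n w)) \<in> measurable M L2_zero_borel"
    by (rule measurable_compose[OF measurable_into_noise series_measurable]) measurable
  show "AE w in M. (\<lambda>n. L2_norm (\<lambda>x. series (\<lambda>n. \<eta> n w) x - (\<Sum>j<n. \<eta> j w * iterate j x))) \<longlonglongrightarrow> 0"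
    using AE_tame[OF iid_innovations_axioms]
    by eventually_elim (use series_converges(2) in \<open>simp add: partial_series_def\<close>)
qed

definition stationary_law :: "('n torus \<Rightarrow> real) measure" where
  "stationary_law = distr noise L2_zero_borel series"

text \<open>Two versions may differ as functions; their coefficients agree almost surely, and events
  see nothing more. Transport to the canonical noise then removes the underlying space.\<close>

lemma random_series_law:
  assumes "prob_space M" "iid_on M \<eta> UNIV \<nu>" and g: "is_random_series M \<eta> f \<kappa> b g"
  shows "distr M L2_zero_borel g = stationary_law"
proof -
  interpret iid_innovations M \<eta> by (rule iid_innovationsI[OF assms(1,2)])
  have gm: "g \<in> measurable M L2_zero_borel" using g by (simp add: is_random_series_def)
  have \<eta>m: "(\<lambda>w n. \<eta> n w) \<in> measurable M noise" by (rule measurable_into_noise) measurable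
  have sm: "(\<lambda>w. series (\<lambda>n. \<eta> n w)) \<in> measurable M L2_zero_borel"
    by (rule measurable_compose[OF \<eta>m series_measurable])
  have eq: "AE w in M. fourier_coeff (g w) = fourier_coeff (series (\<lambda>n. \<eta> n w))"
    using AE_tame[OF iid_innovations_axioms] random_series_fourier_coeff[OF L2_zero_imp_L2[OF iterate_L2_zero] g]
  proof eventually_elim
    case (elim w)
    show ?case by (rule ext) (rule sums_unique2[OF elim(2)[rule_format] series_coeff[OF elim(1)]])
  qed
  have "distr M L2_zero_borel g = distr M L2_zero_borel (\<lambda>w. series (\<lambda>n. \<eta> n w))"
  proof (rule measure_eqI)
    fix A assume "A \<in> sets (distr M L2_zero_borel g)"
    then have A: "A \<in> sets L2_zero_borel" by simp
    have "AE w in M. w \<in> g -` A \<inter> space M \<longleftrightarrow> w \<in> (\<lambda>w. series (\<lambda>n. \<eta> n w)) -` A \<inter> space M"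
      using eq AE_space
    proof eventually_elim
      case (elim w)
      have "g w \<in> L2_zero" using measurable_space[OF gm elim(2)] by simp
      then show ?case
        using fourier_coeff_in_sets_L2_zero_borel[OF A _ series_L2_zero elim(1)] elim(2) by simp
    qed
    then show "emeasure (distr M L2_zero_borel g) A = emeasure (distr M L2_zero_borel (\<lambda>w. series (\<lambda>n. \<eta> n w))) A"
      by (simp add: emeasure_distr[OF gm A] emeasure_distr[OF sm A] emeasure_eq_AE measurable_sets[OF gm A] measurable_sets[OF sm A])
  qed simp
  also have "\<dots> = distr (distr M noise (\<lambda>w n. \<eta> n w)) L2_zero_borel series"
    by (simp add: distr_distr[OF series_measurable \<eta>m] comp_def)
  finally show ?thesis by (simp add: distr_iid_sequence[OF assms(1,2)] stationary_law_def)
qed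

section \<open>One step of the chain and invariance of the law\<close>

definition step :: "real \<Rightarrow> ('n torus \<Rightarrow> real) \<Rightarrow> 'n torus \<Rightarrow> real" where
  "step w g x = transfer f \<kappa> g x + w * b x"

lemma step_L2_zero: "g \<in> L2_zero \<Longrightarrow> step w g \<in> L2_zero"
  unfolding step_def by (intro L2_zero_add L2_zero_scale transfer_L2_zero[OF \<kappa>] b)

lemma step_coeff:
  "g \<in> L2_zero \<Longrightarrow> fourier_coeff (step w g) k = fourier_coeff (transfer f \<kappa> g) k + of_real w * fourier_coeff b k"
  unfolding step_def
  by (simp add: fourier_coeff_add fourier_coeff_scale L2_fun_scale L2_zero_imp_L2[OF b] transfer_L2_fun[OF \<kappa>] L2_zero_imp_L2)

lemma transfer_pow_lipschitz:
  assumes "g \<in> L2_zero" "h \<in> L2_zero"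
  shows "L2_norm (\<lambda>x. (transfer f \<kappa> ^^ n) h x - (transfer f \<kappa> ^^ n) g x) \<le> L2_norm (\<lambda>x. h x - g x)"
proof (induction n)
  case (Suc n)
  have "L2_norm (\<lambda>x. (transfer f \<kappa> ^^ Suc n) h x - (transfer f \<kappa> ^^ Suc n) g x) \<le>
      L2_norm (\<lambda>x. (transfer f \<kappa> ^^ n) h x - (transfer f \<kappa> ^^ n) g x)"
    using L2_norm_transfer_diff[OF \<kappa>] transfer_pow_L2_zero[OF \<kappa>] assms by (simp add: L2_zero_imp_L2)
  also note Suc
  finally show ?case .
qed simp

lemma transfer_pow_coeff_measurable [measurable]:
  "(\<lambda>g. fourier_coeff ((transfer f \<kappa> ^^ n) g) k) \<in> borel_measurable L2_zero_borel"
proof (rule lipschitz_measurable_L2_zero)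
  fix g h :: "'n torus \<Rightarrow> real" assume gh: "g \<in> L2_zero" "h \<in> L2_zero"
  let ?g = "(transfer f \<kappa> ^^ n) g" and ?h = "(transfer f \<kappa> ^^ n) h"
  have L: "?g \<in> L2_fun" "?h \<in> L2_fun" using transfer_pow_L2_zero[OF \<kappa>] gh by (auto simp: L2_zero_imp_L2)
  have "dist (fourier_coeff ?h k) (fourier_coeff ?g k) = norm (fourier_coeff (\<lambda>x. ?h x - ?g x) k)"
    by (simp add: dist_norm fourier_coeff_diff L)
  also have "\<dots> \<le> L2_norm (\<lambda>x. ?h x - ?g x)" by (intro norm_fourier_coeff_le L2_fun_diff L)
  also note transfer_pow_lipschitz[OF gh]
  finally show "dist (fourier_coeff ?h k) (fourier_coeff ?g k) \<le> L2_norm (\<lambda>x. h x - g x)" .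
qed

lemma measurable_\<nu>_id [measurable]: "(\<lambda>w. w) \<in> borel_measurable \<nu>"
  by (simp add: measurable_cong_sets[OF sets_\<nu> refl])

lemma step_measurable: "(\<lambda>p. step (snd p) (fst p)) \<in> measurable (L2_zero_borel \<Otimes>\<^sub>M \<nu>) L2_zero_borel"
proof (rule measurable_L2_zero_borelI)
  fix p :: "('n torus \<Rightarrow> real) \<times> real" assume "p \<in> space (L2_zero_borel \<Otimes>\<^sub>M \<nu>)"
  then show "step (snd p) (fst p) \<in> L2_zero" by (auto simp: space_pair_measure intro: step_L2_zero)
next
  fix k
  have m: "(\<lambda>g. fourier_coeff (transfer f \<kappa> g) k) \<in> borel_measurable L2_zero_borel"
    using transfer_pow_coeff_measurable[of 1 k] by simp
  have "(\<lambda>p. fourier_coeff (transfer f \<kappa> (fst p)) k + of_real (snd p) * fourier_coeff b k)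
      \<in> borel_measurable (L2_zero_borel \<Otimes>\<^sub>M \<nu>)"
    by (intro borel_measurable_add borel_measurable_times borel_measurable_const
        measurable_compose[OF measurable_fst m] 
        measurable_compose[OF measurable_compose[OF measurable_snd measurable_\<nu>_id] borel_measurable_of_real])
  then show "(\<lambda>p. fourier_coeff (step (snd p) (fst p)) k) \<in> borel_measurable (L2_zero_borel \<Otimes>\<^sub>M \<nu>)"
    by (rule measurable_cong[THEN iffD1, rotated]) (auto simp: space_pair_measure step_coeff)
qed

lemma step_measurable_noise: "g \<in> L2_zero \<Longrightarrow> (\<lambda>w. step w g) \<in> measurable \<nu> L2_zero_borel"
  using measurable_compose[OF measurable_Pair1'[of g L2_zero_borel \<nu>] step_measurable] by simp

lemma emeasure_transition_kernel:
  assumes "g \<in> L2_zero" "A \<in> sets L2_zero_borel"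
  shows "emeasure (transition_kernel f \<kappa> b \<nu> g) A = (\<integral>\<^sup>+w. indicator A (step w g) \<partial>\<nu>)"
proof -
  have "transition_kernel f \<kappa> b \<nu> g = distr \<nu> L2_zero_borel (\<lambda>w. step w g)"
    by (simp add: transition_kernel_def step_def[abs_def])
  then have "emeasure (transition_kernel f \<kappa> b \<nu> g) A = (\<integral>\<^sup>+h. indicator A h \<partial>distr \<nu> L2_zero_borel (\<lambda>w. step w g))"
    using assms(2) by simp
  also have "\<dots> = (\<integral>\<^sup>+w. indicator A (step w g) \<partial>\<nu>)"
    using assms by (intro nn_integral_distr step_measurable_noise) auto
  finally show ?thesis .
qed

lemma transition_kernel_measurable:
  assumes A: "A \<in> sets L2_zero_borel"
  shows "(\<lambda>g. emeasure (transition_kernel f \<kappa> b \<nu> g) A) \<in> borel_measurable L2_zero_borel"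
proof (rule measurable_cong[THEN iffD1, rotated])
  have "(\<lambda>p. indicator A (step (snd p) (fst p)) :: ennreal) \<in> borel_measurable (L2_zero_borel \<Otimes>\<^sub>M \<nu>)"
    by (rule measurable_compose[OF step_measurable]) (use A in simp)
  then show "(\<lambda>g. \<integral>\<^sup>+w. indicator A (step w g) \<partial>\<nu>) \<in> borel_measurable L2_zero_borel"
    by (intro nu.borel_measurable_nn_integral) (simp add: case_prod_beta')
qed (simp add: emeasure_transition_kernel A)

text \<open>One step of the chain prepends an innovation to the noise sequence that drives it.\<close>

lemma kernel_noise_shift:
  assumes F: "F \<in> measurable noise L2_zero_borel" and F': "\<And>v. F' v \<in> L2_zero"
    and eq: "AE v in noise. \<forall>w. fourier_coeff (step w (F' v)) = fourier_coeff (F (case_nat w v))"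
    and A: "A \<in> sets L2_zero_borel"
  shows "(\<integral>\<^sup>+v. emeasure (transition_kernel f \<kappa> b \<nu> (F' v)) A \<partial>noise) = (\<integral>\<^sup>+v. indicator A (F v) \<partial>noise)"
proof -
  interpret pair_sigma_finite \<nu> noise ..
  have Fz: "F v \<in> L2_zero" for v using measurable_space[OF F, of v] by (simp add: space_noise)
  have cn: "(\<lambda>(w, v). case_nat w v) \<in> measurable (\<nu> \<Otimes>\<^sub>M noise) noise" by measurable
  have ind: "(\<lambda>v. indicator A (F v) :: ennreal) \<in> borel_measurable noise"
    by (rule measurable_compose[OF F]) (use A in simp)
  have m: "(\<lambda>(w, v). indicator A (F (case_nat w v)) :: ennreal) \<in> borel_measurable (\<nu> \<Otimes>\<^sub>M noise)"
    using measurable_compose[OF cn ind] by (simp add: case_prod_beta')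
  have "(\<integral>\<^sup>+v. indicator A (F v) \<partial>noise) = (\<integral>\<^sup>+v. indicator A (F v) \<partial>distr (\<nu> \<Otimes>\<^sub>M noise) noise (\<lambda>(w, v). case_nat w v))"
    by (simp only: S.PiM_iter)
  also have "\<dots> = (\<integral>\<^sup>+p. indicator A (F (case p of (w, v) \<Rightarrow> case_nat w v)) \<partial>(\<nu> \<Otimes>\<^sub>M noise))"
    by (rule nn_integral_distr_borel[OF cn ind])
  also have "\<dots> = (\<integral>\<^sup>+v. \<integral>\<^sup>+w. indicator A (F (case_nat w v)) \<partial>\<nu> \<partial>noise)"
    using nn_integral_snd[OF m] by (simp add: case_prod_beta')
  also have "\<dots> = (\<integral>\<^sup>+v. emeasure (transition_kernel f \<kappa> b \<nu> (F' v)) A \<partial>noise)"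
  proof (rule nn_integral_cong_AE)
    show "AE v in noise. (\<integral>\<^sup>+w. indicator A (F (case_nat w v)) \<partial>\<nu>) = emeasure (transition_kernel f \<kappa> b \<nu> (F' v)) A"
      using eq
    proof eventually_elim
      case (elim v)
      have "step w (F' v) \<in> A \<longleftrightarrow> F (case_nat w v) \<in> A" for w
        by (rule fourier_coeff_in_sets_L2_zero_borel[OF A step_L2_zero[OF F'] Fz]) (use elim in blast)
      then show ?case by (simp add: emeasure_transition_kernel[OF F' A] indicator_def)
    qed
  qed
  finally show ?thesis by simp
qed

text \<open>The transfer operator does not increase L2 distances, so it may be applied to the
  partial sums, where it shifts every iterate by one.\<close>

lemma transfer_series_coeff:
  assumes v: "tame v"
  shows "(\<lambda>n. of_real (v n) * fourier_coeff (iterate (Suc n)) k) sums fourier_coeff (transfer f \<kappa> (series v)) k"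
proof -
  note pL = L2_zero_imp_L2[OF partial_series_L2_zero] and sL = L2_zero_imp_L2[OF series_L2_zero]
  have "(\<lambda>n. L2_norm (\<lambda>x. transfer f \<kappa> (series v) x - transfer f \<kappa> (partial_series n v) x)) \<longlonglongrightarrow> 0"
    by (rule tendsto_sandwich[OF _ _ tendsto_const series_converges(2)[OF v]])
       (auto intro!: always_eventually L2_norm_transfer_diff[OF \<kappa> sL pL])
  then have "(\<lambda>n. fourier_coeff (transfer f \<kappa> (partial_series n v)) k) \<longlonglongrightarrow> fourier_coeff (transfer f \<kappa> (series v)) k"
    by (intro fourier_coeff_L2_limit transfer_L2_fun[OF \<kappa>] pL sL)
  moreover have "fourier_coeff (transfer f \<kappa> (partial_series n v)) k =
      (\<Sum>j<n. of_real (v j) * fourier_coeff (iterate (Suc j)) k)" for n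
    unfolding partial_series_def
    by (subst fourier_coeff_transfer_sum[OF \<kappa>]) (auto intro: L2_zero_imp_L2 iterate_L2_zero)
  ultimately show ?thesis by (simp add: sums_def)
qed

lemma stationary_stationary_law: "stationary_measure f \<kappa> b \<nu> stationary_law"
  unfolding stationary_measure_def
proof (intro conjI ballI)
  show "prob_space stationary_law"
    unfolding stationary_law_def by (rule S.prob_space_distr[OF series_measurable])
  show "sets stationary_law = sets L2_zero_borel" by (simp add: stationary_law_def)
  fix A :: "('n torus \<Rightarrow> real) set" assume A: "A \<in> sets L2_zero_borel"
  have "AE v in noise. \<forall>w. fourier_coeff (step w (series v)) = fourier_coeff (series (case_nat w v))"
    using AE_tame_noise
  proof eventually_elim
    case (elim v)
    show ?case
    proof (intro allI ext)
      fix w k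
      \<comment> \<open>Prepending an entry multiplies the weights of the old entries by
        \<open>contraction\<close>, so tameness is kept.\<close>
      have "summable (\<lambda>n. contraction * (contraction ^ n * \<bar>v n\<bar>))"
        using elim unfolding tame_iff by (rule summable_mult)
      then have t: "tame (case_nat w v)"
        unfolding tame_iff by (subst summable_Suc_iff[symmetric]) (simp add: mult.assoc)
      have "(\<lambda>n. of_real (case_nat w v (Suc n)) * fourier_coeff (iterate (Suc n)) k) sums
          fourier_coeff (transfer f \<kappa> (series v)) k"
        using transfer_series_coeff[OF elim] by simp
      \<comment> \<open>The new zeroth term is w times the coefficient of \<open>b\<close>, exactly
        what \<open>step\<close> adds.\<close>
      from sums_Suc[OF this] have "(\<lambda>n. of_real (case_nat w v n) * fourier_coeff (iterate n) k) sums
          fourier_coeff (step w (series v)) k"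
        by (simp add: step_coeff[OF series_L2_zero])
      then show "fourier_coeff (step w (series v)) k = fourier_coeff (series (case_nat w v)) k"
        by (rule sums_unique2[OF _ series_coeff[OF t]])
    qed
  qed
  from kernel_noise_shift[OF series_measurable series_L2_zero this A]
  have "(\<integral>\<^sup>+v. emeasure (transition_kernel f \<kappa> b \<nu> (series v)) A \<partial>noise) = (\<integral>\<^sup>+v. indicator A (series v) \<partial>noise)" .
  also have "\<dots> = emeasure stationary_law A"
    unfolding stationary_law_def using A nn_integral_distr[OF series_measurable, of "indicator A"] by simp
  finally show "emeasure stationary_law A = (\<integral>\<^sup>+g. emeasure (transition_kernel f \<kappa> b \<nu> g) A \<partial>stationary_law)"
    unfolding stationary_law_def by (simp add: nn_integral_distr_borel[OF series_measurable transition_kernel_measurable[OF A]])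
qed

section \<open>Uniqueness of the stationary law\<close>

text \<open>Index 0 carries the newest innovation, the reverse of chronological order. For fixed n
  this has the law of the chain after n steps from \<open>g\<close>, but as n grows the noise part
  is a partial sum of one fixed series and can converge almost surely.\<close>

definition solution :: "nat \<Rightarrow> ('n torus \<Rightarrow> real) \<Rightarrow> (nat \<Rightarrow> real) \<Rightarrow> 'n torus \<Rightarrow> real" where
  "solution n g v x = (transfer f \<kappa> ^^ n) g x + partial_series n v x"

lemma solution_L2_zero: "g \<in> L2_zero \<Longrightarrow> solution n g v \<in> L2_zero"
  unfolding solution_def by (intro L2_zero_add transfer_pow_L2_zero \<kappa> partial_series_L2_zero)

lemma solution_coeff:
  "g \<in> L2_zero \<Longrightarrow> fourier_coeff (solution n g v) k =
    fourier_coeff ((transfer f \<kappa> ^^ n) g) k + (\<Sum>j<n. of_real (v j) * fourier_coeff (iterate j) k)"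
  unfolding solution_def partial_series_coeff[symmetric]
  by (intro fourier_coeff_add L2_zero_imp_L2 transfer_pow_L2_zero \<kappa> partial_series_L2_zero)

lemma solution_measurable:
  "(\<lambda>p. solution n (fst p) (snd p)) \<in> measurable (L2_zero_borel \<Otimes>\<^sub>M noise) L2_zero_borel"
proof (rule measurable_L2_zero_borelI)
  fix p :: "('n torus \<Rightarrow> real) \<times> (nat \<Rightarrow> real)" assume "p \<in> space (L2_zero_borel \<Otimes>\<^sub>M noise)"
  then show "solution n (fst p) (snd p) \<in> L2_zero" by (auto simp: space_pair_measure intro: solution_L2_zero)
next
  fix k
  have "(\<lambda>p. fourier_coeff ((transfer f \<kappa> ^^ n) (fst p)) k + (\<Sum>j<n. of_real (snd p j) * fourier_coeff (iterate j) k))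
      \<in> borel_measurable (L2_zero_borel \<Otimes>\<^sub>M noise)"
    by (intro borel_measurable_add borel_measurable_sum borel_measurable_times borel_measurable_const
        measurable_compose[OF measurable_fst transfer_pow_coeff_measurable]
        measurable_compose[OF measurable_compose[OF measurable_snd measurable_noise_component] borel_measurable_of_real])
  then show "(\<lambda>p. fourier_coeff (solution n (fst p) (snd p)) k) \<in> borel_measurable (L2_zero_borel \<Otimes>\<^sub>M noise)"
    by (rule measurable_cong[THEN iffD1, rotated]) (auto simp: space_pair_measure solution_coeff)
qed

lemma solution_step_coeff:
  assumes g: "g \<in> L2_zero"
  shows "fourier_coeff (step w (solution n g v)) = fourier_coeff (solution (Suc n) g (case_nat w v))"
proof
  fix k
  let ?u = "(transfer f \<kappa> ^^ n) g"
  have u: "?u \<in> L2_fun" by (intro L2_zero_imp_L2 transfer_pow_L2_zero \<kappa> g)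
  \<comment> \<open>Written as a sum over two labels, to which linearity of the transferred
    coefficients applies.\<close>
  have "solution n g v = (\<lambda>x. \<Sum>i\<in>{True, False}. 1 * (if i then ?u x else partial_series n v x))"
    by (simp add: solution_def fun_eq_iff)
  then have "fourier_coeff (transfer f \<kappa> (solution n g v)) k =
      fourier_coeff (transfer f \<kappa> ?u) k + fourier_coeff (transfer f \<kappa> (partial_series n v)) k"
    using fourier_coeff_transfer_sum[OF \<kappa>, of "{True, False}" "\<lambda>i. if i then ?u else partial_series n v" "\<lambda>_. 1" k]
      u L2_zero_imp_L2[OF partial_series_L2_zero[of n v]] by (simp add: if_distribR)
  moreover have "fourier_coeff (transfer f \<kappa> (partial_series n v)) k =
      (\<Sum>j<n. of_real (v j) * fourier_coeff (iterate (Suc j)) k)"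
    unfolding partial_series_def
    by (subst fourier_coeff_transfer_sum[OF \<kappa>]) (auto intro: L2_zero_imp_L2 iterate_L2_zero)
  ultimately show "fourier_coeff (step w (solution n g v)) k = fourier_coeff (solution (Suc n) g (case_nat w v)) k"
    unfolding step_coeff[OF solution_L2_zero[OF g]] solution_coeff[OF g] sum.lessThan_Suc_shift by simp
qed

text \<open>In the induction step the hypothesis exhibits \<mu> as the law of the n-step solution;
  the kernel leaves \<mu> unchanged and acts on the solution by prepending one innovation.\<close>

lemma stationary_measure_eq_solution_law:
  assumes \<mu>: "stationary_measure f \<kappa> b \<nu> \<mu>"
  shows "distr (\<mu> \<Otimes>\<^sub>M noise) L2_zero_borel (\<lambda>p. solution n (fst p) (snd p)) = \<mu>"
proof (induction n)
  have prob: "prob_space \<mu>" and sets: "sets \<mu> = sets L2_zero_borel"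
    and inv: "\<And>A. A \<in> sets L2_zero_borel \<Longrightarrow> emeasure \<mu> A = (\<integral>\<^sup>+g. emeasure (transition_kernel f \<kappa> b \<nu> g) A \<partial>\<mu>)"
    using \<mu> by (auto simp: stationary_measure_def)
  interpret \<mu>: prob_space \<mu> by (rule prob)
  interpret pair_prob_space \<mu> noise ..
  have space: "space \<mu> = L2_zero" using sets_eq_imp_space_eq[OF sets] by simp
  have pair_sets: "sets (\<mu> \<Otimes>\<^sub>M noise) = sets (L2_zero_borel \<Otimes>\<^sub>M noise)"
    by (intro sets_pair_measure_cong sets refl)
  have sol: "(\<lambda>p. solution n (fst p) (snd p)) \<in> measurable (\<mu> \<Otimes>\<^sub>M noise) L2_zero_borel" for n
    using solution_measurable by (simp add: measurable_cong_sets[OF pair_sets refl])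
  have eq: "emeasure (distr (\<mu> \<Otimes>\<^sub>M noise) L2_zero_borel (\<lambda>p. solution n (fst p) (snd p))) A =
      (\<integral>\<^sup>+g. \<integral>\<^sup>+v. indicator A (solution n g v) \<partial>noise \<partial>\<mu>)" if A: "A \<in> sets L2_zero_borel" for A n
  proof -
    have m: "(\<lambda>p. indicator A (solution n (fst p) (snd p)) :: ennreal) \<in> borel_measurable (\<mu> \<Otimes>\<^sub>M noise)"
      by (rule measurable_compose[OF sol]) (use A in simp)
    have "emeasure (distr (\<mu> \<Otimes>\<^sub>M noise) L2_zero_borel (\<lambda>p. solution n (fst p) (snd p))) A =
       (\<integral>\<^sup>+p. indicator A (solution n (fst p) (snd p)) \<partial>(\<mu> \<Otimes>\<^sub>M noise))"
      using A nn_integral_distr[OF sol, of "indicator A"] by simp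
    also have "\<dots> = (\<integral>\<^sup>+g. \<integral>\<^sup>+v. indicator A (solution n g v) \<partial>noise \<partial>\<mu>)"
      using S.nn_integral_fst[OF m] by simp
    finally show ?thesis .
  qed
  {
    case 0
    show ?case
    proof (rule measure_eqI)
      fix A assume "A \<in> sets (distr (\<mu> \<Otimes>\<^sub>M noise) L2_zero_borel (\<lambda>p. solution 0 (fst p) (snd p)))"
      then have A: "A \<in> sets L2_zero_borel" by simp
      have "solution 0 g v = g" for g v by (simp add: solution_def partial_series_def fun_eq_iff)
      then show "emeasure (distr (\<mu> \<Otimes>\<^sub>M noise) L2_zero_borel (\<lambda>p. solution 0 (fst p) (snd p))) A = emeasure \<mu> A"
        unfolding eq[OF A] using A sets by (simp add: S.emeasure_space_1)
    qed (simp add: sets)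
  next
    case (Suc n)
    show ?case
    proof (rule measure_eqI)
      fix A assume "A \<in> sets (distr (\<mu> \<Otimes>\<^sub>M noise) L2_zero_borel (\<lambda>p. solution (Suc n) (fst p) (snd p)))"
      then have A: "A \<in> sets L2_zero_borel" by simp
      note km = transition_kernel_measurable[OF A]
      have "emeasure \<mu> A = (\<integral>\<^sup>+g. emeasure (transition_kernel f \<kappa> b \<nu> g) A \<partial>\<mu>)" by (rule inv[OF A])
      also have "\<dots> = (\<integral>\<^sup>+g. emeasure (transition_kernel f \<kappa> b \<nu> g) A
          \<partial>distr (\<mu> \<Otimes>\<^sub>M noise) L2_zero_borel (\<lambda>p. solution n (fst p) (snd p)))"
        by (simp only: Suc.IH)
      also have "\<dots> = (\<integral>\<^sup>+p. emeasure (transition_kernel f \<kappa> b \<nu> (solution n (fst p) (snd p))) A \<partial>(\<mu> \<Otimes>\<^sub>M noise))"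
        by (rule nn_integral_distr_borel[OF sol km])
      also have "\<dots> = (\<integral>\<^sup>+g. \<integral>\<^sup>+v. emeasure (transition_kernel f \<kappa> b \<nu> (solution n g v)) A \<partial>noise \<partial>\<mu>)"
        using S.nn_integral_fst[OF measurable_compose[OF sol km]] by simp
      also have "\<dots> = (\<integral>\<^sup>+g. \<integral>\<^sup>+v. indicator A (solution (Suc n) g v) \<partial>noise \<partial>\<mu>)"
      proof (rule nn_integral_cong)
        fix g assume "g \<in> space \<mu>"
        then have g: "g \<in> L2_zero" by (simp add: space)
        have Fm: "solution (Suc n) g \<in> measurable noise L2_zero_borel"
          using measurable_compose[OF measurable_Pair1'[of g L2_zero_borel noise] solution_measurable] g by simp
        show "(\<integral>\<^sup>+v. emeasure (transition_kernel f \<kappa> b \<nu> (solution n g v)) A \<partial>noise) =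
            (\<integral>\<^sup>+v. indicator A (solution (Suc n) g v) \<partial>noise)"
          by (rule kernel_noise_shift[OF Fm solution_L2_zero[OF g] _ A]) (simp add: solution_step_coeff[OF g])
      qed
      finally show "emeasure (distr (\<mu> \<Otimes>\<^sub>M noise) L2_zero_borel (\<lambda>p. solution (Suc n) (fst p) (snd p))) A = emeasure \<mu> A"
        unfolding eq[OF A] by simp
    qed (simp add: sets)
  }
qed

text \<open>The initial datum decays by the spectral gap, leaving partial sums of the series.
  Convergence is in the product topology on coefficient families, which is metrisable as there are
  countably many modes.\<close>

lemma solution_converges:
  assumes g: "g \<in> L2_zero" and v: "tame v"
  shows "(\<lambda>n. fourier_coeff (solution n g v)) \<longlonglongrightarrow> fourier_coeff (series v)"
proof (rule tendsto_fun_componentwise)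
  fix k
  have "(\<lambda>n. contraction ^ n * L2_norm g) \<longlonglongrightarrow> 0 * L2_norm g"
    using contraction by (intro tendsto_mult[OF LIMSEQ_realpow_zero tendsto_const]) auto
  then have null: "(\<lambda>n. contraction ^ n * L2_norm g) \<longlonglongrightarrow> 0" by simp
  have "norm (fourier_coeff ((transfer f \<kappa> ^^ n) g) k) \<le> contraction ^ n * L2_norm g" for n
    using norm_fourier_coeff_le[OF L2_zero_imp_L2[OF transfer_pow_L2_zero[OF \<kappa> g]]]
      L2_norm_transfer_pow_le[OF \<kappa> g] unfolding contraction_def by (rule order_trans)
  then have "(\<lambda>n. fourier_coeff ((transfer f \<kappa> ^^ n) g) k) \<longlonglongrightarrow> 0"
    by (intro Lim_null_comparison[OF always_eventually null] allI)
  from tendsto_add[OF this series_coeff[OF v, of k, unfolded sums_def]]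
  show "(\<lambda>n. fourier_coeff (solution n g v) k) \<longlonglongrightarrow> fourier_coeff (series v) k"
    by (simp add: solution_coeff[OF g])
qed

text \<open>For every n the coefficients of the n-step solution have the law induced by \<mu>, and
  almost surely they tend to those of the series driven by the noise alone; so these have that law
  too.\<close>

lemma stationary_measure_unique:
  assumes \<mu>: "stationary_measure f \<kappa> b \<nu> \<mu>"
  shows "\<mu> = stationary_law"
proof -
  have prob: "prob_space \<mu>" and sets: "sets \<mu> = sets L2_zero_borel"
    using \<mu> by (auto simp: stationary_measure_def)
  interpret \<mu>: prob_space \<mu> by (rule prob)
  interpret pair_prob_space \<mu> noise ..
  have space: "space \<mu> = L2_zero" using sets_eq_imp_space_eq[OF sets] by simp
  have pair_sets: "sets (\<mu> \<Otimes>\<^sub>M noise) = sets (L2_zero_borel \<Otimes>\<^sub>M noise)"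
    by (intro sets_pair_measure_cong sets refl)
  have sol: "(\<lambda>p. solution n (fst p) (snd p)) \<in> measurable (\<mu> \<Otimes>\<^sub>M noise) L2_zero_borel" for n
    using solution_measurable by (simp add: measurable_cong_sets[OF pair_sets refl])
  note fm = fourier_coeff_measurable_fun
  have fm\<mu>: "fourier_coeff \<in> borel_measurable \<mu>" using fm by (simp add: measurable_cong_sets[OF sets refl])
  have fs: "(\<lambda>v. fourier_coeff (series v)) \<in> borel_measurable noise"
    by (rule measurable_compose[OF series_measurable fm])
  have "distr (\<mu> \<Otimes>\<^sub>M noise) borel (\<lambda>p. fourier_coeff (series (snd p))) = distr \<mu> borel fourier_coeff"
  proof (rule distr_AE_limit[where X="\<lambda>n p. fourier_coeff (solution n (fst p) (snd p))"])
    show "prob_space (\<mu> \<Otimes>\<^sub>M noise)" by (rule prob_space_axioms)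
    show "(\<lambda>p. fourier_coeff (solution n (fst p) (snd p))) \<in> borel_measurable (\<mu> \<Otimes>\<^sub>M noise)" for n
      by (rule measurable_compose[OF sol fm])
    show "(\<lambda>p. fourier_coeff (series (snd p))) \<in> borel_measurable (\<mu> \<Otimes>\<^sub>M noise)"
      by (rule measurable_compose[OF measurable_snd fs])
    show "distr (\<mu> \<Otimes>\<^sub>M noise) borel (\<lambda>p. fourier_coeff (solution n (fst p) (snd p))) = distr \<mu> borel fourier_coeff" for n
    proof -
      have "distr (distr (\<mu> \<Otimes>\<^sub>M noise) L2_zero_borel (\<lambda>p. solution n (fst p) (snd p))) borel fourier_coeff =
         distr (\<mu> \<Otimes>\<^sub>M noise) borel (\<lambda>p. fourier_coeff (solution n (fst p) (snd p)))"
        by (simp add: distr_distr[OF fm sol] comp_def)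
      then show ?thesis by (simp add: stationary_measure_eq_solution_law[OF \<mu>])
    qed
    have "AE p in \<mu> \<Otimes>\<^sub>M noise. tame (snd p)"
      by (rule AE_pair_measure) (use AE_tame_noise in auto)
    then show "AE p in \<mu> \<Otimes>\<^sub>M noise. (\<lambda>n. fourier_coeff (solution n (fst p) (snd p))) \<longlonglongrightarrow> fourier_coeff (series (snd p))"
      using AE_space
    proof eventually_elim
      case (elim p)
      then show ?case by (intro solution_converges) (auto simp: space_pair_measure space)
    qed
  qed
  note law = this
  show ?thesis
  proof (rule measure_eqI)
    show "sets \<mu> = sets stationary_law" by (simp add: sets stationary_law_def)
    fix A assume "A \<in> sets \<mu>"
    then have A: "A \<in> sets L2_zero_borel" by (simp add: sets)
    then obtain B where B: "B \<in> sets borel" "A = fourier_coeff -` B \<inter> L2_zero"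
      by (rule sets_L2_zero_borel_vimage)
    have V: "{v. fourier_coeff (series v) \<in> B} \<in> sets noise"
      using measurable_sets[OF fs B(1)] by (simp add: space_noise vimage_def)
    have "emeasure \<mu> A = emeasure (distr \<mu> borel fourier_coeff) B"
      by (simp add: emeasure_distr[OF fm\<mu> B(1)] B(2) space)
    also have "\<dots> = emeasure (\<mu> \<Otimes>\<^sub>M noise) ((\<lambda>p. fourier_coeff (series (snd p))) -` B \<inter> space (\<mu> \<Otimes>\<^sub>M noise))"
      unfolding law[symmetric]
      by (rule emeasure_distr[OF measurable_compose[OF measurable_snd fs] B(1)])
    also have "(\<lambda>p. fourier_coeff (series (snd p))) -` B \<inter> space (\<mu> \<Otimes>\<^sub>M noise) = space \<mu> \<times> {v. fourier_coeff (series v) \<in> B}"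
      by (auto simp: space_pair_measure space_noise)
    \<comment> \<open>The initial datum no longer appears in the event, so its factor has measure
      1.\<close>
    also have "emeasure (\<mu> \<Otimes>\<^sub>M noise) \<dots> = emeasure noise {v. fourier_coeff (series v) \<in> B}"
      by (subst S.emeasure_pair_measure_Times) (auto simp: V \<mu>.emeasure_space_1)
    also have "\<dots> = emeasure stationary_law A"
      unfolding stationary_law_def emeasure_distr[OF series_measurable A]
      by (rule arg_cong[where f="emeasure noise"]) (auto simp: B(2) space_noise series_L2_zero)
    finally show "emeasure \<mu> A = emeasure stationary_law A" .
  qed
qed

end

section \<open>The logarithmic bounds and the final assembly\<close>

lemma scale_condition:
  assumes "0 < \<kappa>" "0 < N" "N \<le> \<kappa> powr (-1/2)"
  shows "\<kappa> * N\<^sup>2 \<le> (1 :: real)"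
proof -
  have "N\<^sup>2 \<le> (\<kappa> powr (-1/2))\<^sup>2" using assms by (intro power_mono) auto
  also have "\<dots> = 1 / \<kappa>"
    using assms by (simp add: power2_eq_square powr_add[symmetric] powr_minus_divide)
  finally show ?thesis using assms by (simp add: pos_le_divide_eq mult.commute)
qed

context stationary_solution
begin

lemma low_modes_second_moment_upper:
  assumes "L2_norm b = 1" "N \<ge> 1" "\<gamma> > 0" "C > 0"
    and decay: "\<And>n. n \<ge> 1 \<Longrightarrow> sobolev_norm (-1) (iterate n) \<le> C * exp (- \<gamma> * real n)"
  shows "expectation (\<lambda>w. (L2_norm (proj_le N (g w)))\<^sup>2) \<le>
    ln N / \<gamma> + (2 + C\<^sup>2 / (1 - exp (- 2 * \<gamma>)))"
  unfolding proj_le_second_moment(2)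
proof (rule suminf_upper_log_bound)
  show "(L2_norm (proj_le N (iterate n)))\<^sup>2 \<le> 1" for n
    using L2_norm_proj_le_le[OF iterate_L2, of N n] L2_norm_transfer_pow_le_1[OF \<kappa> b, of n] assms(1)
      power_le_one[of "L2_norm (iterate n)" 2] by (simp only: L2_norm_nonneg order_trans)
  fix n :: nat assume n: "n \<ge> 1"
  have "(L2_norm (proj_le N (iterate n)))\<^sup>2 \<le> N\<^sup>2 * (sobolev_norm (-1) (iterate n))\<^sup>2"
    using proj_le_upper_bound[OF transfer_pow_L2_zero[OF \<kappa> b]] \<open>N \<ge> 1\<close> by simp
  also have "\<dots> \<le> N\<^sup>2 * (C * exp (- \<gamma> * real n))\<^sup>2"
    by (intro mult_left_mono power_mono decay n) (auto simp: sobolev_norm_def intro!: infsum_nonneg)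
  also have "\<dots> = C\<^sup>2 * N\<^sup>2 * exp (- 2 * \<gamma> * real n)"
    by (simp add: power_mult_distrib exp_double[symmetric] mult_ac)
  finally show "(L2_norm (proj_le N (iterate n)))\<^sup>2 \<le> C\<^sup>2 * N\<^sup>2 * exp (- 2 * \<gamma> * real n)" .
qed (use assms proj_le_second_moment(3) in auto)

lemma low_modes_second_moment_lower:
  assumes "L2_norm b = 1" and N: "N \<ge> 1" "\<kappa> * N\<^sup>2 \<le> 1" and B: "dirichlet_le b B" and \<Lambda>: "Lambda_of f > 0"
  defines "E \<equiv> exp (2 * Lambda_of f)"
  shows "ln N / Lambda_of f - (8 * pi\<^sup>2 * E * B / (E - 1) + B) * E / (E - 1) \<le>
    expectation (\<lambda>w. (L2_norm (proj_le N (g w)))\<^sup>2)"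
  unfolding proj_le_second_moment(2) E_def
proof (rule suminf_lower_log_bound)
  show "1 - (8 * pi\<^sup>2 * exp (2 * Lambda_of f) * B / (exp (2 * Lambda_of f) - 1) + B) / N\<^sup>2 * exp (2 * Lambda_of f) ^ n
      \<le> (L2_norm (proj_le N (iterate n)))\<^sup>2" for n
    using low_modes_lower_bound[OF \<kappa> b B \<Lambda> _ N(2), of n] N(1) assms(1) by simp
  have "0 \<le> B" using B[unfolded dirichlet_le_def, rule_format, of "{}"] by simp
  then show "0 \<le> 8 * pi\<^sup>2 * exp (2 * Lambda_of f) * B / (exp (2 * Lambda_of f) - 1) + B"
    using \<Lambda> by (intro add_nonneg_nonneg divide_nonneg_nonneg mult_nonneg_nonneg) auto
qed (use N \<Lambda> proj_le_second_moment(3) in auto)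

end

theorem theorem2p2:
  fixes f :: "('n::finite) torus \<Rightarrow> 'n torus"
    and b :: "'n torus \<Rightarrow> real"
    and \<gamma> :: real
    and M :: "'w measure" and \<omega> :: "nat \<Rightarrow> 'w \<Rightarrow> real"
    and M' :: "'v measure" and \<eta> :: "nat \<Rightarrow> 'v \<Rightarrow> real"
    and \<nu> :: "real measure"
  assumes "smooth_diffeo f" and "preserves_lebesgue f"
    and "uniform_Hminus1_decay f \<gamma>"
    and "smooth_function b" and "mean_zero b" and "L2_norm b = 1"
    and "prob_space M" and "iid_on M \<omega> {1..} \<nu>"
    and "\<And>n. n \<ge> 1 \<Longrightarrow> integrable M (\<lambda>w. (\<omega> n w)\<^sup>2)"
    and "\<And>n. n \<ge> 1 \<Longrightarrow> prob_space.expectation M (\<omega> n) = 0"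
    and "\<And>n. n \<ge> 1 \<Longrightarrow> prob_space.variance M (\<omega> n) = 1"
    and "prob_space M'" and "iid_on M' \<eta> UNIV \<nu>"
  shows
    "(\<forall>\<kappa>>0.
        (\<exists>!\<mu>. stationary_measure f \<kappa> b \<nu> \<mu>) \<and>
        (\<exists>g. is_random_series M' \<eta> f \<kappa> b g) \<and>
        (\<forall>g. is_random_series M' \<eta> f \<kappa> b g \<longrightarrow>
           stationary_measure f \<kappa> b \<nu> (distr M' L2_zero_borel g)))
     \<and>
     (\<exists>C>0. \<exists>\<kappa>\<^sub>0>0. \<forall>\<kappa>. 0 < \<kappa> \<and> \<kappa> \<le> \<kappa>\<^sub>0 \<longrightarrow>
        (\<forall>g. is_random_series M' \<eta> f \<kappa> b g \<longrightarrow>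
           (\<forall>N::real. 2 \<le> N \<and> N \<le> \<kappa> powr (-1/2) \<longrightarrow>
              integrable M' (\<lambda>w. (L2_norm (proj_le N (g w)))\<^sup>2) \<and>
              1 / (2 * Lambda_of f) * ln N - C
                \<le> prob_space.expectation M' (\<lambda>w. (L2_norm (proj_le N (g w)))\<^sup>2) \<and>
              prob_space.expectation M' (\<lambda>w. (L2_norm (proj_le N (g w)))\<^sup>2)
                \<le> 2 / \<gamma> * ln N + C) \<and>
           integrable M' (\<lambda>w. (L2_norm (proj_ge (\<kappa> powr (-1/2)) (g w)))\<^sup>2) \<and>
           prob_space.expectation M' (\<lambda>w. (L2_norm (proj_ge (\<kappa> powr (-1/2)) (g w)))\<^sup>2) \<le> C))"
proof -
  interpret volume_diffeo f by unfold_locales fact+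
  interpret M: prob_space M by fact
  have d1: "distr M borel (\<omega> 1) = \<nu>" and ind: "M.indep_vars (\<lambda>_. borel) \<omega> {1..}"
    using \<open>iid_on M \<omega> {1..} \<nu>\<close> by (auto simp: iid_on_def)
  then have m1: "\<omega> 1 \<in> borel_measurable M" by (auto simp: M.indep_vars_def)
  have b: "b \<in> L2_zero"
    using L2_fun_continuous[OF C1_torus_continuous[OF smooth_function_C1[OF \<open>smooth_function b\<close>]]] \<open>mean_zero b\<close>
    by (simp add: L2_zero_iff mean_zero_iff)
  have mean: "M.expectation (\<omega> 1) = 0" using assms(10)[of 1] by simp
  \<comment> \<open>The law \<open>\<nu>\<close> is that of the innovation with index 1, which
    provides the moments; with mean zero, the variance is the second moment. The sequence
    \<open>\<eta>\<close> inherits them through \<open>\<nu>\<close>.\<close>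
  have chain: "noise_chain f \<kappa> b \<nu>" if "\<kappa> > 0" for \<kappa>
  proof (intro noise_chain.intro noise_chain_axioms.intro)
    show "volume_diffeo f" by (rule volume_diffeo_axioms)
    show "prob_space \<nu>" using M.prob_space_distr[OF m1] by (simp only: d1)
    show "sets \<nu> = sets borel" by (simp flip: d1)
    show "integrable \<nu> (\<lambda>x. x\<^sup>2)"
      using integrable_distr_eq[OF m1, of "\<lambda>x. x\<^sup>2"] assms(9)[of 1] by (simp add: d1[unfolded One_nat_def])
    show "(LINT x|\<nu>. x) = 0" using integral_distr[OF m1, of "\<lambda>x. x"] mean by (simp add: d1[unfolded One_nat_def])
    show "(LINT x|\<nu>. x\<^sup>2) = 1"
      using integral_distr[OF m1, of "\<lambda>x. x\<^sup>2"] assms(11)[of 1] mean by (simp add: d1[unfolded One_nat_def])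
  qed (use that b in auto)
  note iid = \<open>prob_space M'\<close> \<open>iid_on M' \<eta> UNIV \<nu>\<close>
  have solution: "stationary_solution f M' \<eta> \<kappa> b g"
    if "\<kappa> > 0" "is_random_series M' \<eta> f \<kappa> b g" for \<kappa> g
  proof -
    interpret iid_innovations M' \<eta> by (rule noise_chain.iid_innovationsI[OF chain[OF that(1)] iid])
    show ?thesis by unfold_locales (use that b in auto)
  qed
  have \<gamma>: "\<gamma> > 0" using \<open>uniform_Hminus1_decay f \<gamma>\<close> by (simp add: uniform_Hminus1_decay_def)
  \<comment> \<open>The decay constant of \<open>b\<close> is fixed before \<kappa>; this uniformity
    makes the final constant independent of \<kappa>.\<close>
  obtain A where A: "A > 0" "\<And>\<kappa> n. \<kappa> \<ge> 0 \<Longrightarrow> n \<ge> 1 \<Longrightarrow>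
      sobolev_norm (-1) ((transfer f \<kappa> ^^ n) b) \<le> A * exp (- \<gamma> * real n)"
    using \<open>uniform_Hminus1_decay f \<gamma>\<close> \<open>smooth_function b\<close> \<open>mean_zero b\<close>
    unfolding uniform_Hminus1_decay_def by blast
  obtain B where B: "dirichlet_le b B"
    using dirichlet_le_C1[OF smooth_function_C1[OF \<open>smooth_function b\<close>]] by blast
  define E where "E = exp (2 * Lambda_of f)"
  \<comment> \<open>\<open>C1\<close> is the additive constant of the upper bound and
    \<open>C2\<close> the error in the lower one; neither contains \<kappa> or N.\<close>
  define C1 C2 where "C1 = 2 + A\<^sup>2 / (1 - exp (- 2 * \<gamma>))"
    and "C2 = (8 * pi\<^sup>2 * E * B / (E - 1) + B) * E / (E - 1)"
  have C1: "2 \<le> C1" using \<gamma> by (simp add: C1_def)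
  \<comment> \<open>\<open>C2\<close> need not be nonnegative when \<Lambda> \<le> 0, hence the
    absolute value; C \<ge> C1 \<ge> 2 also covers the modes above the dissipation scale.\<close>
  define C where "C = C1 + \<bar>C2\<bar>"
  have C: "C > 0" "C1 \<le> C" "C2 \<le> C" "2 \<le> C" using C1 by (auto simp: C_def)

  have i: "(\<exists>!\<mu>. stationary_measure f \<kappa> b \<nu> \<mu>) \<and>
      (\<exists>g. is_random_series M' \<eta> f \<kappa> b g) \<and>
      (\<forall>g. is_random_series M' \<eta> f \<kappa> b g \<longrightarrow> stationary_measure f \<kappa> b \<nu> (distr M' L2_zero_borel g))"
    if "\<kappa> > 0" for \<kappa>
  proof -
    interpret noise_chain f \<kappa> b \<nu> by (rule chain[OF that])
    show ?thesis
      using stationary_stationary_law stationary_measure_unique random_series_exists[OF iid]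
        random_series_law[OF iid] by metis
  qed

  have ii: "(\<forall>N::real. 2 \<le> N \<and> N \<le> \<kappa> powr (-1/2) \<longrightarrow>
        integrable M' (\<lambda>w. (L2_norm (proj_le N (g w)))\<^sup>2) \<and>
        1 / (2 * Lambda_of f) * ln N - C
          \<le> prob_space.expectation M' (\<lambda>w. (L2_norm (proj_le N (g w)))\<^sup>2) \<and>
        prob_space.expectation M' (\<lambda>w. (L2_norm (proj_le N (g w)))\<^sup>2) \<le> 2 / \<gamma> * ln N + C) \<and>
      integrable M' (\<lambda>w. (L2_norm (proj_ge (\<kappa> powr (-1/2)) (g w)))\<^sup>2) \<and>
      prob_space.expectation M' (\<lambda>w. (L2_norm (proj_ge (\<kappa> powr (-1/2)) (g w)))\<^sup>2) \<le> C"
    if \<kappa>: "\<kappa> > 0" and g: "is_random_series M' \<eta> f \<kappa> b g" for \<kappa> g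
  proof -
    interpret stationary_solution f M' \<eta> \<kappa> b g by (rule solution[OF \<kappa> g])
    have high: "(\<Sum>n<m. (L2_norm (proj_ge (\<kappa> powr (-1/2)) (iterate n)))\<^sup>2) \<le> 2" for m
      using sum_high_modes_le[OF \<kappa> b, of m] \<open>L2_norm b = 1\<close> by simp
    show ?thesis
    proof (intro conjI allI impI)
      fix N :: real assume "2 \<le> N \<and> N \<le> \<kappa> powr (-1/2)"
      then have N: "N \<ge> 1" "\<kappa> * N\<^sup>2 \<le> 1" and L: "0 \<le> ln N"
        using scale_condition[OF \<kappa>, of N] by auto
      show "integrable M' (\<lambda>w. (L2_norm (proj_le N (g w)))\<^sup>2)" by (rule proj_le_second_moment)
      have "ln N / \<gamma> \<le> 2 / \<gamma> * ln N" using L \<gamma> by (simp add: divide_right_mono)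
      then show "expectation (\<lambda>w. (L2_norm (proj_le N (g w)))\<^sup>2) \<le> 2 / \<gamma> * ln N + C"
        using low_modes_second_moment_upper[OF \<open>L2_norm b = 1\<close> N(1) \<gamma> A(1) A(2)] \<kappa> C(2)
        unfolding C1_def by fastforce
      show "1 / (2 * Lambda_of f) * ln N - C \<le> expectation (\<lambda>w. (L2_norm (proj_le N (g w)))\<^sup>2)"
      proof (cases "Lambda_of f > 0")
        case True
        have "1 / (2 * Lambda_of f) * ln N \<le> ln N / Lambda_of f"
          using L True by (simp add: field_simps)
        then show ?thesis
          using low_modes_second_moment_lower[OF \<open>L2_norm b = 1\<close> N B True] C(3)
          unfolding C2_def E_def by linarith
      next
        case False \<comment> \<open>The bound is void here, also for \<open>Lambda_of f = 0\<close>, where \<open>1 / 0 = 0\<close>.\<close>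
        then have "1 / (2 * Lambda_of f) * ln N \<le> 0"
          using L by (intro mult_nonpos_nonneg) (auto simp: divide_nonpos_nonneg)
        moreover have "0 \<le> expectation (\<lambda>w. (L2_norm (proj_le N (g w)))\<^sup>2)" by simp
        ultimately show ?thesis using C(1) by linarith
      qed
    next
      show "integrable M' (\<lambda>w. (L2_norm (proj_ge (\<kappa> powr (-1/2)) (g w)))\<^sup>2)"
        by (rule proj_ge_second_moment[OF high])
      show "expectation (\<lambda>w. (L2_norm (proj_ge (\<kappa> powr (-1/2)) (g w)))\<^sup>2) \<le> C"
        using proj_ge_second_moment(2)[OF high] C(4) by linarith
    qed
  qed
  show ?thesis
    using i ii C(1) zero_less_one by (intro conjI exI[of _ C] exI[of _ "1 :: real"]) blast+
qed

end
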